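(* Let $a\ge 2$ be an integer, let $(X,\mathcal{B},\mu,T)$ be an aperiodic ergodic measure preserving system with entropy equal to $h<\log a$, and let $\boldsymbol{\mathcal{P}}_a$ be the space of labelled partitions of $X$ into $a$ elements that define processes with entropy equal to $h$. Then there is a dense $G_\delta$ subset of $\boldsymbol{\mathcal{P}}_a$ all of whose elements are generators.
   Context: $(X,\mathcal{B},\mu)$ is a standard probability space and $T$ is an invertible, $\mu$-preserving, ergodic transformation; aperiodic means that the set of $T$-periodic points is null. A labelled partition into $a$ elements is an ordered $a$-tuple $\mathcal{P}=(P_1,\dots,P_a)$ of pairwise disjoint measurable sets (possibly null) with union $X$, modulo null sets; the space of these is a complete separable metric space under $d(\mathcal{P},\mathcal{P}')=\frac12\sum_i\mu(P_i\triangle P_i')$. The entropy of the process defined by $\mathcal{P}$ is $h(T,\mathcal{P})=\lim_n\frac1nH(\bigvee_{i=0}^{n-1}T^{-i}\mathcal{P})$, with the same base of logarithm as in $\log a$. By continuity of $\mathcal{P}\mapsto h(T,\mathcal{P})$, the set $\boldsymbol{\mathcal{P}}_a=\{\mathcal{P}:h(T,\mathcal{P})=h\}$ is closed, and it carries the induced metric. A partition $\mathcal{P}$ is a generator if $\bigvee_{n\in\mathbb{Z}}T^{-n}\mathcal{P}=\mathcal{B}$ modulo null sets. *)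

theory Defs
  imports "HOL-Probability.Probability"
begin

section \<open>Standard probability spaces and their automorphisms\<close>

definition standard_borel :: "'a measure \<Rightarrow> bool" where
  "standard_borel N \<longleftrightarrow>
     (\<exists>\<tau>. completely_metrizable_space \<tau> \<and> second_countable \<tau> \<and> topspace \<tau> = space N \<and>
          sets N = sigma_sets (space N) {U. openin \<tau> U})"

text \<open>Both common conventions are admitted: the Borel sets of a Polish topology, and their
  completion with respect to the measure.\<close>

definition standard_prob_space :: "'a measure \<Rightarrow> bool" where
  "standard_prob_space M \<longleftrightarrow>
     prob_space M \<and> (\<exists>N. standard_borel N \<and> (M = N \<or> M = completion N))"

definition invertible_mpt :: "'a measure \<Rightarrow> ('a \<Rightarrow> 'a) \<Rightarrow> bool" where
  "invertible_mpt M T \<longleftrightarrow>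
     bij_betw T (space M) (space M) \<and> T \<in> measurable M M \<and>
     inv_into (space M) T \<in> measurable M M \<and> distr M M T = M"

definition ergodic :: "'a measure \<Rightarrow> ('a \<Rightarrow> 'a) \<Rightarrow> bool" where
  "ergodic M T \<longleftrightarrow>
     (\<forall>A\<in>sets M. T -` A \<inter> space M = A \<longrightarrow> measure M A = 0 \<or> measure M A = 1)"

definition aperiodic :: "'a measure \<Rightarrow> ('a \<Rightarrow> 'a) \<Rightarrow> bool" where
  "aperiodic M T \<longleftrightarrow> (AE x in M. \<forall>n\<ge>1. (T ^^ n) x \<noteq> x)"

definition int_iterate :: "'a measure \<Rightarrow> ('a \<Rightarrow> 'a) \<Rightarrow> int \<Rightarrow> 'a \<Rightarrow> 'a" where
  "int_iterate M T n =
     (if 0 \<le> n then T ^^ nat n else inv_into (space M) T ^^ nat (- n))"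

section \<open>Labelled partitions\<close>

text \<open>The labels are \<open>0, \<dots>, a - 1\<close>. The set below consists of honest tuples;
  null sets are divided out afterwards.\<close>

definition labelled_partitions :: "'a measure \<Rightarrow> nat \<Rightarrow> (nat \<Rightarrow> 'a set) set" where
  "labelled_partitions M a =
     {P \<in> {..<a} \<rightarrow>\<^sub>E sets M. disjoint_family_on P {..<a} \<and> (\<Union>i<a. P i) = space M}"

definition partition_rel :: "'a measure \<Rightarrow> nat \<Rightarrow> ((nat \<Rightarrow> 'a set) \<times> (nat \<Rightarrow> 'a set)) set" where
  "partition_rel M a =
     {(P, Q). P \<in> labelled_partitions M a \<and> Q \<in> labelled_partitions M a \<and>
              (\<forall>i<a. sym_diff (P i) (Q i) \<in> null_sets M)}"

definition partition_classes :: "'a measure \<Rightarrow> nat \<Rightarrow> (nat \<Rightarrow> 'a set) set set" where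
  "partition_classes M a = labelled_partitions M a // partition_rel M a"

definition tuple_dist ::
    "'a measure \<Rightarrow> nat \<Rightarrow> (nat \<Rightarrow> 'a set) \<Rightarrow> (nat \<Rightarrow> 'a set) \<Rightarrow> real" where
  "tuple_dist M a P Q = (1/2) * (\<Sum>i<a. measure M (sym_diff (P i) (Q i)))"

text \<open>The value does not depend on the chosen representatives, see
  \<open>partition_dist_class\<close> below.\<close>

definition partition_dist ::
    "'a measure \<Rightarrow> nat \<Rightarrow> (nat \<Rightarrow> 'a set) set \<Rightarrow> (nat \<Rightarrow> 'a set) set \<Rightarrow> real" where
  "partition_dist M a C D = tuple_dist M a (SOME P. P \<in> C) (SOME Q. Q \<in> D)"

definition partition_topology :: "'a measure \<Rightarrow> nat \<Rightarrow> (nat \<Rightarrow> 'a set) set topology" where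
  "partition_topology M a = Metric_space.mtopology (partition_classes M a) (partition_dist M a)"

section \<open>Entropy and generators\<close>

text \<open>Atoms of the join of \<open>T\<^sup>-\<^sup>i P\<close> over \<open>i < n\<close> are indexed by words
  of length \<open>n\<close>; empty atoms contribute \<open>0\<close>, since \<open>0 * log b 0 = 0\<close>.\<close>

definition join_atom ::
    "'a measure \<Rightarrow> ('a \<Rightarrow> 'a) \<Rightarrow> (nat \<Rightarrow> 'a set) \<Rightarrow> nat \<Rightarrow> (nat \<Rightarrow> nat) \<Rightarrow> 'a set" where
  "join_atom M T P n w = {x \<in> space M. \<forall>i<n. (T ^^ i) x \<in> P (w i)}"

definition join_entropy ::
    "real \<Rightarrow> 'a measure \<Rightarrow> ('a \<Rightarrow> 'a) \<Rightarrow> nat \<Rightarrow> (nat \<Rightarrow> 'a set) \<Rightarrow> nat \<Rightarrow> real" where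
  "join_entropy b M T a P n =
     - (\<Sum>w \<in> {..<n} \<rightarrow>\<^sub>E {..<a}.
          measure M (join_atom M T P n w) * log b (measure M (join_atom M T P n w)))"

definition process_entropy ::
    "real \<Rightarrow> 'a measure \<Rightarrow> ('a \<Rightarrow> 'a) \<Rightarrow> nat \<Rightarrow> (nat \<Rightarrow> 'a set) \<Rightarrow> real" where
  "process_entropy b M T a P = lim (\<lambda>n. join_entropy b M T a P n / real n)"

definition system_entropy :: "real \<Rightarrow> 'a measure \<Rightarrow> ('a \<Rightarrow> 'a) \<Rightarrow> ereal" where
  "system_entropy b M T =
     (SUP (k, P) \<in> (SIGMA k:UNIV. labelled_partitions M k). ereal (process_entropy b M T k P))"

text \<open>The generated sigma-algebra is always contained in \<open>sets M\<close>, so equality modulo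
  null sets amounts to approximating every measurable set.\<close>

definition generator :: "'a measure \<Rightarrow> ('a \<Rightarrow> 'a) \<Rightarrow> nat \<Rightarrow> (nat \<Rightarrow> 'a set) \<Rightarrow> bool" where
  "generator M T a P \<longleftrightarrow>
     (\<forall>B\<in>sets M.
        \<exists>A \<in> sigma_sets (space M) {int_iterate M T n -` P i \<inter> space M | n i. i < a}.
          sym_diff A B \<in> null_sets M)"

definition full_entropy_classes ::
    "real \<Rightarrow> 'a measure \<Rightarrow> ('a \<Rightarrow> 'a) \<Rightarrow> nat \<Rightarrow> real \<Rightarrow> (nat \<Rightarrow> 'a set) set set" where
  "full_entropy_classes b M T a h =
     {partition_rel M a `` {P} | P. P \<in> labelled_partitions M a \<and> process_entropy b M T a P = h}"

definition full_entropy_space ::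
    "real \<Rightarrow> 'a measure \<Rightarrow> ('a \<Rightarrow> 'a) \<Rightarrow> nat \<Rightarrow> real \<Rightarrow> (nat \<Rightarrow> 'a set) set topology" where
  "full_entropy_space b M T a h =
     subtopology (partition_topology M a) (full_entropy_classes b M T a h)"

section \<open>The metric on classes of partitions\<close>

lemma labelled_partitions_sets:
  "P \<in> labelled_partitions M a \<Longrightarrow> i < a \<Longrightarrow> P i \<in> sets M"
  by (auto simp: labelled_partitions_def)

lemma measure_sym_diff_triangle:
  assumes "prob_space M" "A \<in> sets M" "B \<in> sets M" "C \<in> sets M"
  shows "measure M (sym_diff A C) \<le> measure M (sym_diff A B) + measure M (sym_diff B C)"
proof -
  interpret prob_space M by fact
  have "measure M (sym_diff A C) \<le> measure M (sym_diff A B \<union> sym_diff B C)"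
    using assms by (intro finite_measure_mono) auto
  also have "\<dots> \<le> measure M (sym_diff A B) + measure M (sym_diff B C)"
    using assms by (intro measure_Un_le) auto
  finally show ?thesis .
qed

lemma tuple_dist_nonneg: "0 \<le> tuple_dist M a P Q"
  by (auto simp: tuple_dist_def intro!: sum_nonneg)

lemma tuple_dist_commute: "tuple_dist M a P Q = tuple_dist M a Q P"
  by (simp add: tuple_dist_def Un_commute)

lemma tuple_dist_triangle:
  assumes "prob_space M" "P \<in> labelled_partitions M a" "Q \<in> labelled_partitions M a"
    "R \<in> labelled_partitions M a"
  shows "tuple_dist M a P R \<le> tuple_dist M a P Q + tuple_dist M a Q R"
proof -
  have "(\<Sum>i<a. measure M (sym_diff (P i) (R i)))
      \<le> (\<Sum>i<a. measure M (sym_diff (P i) (Q i)) + measure M (sym_diff (Q i) (R i)))"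
    using assms by (intro sum_mono measure_sym_diff_triangle labelled_partitions_sets) auto
  then show ?thesis by (simp add: tuple_dist_def sum.distrib)
qed

lemma tuple_dist_eq_0:
  assumes "prob_space M" "P \<in> labelled_partitions M a" "Q \<in> labelled_partitions M a"
  shows "tuple_dist M a P Q = 0 \<longleftrightarrow> (P, Q) \<in> partition_rel M a"
proof -
  interpret prob_space M by fact
  have "measure M (sym_diff (P i) (Q i)) = 0 \<longleftrightarrow> sym_diff (P i) (Q i) \<in> null_sets M"
    if "i < a" for i
    using that labelled_partitions_sets[OF assms(2)] labelled_partitions_sets[OF assms(3)]
    by (auto simp: null_sets_def emeasure_eq_measure)
  then show ?thesis
    using assms by (auto simp: tuple_dist_def partition_rel_def sum_nonneg_eq_0_iff)
qed

lemma equiv_partition_rel: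
  assumes "prob_space M"
  shows "equiv (labelled_partitions M a) (partition_rel M a)"
proof (rule equivI)
  show "refl_on (labelled_partitions M a) (partition_rel M a)"
    by (auto simp: refl_on_def partition_rel_def)
  show "partition_rel M a \<subseteq> labelled_partitions M a \<times> labelled_partitions M a"
    by (auto simp: partition_rel_def)
  show "sym (partition_rel M a)"
    by (auto simp: sym_def partition_rel_def Un_commute)
  show "trans (partition_rel M a)"
  proof (rule transI)
    fix P Q R assume PQ: "(P, Q) \<in> partition_rel M a" and QR: "(Q, R) \<in> partition_rel M a"
    then have mem: "P \<in> labelled_partitions M a" "Q \<in> labelled_partitions M a"
      "R \<in> labelled_partitions M a"
      by (auto simp: partition_rel_def)
    have "tuple_dist M a P Q = 0" "tuple_dist M a Q R = 0"
      using PQ QR tuple_dist_eq_0[OF assms] mem by auto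
    then have "tuple_dist M a P R \<le> 0"
      using tuple_dist_triangle[OF assms mem] by simp
    then show "(P, R) \<in> partition_rel M a"
      using tuple_dist_eq_0[OF assms mem(1,3)] tuple_dist_nonneg[of M a P R] by simp
  qed
qed

lemma tuple_dist_cong:
  assumes "prob_space M" "(P, P') \<in> partition_rel M a" "(Q, Q') \<in> partition_rel M a"
  shows "tuple_dist M a P Q = tuple_dist M a P' Q'"
proof -
  have le: "tuple_dist M a P Q \<le> tuple_dist M a P' Q'"
    if r: "(P, P') \<in> partition_rel M a" "(Q, Q') \<in> partition_rel M a" for P P' Q Q'
  proof -
    have mem: "P \<in> labelled_partitions M a" "P' \<in> labelled_partitions M a"
      "Q \<in> labelled_partitions M a" "Q' \<in> labelled_partitions M a"
      using r by (auto simp: partition_rel_def)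
    have "tuple_dist M a P P' = 0" "tuple_dist M a Q Q' = 0"
      using tuple_dist_eq_0[OF assms(1)] mem r by auto
    then show ?thesis
      using tuple_dist_triangle[OF assms(1) mem(1,2,3)]
        tuple_dist_triangle[OF assms(1) mem(2,4,3)] tuple_dist_commute[of M a Q Q'] by simp
  qed
  have "(P', P) \<in> partition_rel M a" "(Q', Q) \<in> partition_rel M a"
    using equiv_partition_rel[OF assms(1)] assms(2,3) by (auto simp: equiv_def sym_def)
  then show ?thesis using le assms(2,3) by (meson order_antisym)
qed

lemma some_rep_partition_rel:
  assumes "prob_space M" "P \<in> labelled_partitions M a"
  shows "(P, SOME P'. P' \<in> partition_rel M a `` {P}) \<in> partition_rel M a"
proof -
  have "P \<in> partition_rel M a `` {P}"
    using equiv_class_self[OF equiv_partition_rel[OF assms(1)] assms(2)] .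
  then have "(SOME P'. P' \<in> partition_rel M a `` {P}) \<in> partition_rel M a `` {P}"
    by (rule someI[where P = "\<lambda>P'. P' \<in> partition_rel M a `` {P}"])
  then show ?thesis by simp
qed

lemma partition_dist_class:
  assumes "prob_space M" "P \<in> labelled_partitions M a" "Q \<in> labelled_partitions M a"
  shows "partition_dist M a (partition_rel M a `` {P}) (partition_rel M a `` {Q})
       = tuple_dist M a P Q"
  unfolding partition_dist_def
  by (rule tuple_dist_cong[OF assms(1), symmetric]; rule some_rep_partition_rel) fact+

lemma Metric_space_partition_classes:
  assumes "prob_space M"
  shows "Metric_space (partition_classes M a) (partition_dist M a)"
proof
  show "0 \<le> partition_dist M a C D" for C D
    by (simp add: partition_dist_def tuple_dist_nonneg)
  show "partition_dist M a C D = partition_dist M a D C" for C D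
    by (simp add: partition_dist_def tuple_dist_commute)
next
  fix C D assume "C \<in> partition_classes M a" "D \<in> partition_classes M a"
  then obtain P Q where "P \<in> labelled_partitions M a" "C = partition_rel M a `` {P}"
    "Q \<in> labelled_partitions M a" "D = partition_rel M a `` {Q}"
    by (auto simp: partition_classes_def elim!: quotientE)
  then show "partition_dist M a C D = 0 \<longleftrightarrow> C = D"
    using eq_equiv_class_iff[OF equiv_partition_rel[OF assms]]
    by (simp add: partition_dist_class assms tuple_dist_eq_0)
next
  fix C D E
  assume "C \<in> partition_classes M a" "D \<in> partition_classes M a" "E \<in> partition_classes M a"
  then obtain P Q R where "P \<in> labelled_partitions M a" "C = partition_rel M a `` {P}"
    "Q \<in> labelled_partitions M a" "D = partition_rel M a `` {Q}"
    "R \<in> labelled_partitions M a" "E = partition_rel M a `` {R}"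
    by (auto simp: partition_classes_def elim!: quotientE)
  then show "partition_dist M a C E \<le> partition_dist M a C D + partition_dist M a D E"
    by (simp add: partition_dist_class assms tuple_dist_triangle)
qed

end

theory Submission
  imports Defs "HOL-Real_Asymp.Real_Asymp"
begin

text \<open>Generators are those partitions whose names determine every set of a countable base up to
  arbitrarily small error; each such requirement is stable under small changes of the partition, so
  generators form a \<open>G\<^sub>\<delta>\<close> set. For density, let \<open>p\<close> have nearly full entropy and let \<open>q\<close> be any
  finite partition. On a Rokhlin tower of large height \<open>n\<close>, given the \<open>p\<close>-name of a column there are at
  most \<open>b powr (\<delta> n)\<close> likely \<open>q\<close>-names, where \<open>\<delta>\<close> is the entropy deficit of \<open>p\<close>. An initial segment of
  length \<open>k = \<epsilon> n\<close> carries about \<open>b powr (h k)\<close> likely \<open>p\<close>-names but has room for \<open>a ^ k\<close> words. As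
  \<open>h < log b a\<close>, it can be overwritten by a code for its own \<open>p\<close>-name and for the \<open>q\<close>-name of the whole
  column, with space left for a marker that identifies the base of the tower. The new partition
  determines \<open>q\<close> approximately, so it has nearly full entropy again, and the step can be iterated.

  A decoder with window \<open>m\<close> only sees whether some change occurs within distance \<open>m\<close>. Since the
  overwritten positions are long segments plus a set of very small density, this has probability
  less than \<open>\<epsilon>\<close> for every prescribed \<open>m\<close>, while the admissible entropy deficit depends on \<open>\<epsilon>\<close> alone.
  Therefore the deficits can be fixed before the windows of earlier decoders are known, and the
  limit keeps all of them.\<close>

section \<open>Entropy of simple functions\<close>

text \<open>Only upper bounds on numbers of names are ever needed. One side of the ergodic theorem,
  applied to conditional probabilities that look at finitely many letters, supplies them in place of
  the Shannon-McMillan theorem. Decoders are sliding block codes of finite window, since these vary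
  continuously with the partition and cannot raise entropy. The limit must have entropy exactly
  \<open>h\<close>, so each step encodes, besides the set to be approximated, a partition whose
  entropy is as close to \<open>h\<close> as desired; decoding it bounds the entropy of the new
  partition from below.

  For a column of height \<open>n = J * k\<close> and \<open>\<gamma> = log b a - h\<close>, the
  surplus \<open>\<gamma> * k\<close> of the initial segment is split into four equal shares: one
  for the \<open>q\<close>-name of the column, one for the error in counting \<open>p\<close>-names,
  two for markers and synchronising letters. The first share forces
  \<open>\<delta> = \<gamma> / (4 * J)\<close>, which depends on \<open>\<epsilon>\<close> only
  through \<open>J\<close>.\<close>

lemma (in prob_space) prob_UN_geometric_le:
  assumes W: "\<And>i. W i \<in> sets M" and le: "\<And>i. prob (W i) \<le> c * (1/2) ^ i"
  shows "prob (\<Union>i::nat. W i) \<le> 2 * c"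
proof -
  have sums: "(\<lambda>i. c * (1/2) ^ i) sums (c * (1 / (1 - 1/2)))"
    by (intro sums_mult geometric_sums) simp
  have sm: "summable (\<lambda>i. prob (W i))"
    by (rule summable_comparison_test'[OF sums_summable[OF sums]]) (use le in auto)
  have "prob (\<Union>i. W i) \<le> (\<Sum>i. prob (W i))"
    using W by (intro finite_measure_subadditive_countably sm) auto
  also have "\<dots> \<le> (\<Sum>i. c * (1/2) ^ i)" by (rule suminf_le[OF le sm sums_summable[OF sums]])
  also have "\<dots> = c * (1 / (1 - 1/2))" using sums by (rule sums_unique[symmetric])
  finally show ?thesis by simp
qed

locale mp_system = prob_space M for M :: "'a measure" +
  fixes b :: real and T :: "'a \<Rightarrow> 'a"
  assumes b_gt_1: "1 < b" and invertible: "invertible_mpt M T"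
begin

sublocale information_space M b
  by unfold_locales (rule b_gt_1)

definition point_prob :: "('a \<Rightarrow> 'c) \<Rightarrow> 'a \<Rightarrow> real" where
  "point_prob X x = prob {y \<in> space M. X y = X x}"

text \<open>Shannon entropy as the mean of the information function, so that inequalities can be
  checked pointwise almost everywhere; \<open>ent_eq_sum\<close> recovers the usual sum.\<close>

definition ent :: "('a \<Rightarrow> 'c) \<Rightarrow> real" where
  "ent X = expectation (\<lambda>x. - log b (point_prob X x))"

abbreviation simple :: "('a \<Rightarrow> 'c) \<Rightarrow> bool" where
  "simple \<equiv> simple_function M"

abbreviation differ :: "('a \<Rightarrow> 'c) \<Rightarrow> ('a \<Rightarrow> 'c) \<Rightarrow> 'a set" where
  "differ p q \<equiv> {x \<in> space M. p x \<noteq> q x}"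

lemma simple_level_set:
  assumes "simple X" shows "{y \<in> space M. X y = c} \<in> sets M"
proof (cases "c \<in> X ` space M")
  case True
  then have "X -` {c} \<inter> space M \<in> sets M" using assms unfolding simple_function_def by blast
  moreover have "X -` {c} \<inter> space M = {y \<in> space M. X y = c}" by auto
  ultimately show ?thesis by simp
next
  case False
  then have "{y \<in> space M. X y = c} = {}" by auto
  then show ?thesis by (simp only: sets.empty_sets)
qed

lemma simple_pred_sets:
  assumes X: "simple X" shows "{y \<in> space M. R (X y)} \<in> sets M"
proof -
  have "{y \<in> space M. R (X y)} = (\<Union>c\<in>X ` space M \<inter> {c. R c}. {y \<in> space M. X y = c})" by auto
  moreover have "\<dots> \<in> sets M"
    using X by (intro sets.finite_UN simple_level_set) (auto simp: simple_function_def)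
  ultimately show ?thesis by simp
qed

lemma differ_sets:
  assumes "simple p" "simple q" shows "differ p q \<in> sets M"
  using simple_pred_sets[OF simple_function_Pair[OF assms], of "\<lambda>(u, v). u \<noteq> v"] by simp

lemma simple_factor:
  assumes "simple X" "\<And>x. x \<in> space M \<Longrightarrow> Y x = f (X x)"
  shows "simple Y"
proof -
  have "simple (\<lambda>x. f (X x))" using assms(1) by (rule simple_function_compose1)
  then show ?thesis using simple_function_cong[of M Y "\<lambda>x. f (X x)"] assms(2) by auto
qed

lemma expectation_simple:
  fixes f :: "'c \<Rightarrow> real"
  assumes X: "simple X" and S: "finite S" "X ` space M \<subseteq> S"
  shows "expectation (\<lambda>x. f (X x)) = (\<Sum>c\<in>S. f c * prob {y \<in> space M. X y = c})"
proof -
  have "expectation (\<lambda>x. f (X x))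
      = expectation (\<lambda>x. \<Sum>c\<in>S. f c * indicator {y \<in> space M. X y = c} x)"
  proof (rule Bochner_Integration.integral_cong[OF refl])
    fix x assume x: "x \<in> space M"
    have "(\<Sum>c\<in>S. f c * indicator {y \<in> space M. X y = c} x) = (\<Sum>c\<in>S. if c = X x then f c else 0)"
      using x by (intro sum.cong) (auto simp: indicator_def)
    also have "\<dots> = f (X x)" using S x by (subst sum.delta) auto
    finally show "f (X x) = (\<Sum>c\<in>S. f c * indicator {y \<in> space M. X y = c} x)" ..
  qed
  also have "\<dots> = (\<Sum>c\<in>S. f c * prob {y \<in> space M. X y = c})"
    using simple_level_set[OF X] S
    by (subst Bochner_Integration.integral_sum) (auto simp: integrable_mult_right_iff emeasure_eq_measure)
  finally show ?thesis .
qed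

lemma integrable_simple:
  fixes f :: "'c \<Rightarrow> real"
  assumes X: "simple X" shows "integrable M (\<lambda>x. f (X x))"
proof -
  have sf: "simple (\<lambda>x. f (X x))" by (rule simple_function_compose1[OF X])
  then show ?thesis
    by (auto intro!: integrable_simple_function simp: emeasure_eq_measure)
qed

lemma point_prob_factor:
  "point_prob X = (\<lambda>x. (\<lambda>c. prob {y \<in> space M. X y = c}) (X x))"
  by (simp add: point_prob_def fun_eq_iff)

lemma integrable_log_point_prob:
  "simple X \<Longrightarrow> integrable M (\<lambda>x. log b (point_prob X x))"
  unfolding point_prob_factor by (rule integrable_simple)

lemma ent_eq_sum:
  assumes "simple X" "finite S" "X ` space M \<subseteq> S"
  shows "ent X = - (\<Sum>c\<in>S. prob {y \<in> space M. X y = c} * log b (prob {y \<in> space M. X y = c}))"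
  using expectation_simple[OF assms, of "\<lambda>c. - log b (prob {y \<in> space M. X y = c})"]
  unfolding ent_def point_prob_factor by (simp add: sum_negf mult.commute)

text \<open>Only finitely many values occur, so those of probability zero make up a null set. Off
  it, logarithms are monotone and additive; on it \<open>log b 0 = 0\<close> would spoil
  both.\<close>

lemma AE_point_prob_pos:
  assumes X: "simple X" shows "AE x in M. 0 < point_prob X x"
proof -
  let ?N = "\<Union>c\<in>{c \<in> X ` space M. prob {y \<in> space M. X y = c} = 0}. {y \<in> space M. X y = c}"
  have "?N \<in> null_sets M"
  proof (intro null_sets_UN')
    show "countable {c \<in> X ` space M. prob {y \<in> space M. X y = c} = 0}"
      using X by (auto simp: simple_function_def intro: countable_finite)
  qed (use simple_level_set[OF X] in \<open>auto simp: null_sets_def emeasure_eq_measure\<close>)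
  then show ?thesis
    by (rule AE_I') (auto simp: point_prob_def zero_less_measure_iff)
qed

lemma point_prob_le_1: "point_prob X x \<le> 1"
  by (simp add: point_prob_def)

lemma point_prob_anti:
  assumes "simple X" "simple Y" "\<And>x. x \<in> space M \<Longrightarrow> Y x = f (X x)" "x \<in> space M"
  shows "point_prob X x \<le> point_prob Y x"
  unfolding point_prob_def
  using assms by (intro finite_measure_mono simple_level_set) auto

lemma ent_factor_le:
  assumes X: "simple X" and Y: "\<And>x. x \<in> space M \<Longrightarrow> Y x = f (X x)"
  shows "ent Y \<le> ent X"
  unfolding ent_def
proof (rule integral_mono_AE)
  have sY: "simple Y" using simple_factor[where f=f, OF X] Y by blast
  show "integrable M (\<lambda>x. - log b (point_prob X x))" "integrable M (\<lambda>x. - log b (point_prob Y x))"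
    using integrable_log_point_prob X sY by auto
  show "AE x in M. - log b (point_prob Y x) \<le> - log b (point_prob X x)"
    using AE_point_prob_pos[OF X] AE_space
  proof eventually_elim
    case (elim x)
    then show ?case using point_prob_anti[OF X sY Y] b_gt_1
      by (smt (verit) log_le_cancel_iff)
  qed
qed

lemma ent_cong: "(\<And>x. x \<in> space M \<Longrightarrow> X x = Y x) \<Longrightarrow> ent X = ent Y"
  unfolding ent_def point_prob_def
  by (intro Bochner_Integration.integral_cong refl arg_cong[where f="\<lambda>A. - log b (prob A)"]) auto

lemma ent_nonneg: assumes X: "simple X" shows "0 \<le> ent X"
  unfolding ent_def
  using AE_point_prob_pos[OF X] point_prob_le_1 b_gt_1
  by (intro integral_nonneg_AE) (auto elim!: eventually_mono simp: point_prob_def)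

lemma ent_const: "ent (\<lambda>x. c) = 0"
  by (simp add: ent_def point_prob_def prob_space)

text \<open>Non-negativity of the conditional mutual information, I(X; Y | Z) = H(X,Z) + H(Y,Z) -
  H(X,Y,Z) - H(Z). Both the existence of the entropy rate and its continuity rest on it.\<close>

lemma ent_submodular:
  assumes X: "simple X" and Y: "simple Y" and Z: "simple Z"
  shows "ent (\<lambda>x. (X x, Y x, Z x)) + ent Z \<le> ent (\<lambda>x. (X x, Z x)) + ent (\<lambda>x. (Y x, Z x))"
proof -
  let ?P = "\<lambda>X v. prob {y \<in> space M. X y = v}"
  let ?XYZ = "\<lambda>x. (X x, Y x, Z x)" and ?XZ = "\<lambda>x. (X x, Z x)" and ?YZ = "\<lambda>x. (Y x, Z x)"
  have sf: "simple ?XZ" "simple ?YZ" "simple ?XYZ"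
    using X Y Z by (auto intro!: simple_function_Pair)
  have sd: "simple_distributed M W (\<lambda>v. prob {y \<in> space M. W y = v})" if "simple W" for W :: "'a \<Rightarrow> 'z"
    using that by (rule simple_distributedI)
      (auto intro!: arg_cong[where f=prob])
  define F where "F = (\<lambda>(x,y,z). log b (?P ?XYZ (x,y,z) / (?P ?XZ (x,z) * (?P ?YZ (y,z) / ?P Z z))))"
  have "0 \<le> \<I>(X ; Y | Z)" by (rule conditional_mutual_information_nonneg[OF X Y Z])
  also have "\<I>(X ; Y | Z) = (\<Sum>v\<in>?XYZ ` space M. F v * ?P ?XYZ v)"
    unfolding conditional_mutual_information_eq[OF sd[OF Z] sd[OF sf(2)] sd[OF sf(1)] sd[OF sf(3)]]
    by (auto intro!: sum.cong simp: F_def mult.commute)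
  also have "\<dots> = expectation (\<lambda>x. F (?XYZ x))"
    using sf(3) by (intro expectation_simple[symmetric]) (auto simp: simple_function_def)
  also have "\<dots> = expectation (\<lambda>x. (log b (point_prob ?XYZ x) + log b (point_prob Z x))
        - (log b (point_prob ?XZ x) + log b (point_prob ?YZ x)))"
  proof (rule integral_cong_AE)
    show "AE x in M. F (?XYZ x) = (log b (point_prob ?XYZ x) + log b (point_prob Z x))
        - (log b (point_prob ?XZ x) + log b (point_prob ?YZ x))"
      using AE_point_prob_pos[OF Z] AE_point_prob_pos[OF sf(1)] AE_point_prob_pos[OF sf(2)] AE_point_prob_pos[OF sf(3)]
    proof eventually_elim
      case (elim x)
      then show ?case using b_gt_1
        unfolding F_def by (simp add: point_prob_def log_divide log_mult)
    qed
  qed (use integrable_simple[OF sf(3), of F] integrable_log_point_prob[OF Z]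
       integrable_log_point_prob[OF sf(1)] integrable_log_point_prob[OF sf(2)] integrable_log_point_prob[OF sf(3)]
       in \<open>auto intro: borel_measurable_integrable\<close>)
  also have "\<dots> = (- ent ?XYZ - ent Z) + (ent ?XZ + ent ?YZ)"
    unfolding ent_def
    using integrable_log_point_prob[OF Z]
       integrable_log_point_prob[OF sf(1)] integrable_log_point_prob[OF sf(2)] integrable_log_point_prob[OF sf(3)]
    by simp
  finally show ?thesis by simp
qed

end

section \<open>Names and the entropy rate\<close>

text \<open>The only delicate point is 0, where the factor x makes the value agree with the limit of
  x log x. Compactness then gives the uniform continuity behind
  \<open>ent_cond_small\<close>.\<close>

lemma continuous_on_x_log:
  assumes "1 < b" shows "continuous_on {0..1} (\<lambda>x::real. - (x * log b x))"
  unfolding continuous_on_eq_continuous_within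
proof
  fix x :: real assume x: "x \<in> {0..1}"
  show "continuous (at x within {0..1}) (\<lambda>x. - (x * log b x))"
  proof (cases "x = 0")
    case True
    have "((\<lambda>x::real. - (x * (ln x / ln b))) \<longlongrightarrow> 0) (at_right 0)"
      using assms by real_asymp
    then have "((\<lambda>x::real. - (x * log b x)) \<longlongrightarrow> 0) (at_right 0)" by (simp add: log_def)
    moreover have "at 0 within {0..1} \<le> at_right (0::real)"
    proof -
      have "{0..1} - {0} = {0<..1} - {0::real}" by auto
      then have "at 0 within {0..1} = at (0::real) within {0<..1}" by (simp add: at_within_def)
      also have "\<dots> \<le> at_right 0" by (rule at_le) auto
      finally show ?thesis .
    qed
    ultimately show ?thesis using True by (auto simp: continuous_within intro: tendsto_mono)
  next
    case False
    then show ?thesis using x assms by (intro continuous_intros) auto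
  qed
qed

context mp_system begin

abbreviation Ti :: "'a \<Rightarrow> 'a" where "Ti \<equiv> inv_into (space M) T"

abbreviation differ_within :: "nat \<Rightarrow> ('a \<Rightarrow> 'c) \<Rightarrow> ('a \<Rightarrow> 'c) \<Rightarrow> 'a set" where
  "differ_within m p q \<equiv> {x \<in> space M. \<exists>j<m. p ((T ^^ j) x) \<noteq> q ((T ^^ j) x)}"

text \<open>For a tower of height \<open>n\<close> over \<open>F\<close> this is the complement of
  its levels F, T F, ..., up to the top one.\<close>

abbreviation uncovered :: "nat \<Rightarrow> 'a set \<Rightarrow> 'a set" where
  "uncovered n F \<equiv> {y \<in> space M. \<forall>i<n. (Ti ^^ i) y \<notin> F}"

definition measure_pres :: "('a \<Rightarrow> 'a) \<Rightarrow> bool" where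
  "measure_pres S \<longleftrightarrow> S \<in> measurable M M \<and> distr M M S = M"

lemma T_Ti[simp]: "x \<in> space M \<Longrightarrow> T (Ti x) = x"
  and Ti_T[simp]: "x \<in> space M \<Longrightarrow> Ti (T x) = x"
  using invertible unfolding invertible_mpt_def
  by (auto simp: bij_betw_def f_inv_into_f inv_into_f_f)

lemma measure_pres_T: "measure_pres T"
  using invertible by (simp add: measure_pres_def invertible_mpt_def)

lemma measure_pres_Ti: "measure_pres Ti"
  unfolding measure_pres_def
proof
  show m: "Ti \<in> measurable M M" using invertible by (simp add: invertible_mpt_def)
  have "distr M M Ti = distr (distr M M T) M Ti"
    using measure_pres_T by (simp add: measure_pres_def)
  also have "\<dots> = distr M M (Ti \<circ> T)"
    using m measure_pres_T by (intro distr_distr) (auto simp: measure_pres_def)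
  also have "\<dots> = distr M M (\<lambda>x. x)" by (intro distr_cong) auto
  finally show "distr M M Ti = M" by simp
qed

lemma measure_pres_comp: "measure_pres S \<Longrightarrow> measure_pres R \<Longrightarrow> measure_pres (S \<circ> R)"
  unfolding measure_pres_def by (auto simp: distr_distr[symmetric])

lemma measure_pres_pow: "measure_pres S \<Longrightarrow> measure_pres (S ^^ n)"
proof (induction n)
  case 0
  have "distr M M (id::'a\<Rightarrow>'a) = distr M M (\<lambda>x. x)" by (intro distr_cong) auto
  then show ?case by (simp add: measure_pres_def)
qed (simp add: measure_pres_comp)

lemmas mp_Tn = measure_pres_pow[OF measure_pres_T]
lemmas mp_Tin = measure_pres_pow[OF measure_pres_Ti]

lemma measure_pres_measurable: "measure_pres S \<Longrightarrow> S \<in> measurable M M"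
  by (simp add: measure_pres_def)

lemma Tn_measurable[measurable]: "T ^^ n \<in> measurable M M" "Ti ^^ n \<in> measurable M M"
  using mp_Tn mp_Tin by (auto simp: measure_pres_def)

lemma Tn_space[simp]:
  "x \<in> space M \<Longrightarrow> (T ^^ n) x \<in> space M" "x \<in> space M \<Longrightarrow> (Ti ^^ n) x \<in> space M"
  using measurable_space[OF Tn_measurable(1)] measurable_space[OF Tn_measurable(2)] by auto

lemma Tin_Tn[simp]: "x \<in> space M \<Longrightarrow> (Ti ^^ n) ((T ^^ n) x) = x"
proof (induction n arbitrary: x)
  case (Suc n)
  then show ?case by (subst funpow_Suc_right) simp
qed simp

lemma Tn_Tin[simp]: "x \<in> space M \<Longrightarrow> (T ^^ n) ((Ti ^^ n) x) = x"
proof (induction n arbitrary: x)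
  case (Suc n)
  then show ?case by (subst funpow_Suc_right) simp
qed simp

lemma Tn_Tin_le: "x \<in> space M \<Longrightarrow> m \<le> n \<Longrightarrow> (T ^^ m) ((Ti ^^ n) x) = (Ti ^^ (n - m)) x"
  using Tn_Tin[of "(Ti ^^ (n - m)) x" m] funpow_add[of m "n - m" Ti] by simp

lemma Tn_Tin_ge: "x \<in> space M \<Longrightarrow> n \<le> m \<Longrightarrow> (T ^^ m) ((Ti ^^ n) x) = (T ^^ (m - n)) x"
  using Tn_Tin[of x n] funpow_add[of "m - n" n T] by simp

lemma Tin_Tn_ge: "x \<in> space M \<Longrightarrow> m \<le> n \<Longrightarrow> (Ti ^^ m) ((T ^^ n) x) = (T ^^ (n - m)) x"
  using Tin_Tn[of "(T ^^ (n - m)) x" m] funpow_add[of m "n - m" T] by simp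

lemma prob_preimage:
  assumes "measure_pres S" "A \<in> sets M" shows "prob {x \<in> space M. S x \<in> A} = prob A"
proof -
  have "prob A = measure (distr M M S) A" using assms by (simp add: measure_pres_def)
  also have "\<dots> = prob (S -` A \<inter> space M)" using assms by (subst measure_distr) (auto simp: measure_pres_def)
  also have "S -` A \<inter> space M = {x \<in> space M. S x \<in> A}" by auto
  finally show ?thesis ..
qed

lemma simple_measure_pres:
  assumes "measure_pres S" "simple X" shows "simple (\<lambda>x. X (S x))"
proof -
  have "(\<lambda>x. X (S x)) ` space M \<subseteq> X ` space M"
    using measurable_space[OF measure_pres_measurable[OF assms(1)]] by auto
  moreover have "(\<lambda>x. X (S x)) \<in> measurable M (count_space UNIV)"
    using measurable_compose[OF measure_pres_measurable[OF assms(1)], of X "count_space UNIV"]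
      assms(2) by (simp add: simple_function_eq_measurable)
  ultimately show ?thesis
    using assms(2) finite_subset by (auto simp: simple_function_eq_measurable)
qed

lemma differ_within_sets:
  assumes "simple p" "simple q" shows "differ_within m p q \<in> sets M"
proof -
  have "differ (\<lambda>x. p ((T ^^ j) x)) (\<lambda>x. q ((T ^^ j) x)) \<in> sets M" for j
    by (rule differ_sets[OF simple_measure_pres[OF mp_Tn assms(1)] simple_measure_pres[OF mp_Tn assms(2)]])
  then have "(\<Union>j<m. differ (\<lambda>x. p ((T ^^ j) x)) (\<lambda>x. q ((T ^^ j) x))) \<in> sets M"
    by (intro sets.finite_UN finite_lessThan)
  also have "(\<Union>j<m. differ (\<lambda>x. p ((T ^^ j) x)) (\<lambda>x. q ((T ^^ j) x))) = differ_within m p q" by blast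
  finally show ?thesis .
qed

lemma ent_measure_pres:
  assumes S: "measure_pres S" and X: "simple X"
  shows "ent (\<lambda>x. X (S x)) = ent X"
proof -
  have "ent X = integral\<^sup>L (distr M M S) (\<lambda>x. - log b (point_prob X x))"
    using S by (simp add: measure_pres_def ent_def)
  also have "\<dots> = expectation (\<lambda>x. - log b (point_prob X (S x)))"
    using S integrable_log_point_prob[OF X]
    by (subst integral_distr) (auto simp: measure_pres_def)
  also have "\<dots> = ent (\<lambda>x. X (S x))"
    unfolding ent_def
  proof (intro Bochner_Integration.integral_cong refl)
    fix x assume "x \<in> space M"
    have "point_prob X (S x) = prob {y \<in> space M. S y \<in> {z \<in> space M. X z = X (S x)}}"
      unfolding point_prob_def using simple_level_set[OF X]
      by (subst prob_preimage[OF S]) auto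
    also have "\<dots> = point_prob (\<lambda>x. X (S x)) x"
      unfolding point_prob_def using measurable_space[OF measure_pres_measurable[OF S]]
      by (auto intro!: arg_cong[where f=prob])
    finally show "- log b (point_prob X (S x)) = - log b (point_prob (\<lambda>x. X (S x)) x)" by simp
  qed
  finally show ?thesis ..
qed

lemma ent_eqI:
  assumes X: "simple X" and "\<And>x. x \<in> space M \<Longrightarrow> Y x = f (X x)"
    and "\<And>x. x \<in> space M \<Longrightarrow> X x = g (Y x)"
  shows "ent X = ent Y"
proof (rule antisym)
  have Y: "simple Y" by (rule simple_factor[where f=f, OF X]) fact
  show "ent X \<le> ent Y" by (rule ent_factor_le[where f=g, OF Y]) fact
  show "ent Y \<le> ent X" by (rule ent_factor_le[where f=f, OF X]) fact
qed

definition names :: "('a \<Rightarrow> 'c) \<Rightarrow> nat \<Rightarrow> nat \<Rightarrow> 'a \<Rightarrow> 'c list" where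
  "names q i j x = map (\<lambda>l. q ((T ^^ l) x)) [i..<j]"

lemma length_names[simp]: "length (names q i j x) = j - i"
  by (simp add: names_def)

lemma nth_names[simp]: "l < j - i \<Longrightarrow> names q i j x ! l = q ((T ^^ (i + l)) x)"
  by (simp add: names_def)

lemma names_Suc: "i \<le> j \<Longrightarrow> names q i (Suc j) x = names q i j x @ [q ((T ^^ j) x)]"
  by (simp add: names_def)

lemma names_Cons: "i < j \<Longrightarrow> names q i j x = q ((T ^^ i) x) # names q (Suc i) j x"
  by (simp add: names_def upt_conv_Cons)

lemma names_shift: "names q i j ((T ^^ m) x) = names q (i + m) (j + m) x"
  by (rule nth_equalityI) (auto simp: funpow_add[symmetric] ac_simps simp flip: comp_apply[of "T ^^ _" "T ^^ _"])

lemma drop_take_names: "i + l \<le> j \<Longrightarrow> take l (drop i (names q 0 j x)) = names q i (i + l) x"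
  by (rule nth_equalityI) auto

lemma simple_names:
  assumes "simple q" shows "simple (names q i j)"
proof (induction j)
  case 0 show ?case by (simp add: names_def)
next
  case (Suc j)
  show ?case
  proof (cases "i \<le> j")
    case True
    show ?thesis unfolding names_Suc[OF True]
      by (rule simple_factor[where f="\<lambda>(u, v). u @ [v]",
            OF simple_function_Pair[OF Suc simple_measure_pres[OF mp_Tn[of j] assms]]])
         (simp add: names_Suc True)
  qed (simp add: names_def)
qed

text \<open>The two-sided name over the times -N, ..., N, read from its left end.\<close>

abbreviation window :: "nat \<Rightarrow> ('a \<Rightarrow> 'c) \<Rightarrow> 'a \<Rightarrow> 'c list" where
  "window N p x \<equiv> names p 0 (2 * N + 1) ((Ti ^^ N) x)"

definition rate :: "('a \<Rightarrow> 'c) \<Rightarrow> real" where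
  "rate q = lim (\<lambda>n. ent (names q 0 n) / real n)"

lemma ent_names_shift:
  assumes "simple q" shows "ent (names q (i + m) (j + m)) = ent (names q i j)"
proof -
  have "ent (names q (i + m) (j + m)) = ent (\<lambda>x. names q i j ((T ^^ m) x))"
    by (simp add: names_shift)
  then show ?thesis using ent_measure_pres[OF mp_Tn simple_names[OF assms]] by simp
qed

text \<open>Conditioning on a longer block lowers the entropy of the next letter: submodularity with
  the last letter, the first letter and the block between them, combined with stationarity.\<close>

lemma ent_names_concave:
  assumes q: "simple q"
  shows "ent (names q 0 (Suc (Suc n))) - ent (names q 0 (Suc n))
    \<le> ent (names q 0 (Suc n)) - ent (names q 0 n)"
proof -
  note sfT = simple_measure_pres[OF mp_Tn[of "Suc n"] q]
  let ?Z = "names q 1 (Suc n)" and ?X = "\<lambda>x. q ((T ^^ Suc n) x)"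
  have "ent (\<lambda>x. (?X x, q x, ?Z x)) + ent ?Z \<le> ent (\<lambda>x. (?X x, ?Z x)) + ent (\<lambda>x. (q x, ?Z x))"
    by (rule ent_submodular[OF sfT q simple_names[OF q]])
  moreover have "ent (\<lambda>x. (?X x, q x, ?Z x)) = ent (names q 0 (Suc (Suc n)))"
    by (rule ent_eqI[where f="\<lambda>(x,y,z). y # z @ [x]" and g="\<lambda>l. (last l, hd l, butlast (tl l))"])
       (auto simp: names_Cons[of 0] names_Suc[of "Suc 0"] intro!: simple_function_Pair sfT[simplified] q simple_names)
  moreover have "ent (\<lambda>x. (?X x, ?Z x)) = ent (names q 1 (Suc (Suc n)))"
    by (rule ent_eqI[where f="\<lambda>(x,z). z @ [x]" and g="\<lambda>l. (last l, butlast l)"])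
       (auto simp: names_Suc[of "Suc 0"] intro!: simple_function_Pair sfT[simplified] q simple_names)
  moreover have "ent (\<lambda>x. (q x, ?Z x)) = ent (names q 0 (Suc n))"
    by (rule ent_eqI[where f="\<lambda>(x,z). x # z" and g="\<lambda>l. (hd l, tl l)"])
       (auto simp: names_Cons[of 0] intro!: simple_function_Pair sfT[simplified] q simple_names)
  moreover have "ent (names q 1 (Suc n)) = ent (names q 0 n)"
    using ent_names_shift[OF q, of 0 1 n] by simp
  moreover have "ent (names q 1 (Suc (Suc n))) = ent (names q 0 (Suc n))"
    using ent_names_shift[OF q, of 0 1 "Suc n"] by simp
  ultimately show ?thesis by simp
qed

lemma names_0_0: "names q 0 0 = (\<lambda>x. [])"
  by (simp add: names_def fun_eq_iff)

text \<open>Since the increments \<open>d\<close> decrease, the average of the first n of them is at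
  least the next one, so the averages \<open>f n / n\<close> decrease as well. The index is shifted
  by one to stay away from division by 0.\<close>

lemma rate_LIMSEQ:
  assumes q: "simple q"
  shows "(\<lambda>n. ent (names q 0 n) / real n) \<longlonglongrightarrow> rate q"
proof -
  define f where "f n = ent (names q 0 n)" for n
  define d where "d n = f (Suc n) - f n" for n
  have f0: "f 0 = 0" by (simp add: f_def names_0_0 ent_const)
  have decd: "decseq d"
    by (rule decseq_SucI) (use ent_names_concave[OF q] in \<open>auto simp: d_def f_def\<close>)
  have f: "real n * d n \<le> f n" for n
  proof -
    have "real n * d n = (\<Sum>i<n. d n)" by simp
    also have "\<dots> \<le> (\<Sum>i<n. d i)" using decd by (intro sum_mono) (auto simp: decseq_def)
    also have "\<dots> = f n" using sum_lessThan_telescope[of f n] f0 by (simp add: d_def)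
    finally show ?thesis .
  qed
  have "f (Suc (Suc n)) / real (Suc (Suc n)) \<le> f (Suc n) / real (Suc n)" for n
    using f[of "Suc n"] by (simp add: d_def field_simps)
  then have "decseq (\<lambda>n. f (Suc n) / real (Suc n))" by (intro decseq_SucI)
  moreover have "0 \<le> f (Suc n) / real (Suc n)" for n
    using ent_nonneg[OF simple_names[OF q], of 0 "Suc n"] unfolding f_def
    by (rule divide_nonneg_nonneg) simp
  ultimately obtain L where "(\<lambda>n. f (Suc n) / real (Suc n)) \<longlonglongrightarrow> L"
    using decseq_convergent[of "\<lambda>n. f (Suc n) / real (Suc n)" 0] by blast
  then have "convergent (\<lambda>n. f n / real n)"
    using filterlim_sequentially_Suc[of "\<lambda>n. f n / real n"] by (auto simp: convergent_def)
  then show ?thesis by (simp add: convergent_LIMSEQ_iff rate_def f_def)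
qed

text \<open>Each further letter of \<open>q\<close> costs at most H(q | r): conditioning on the
  whole \<open>r\<close>-name and the earlier letters of \<open>q\<close> leaves less entropy than
  conditioning on the simultaneous letter of \<open>r\<close>. That letter lies in the name because
  j does not exceed n.\<close>

lemma ent_names_pair_le:
  assumes q: "simple q" and r: "simple r" and "j \<le> n"
  shows "ent (\<lambda>x. (names q 0 j x, names r 0 n x))
    \<le> ent (names r 0 n) + real j * (ent (\<lambda>x. (q x, r x)) - ent r)"
  using assms(3)
proof (induction j)
  case 0
  have "ent (\<lambda>x. ([], names r 0 n x)) \<le> ent (names r 0 n)"
    by (rule ent_factor_le[where f="\<lambda>u. ([], u)"]) (auto intro: simple_names r)
  then show ?case by (simp add: names_0_0)
next
  case (Suc j)
  note sfq = simple_measure_pres[OF mp_Tn q] note sfr = simple_measure_pres[OF mp_Tn r]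
  note nq = simple_names[OF q] note nr = simple_names[OF r]
  let ?X = "\<lambda>x. q ((T ^^ j) x)" and ?Z = "\<lambda>x. r ((T ^^ j) x)" and ?Y = "\<lambda>x. (names q 0 j x, names r 0 n x)"
  have "ent (\<lambda>x. (?X x, ?Y x, ?Z x)) + ent ?Z \<le> ent (\<lambda>x. (?X x, ?Z x)) + ent (\<lambda>x. (?Y x, ?Z x))"
    by (intro ent_submodular sfq sfr simple_function_Pair nq nr)
  moreover have "ent ?Z = ent r" by (rule ent_measure_pres[OF mp_Tn r])
  moreover have "ent (\<lambda>x. (?X x, ?Z x)) = ent (\<lambda>x. (q x, r x))"
    using ent_measure_pres[OF mp_Tn simple_function_Pair[OF q r]] by simp
  moreover have "ent (\<lambda>x. (?Y x, ?Z x)) \<le> ent ?Y"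
    using Suc.prems by (intro ent_factor_le[where f="\<lambda>(u,v). ((u,v), v ! j)"]) (auto intro!: simple_function_Pair nq nr)
  moreover have "ent (\<lambda>x. (names q 0 (Suc j) x, names r 0 n x)) \<le> ent (\<lambda>x. (?X x, ?Y x, ?Z x))"
    by (intro ent_factor_le[where f="\<lambda>(x,(u,v),z). (u @ [x], v)"])
       (auto intro!: simple_function_Pair nq nr sfq sfr simp: names_Suc)
  ultimately show ?case using Suc by (simp add: algebra_simps)
qed

lemma rate_le_add:
  assumes q: "simple q" and r: "simple r"
  shows "rate q \<le> rate r + (ent (\<lambda>x. (q x, r x)) - ent r)"
proof (rule LIMSEQ_le[OF rate_LIMSEQ[OF q] tendsto_add[OF rate_LIMSEQ[OF r] tendsto_const]], intro exI allI impI)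
  fix n :: nat assume n: "1 \<le> n"
  have "ent (names q 0 n) \<le> ent (\<lambda>x. (names q 0 n x, names r 0 n x))"
    by (rule ent_factor_le[where f=fst]) (auto intro!: simple_function_Pair simple_names q r)
  also have "\<dots> \<le> ent (names r 0 n) + real n * (ent (\<lambda>x. (q x, r x)) - ent r)"
    by (rule ent_names_pair_le[OF q r order_refl])
  finally show "ent (names q 0 n) / real n \<le> ent (names r 0 n) / real n + (ent (\<lambda>x. (q x, r x)) - ent r)"
    using n by (simp add: field_simps)
qed

text \<open>If \<open>q\<close> and \<open>r\<close> mostly agree, their joint law is close to the
  law of (r, r), whose entropy is \<open>ent r\<close>. The bound \<open>\<epsilon>\<close> depends
  on the alphabet and \<open>\<eta>\<close> only, not on the functions; the passage to the limit
  relies on this uniformity.\<close>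

lemma ent_cond_small:
  fixes S :: "'c set"
  assumes S: "finite S" and "0 < \<eta>"
  shows "\<exists>\<epsilon>>0. \<forall>q r. simple q \<and> q ` space M \<subseteq> S \<and> simple r \<and> r ` space M \<subseteq> S \<and>
    prob (differ q r) < \<epsilon> \<longrightarrow> ent (\<lambda>x. (q x, r x)) - ent r \<le> \<eta>"
proof -
  define \<phi> where "\<phi> x = - (x * log b x)" for x
  \<comment> \<open>The tolerance per pair of letters; the summand 1 keeps the denominator positive
    when \<open>S\<close> is empty.\<close>
  define \<omega> where "\<omega> = \<eta> / (1 + real (card (S \<times> S)))"
  have "\<omega> > 0" using assms by (simp add: \<omega>_def add_pos_nonneg)
  have "uniformly_continuous_on {0..1} \<phi>"
    unfolding \<phi>_def using continuous_on_x_log[OF b_gt_1]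
    by (intro compact_uniformly_continuous) auto
  then obtain \<epsilon> where \<epsilon>: "\<epsilon> > 0" "\<And>x y. x \<in> {0..1} \<Longrightarrow> y \<in> {0..1} \<Longrightarrow> dist y x < \<epsilon> \<Longrightarrow> dist (\<phi> y) (\<phi> x) < \<omega>"
    unfolding uniformly_continuous_on_def using \<open>\<omega> > 0\<close> by metis
  show ?thesis
  proof (intro exI[of _ \<epsilon>] conjI \<epsilon>(1) allI impI)
    fix q r :: "'a \<Rightarrow> 'c"
    assume r: "simple q \<and> q ` space M \<subseteq> S \<and> simple r \<and> r ` space M \<subseteq> S \<and>
      prob (differ q r) < \<epsilon>"
    then have q: "simple q" and qS: "q ` space M \<subseteq> S"
      and sr: "simple r" and rS: "r ` space M \<subseteq> S" by auto
    have sp: "simple (\<lambda>x. (q x, r x))" by (intro simple_function_Pair q sr)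
    let ?m = "\<lambda>ij. prob {x \<in> space M. (q x, r x) = ij}"
    \<comment> \<open>The law of (r, r), concentrated on the diagonal.\<close>
    let ?t = "\<lambda>ij. if fst ij = snd ij then prob {x \<in> space M. r x = snd ij} else 0"
    have ne: "differ q r \<in> sets M"
      using simple_pred_sets[OF sp, of "\<lambda>(a, b). a \<noteq> b"] by simp
    have e1: "ent (\<lambda>x. (q x, r x)) = (\<Sum>ij\<in>S\<times>S. \<phi> (?m ij))"
      using S qS rS by (subst ent_eq_sum[OF sp, of "S \<times> S"]) (auto simp: \<phi>_def sum_negf)
    have "ent r = (\<Sum>j\<in>S. \<phi> (prob {x \<in> space M. r x = j}))"
      using S rS by (subst ent_eq_sum[OF sr, of S]) (auto simp: \<phi>_def sum_negf)
    also have "\<dots> = (\<Sum>j\<in>S. \<Sum>i\<in>S. if i = j then \<phi> (prob {x \<in> space M. r x = j}) else 0)"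
      using S by (intro sum.cong) (auto simp: sum.delta)
    also have "\<dots> = (\<Sum>i\<in>S. \<Sum>j\<in>S. \<phi> (?t (i, j)))"
      by (subst sum.swap) (auto intro!: sum.cong simp: \<phi>_def)
    also have "\<dots> = (\<Sum>ij\<in>S\<times>S. \<phi> (?t ij))"
      by (subst sum.cartesian_product) (auto intro!: sum.cong)
    finally have e2: "ent r = (\<Sum>ij\<in>S\<times>S. \<phi> (?t ij))" .
    have "ent (\<lambda>x. (q x, r x)) - ent r = (\<Sum>ij\<in>S\<times>S. \<phi> (?m ij) - \<phi> (?t ij))"
      unfolding e1 e2 by (simp add: sum_subtractf)
    also have "\<dots> \<le> (\<Sum>ij\<in>S\<times>S. \<omega>)"
    proof (rule sum_mono)
      fix ij :: "'c \<times> 'c"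
      obtain i j where ij: "ij = (i, j)" by force
      have mi: "{x \<in> space M. (q x, r x) = ij} \<in> sets M" by (rule simple_level_set[OF sp])
      have mj: "{x \<in> space M. r x = j} \<in> sets M" by (rule simple_level_set[OF sr])
      have "dist (?m ij) (?t ij) \<le> prob (differ q r)"
      proof (cases "i = j")
        case True
        have "prob {x \<in> space M. r x = j} \<le> prob ({x \<in> space M. (q x, r x) = ij} \<union> differ q r)"
          using mi ne True ij by (intro finite_measure_mono) auto
        also have "\<dots> \<le> ?m ij + prob (differ q r)" by (rule measure_Un_le[OF mi ne])
        finally have "prob {x \<in> space M. r x = j} \<le> ?m ij + prob (differ q r)" .
        moreover have "?m ij \<le> prob {x \<in> space M. r x = j}"
          using mj ij by (intro finite_measure_mono) auto
        ultimately show ?thesis using True ij by (simp add: dist_real_def)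
      next
        case False
        then have "?m ij \<le> prob (differ q r)" using ne ij by (intro finite_measure_mono) auto
        then show ?thesis using False ij by (simp add: dist_real_def)
      qed
      then have "dist (\<phi> (?m ij)) (\<phi> (?t ij)) < \<omega>" using r by (intro \<epsilon>(2)) auto
      then show "\<phi> (?m ij) - \<phi> (?t ij) \<le> \<omega>" by (auto simp: dist_real_def)
    qed
    also have "\<dots> = real (card (S \<times> S)) * \<omega>" by simp
    also have "\<dots> \<le> \<eta>" using \<open>0 < \<eta>\<close> by (simp add: \<omega>_def field_simps del: card_cartesian_product)
    finally show "ent (\<lambda>x. (q x, r x)) - ent r \<le> \<eta>" .
  qed
qed

lemma rate_uniformly_continuous:
  fixes S :: "'c set"
  assumes S: "finite S" and "0 < \<eta>"
  obtains \<epsilon> where "0 < \<epsilon>"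
    "\<And>q r. simple q \<Longrightarrow> q ` space M \<subseteq> S \<Longrightarrow> simple r \<Longrightarrow> r ` space M \<subseteq> S \<Longrightarrow>
      prob (differ q r) < \<epsilon> \<Longrightarrow> rate q \<le> rate r + \<eta>"
proof -
  from ent_cond_small[OF assms] obtain \<epsilon> where "0 < \<epsilon>"
    and \<epsilon>: "\<forall>q r. simple q \<and> q ` space M \<subseteq> S \<and> simple r \<and> r ` space M \<subseteq> S \<and>
      prob (differ q r) < \<epsilon> \<longrightarrow> ent (\<lambda>x. (q x, r x)) - ent r \<le> \<eta>"
    by (elim exE conjE)
  show ?thesis
  proof (rule that[OF \<open>0 < \<epsilon>\<close>])
    fix q r :: "'a \<Rightarrow> 'c"
    assume *: "simple q" "q ` space M \<subseteq> S" "simple r" "r ` space M \<subseteq> S"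
      "prob (differ q r) < \<epsilon>"
    have "ent (\<lambda>x. (q x, r x)) - ent r \<le> \<eta>"
      by (rule \<epsilon>[rule_format]) (intro conjI *)
    then show "rate q \<le> rate r + \<eta>" using rate_le_add[OF *(1,3)] by linarith
  qed
qed

text \<open>A sliding block code. The finite window is what makes decoding robust: a small change of
  \<open>p\<close> alters the output with small probability only.\<close>

definition finite_factor :: "('a \<Rightarrow> 'c) \<Rightarrow> ('a \<Rightarrow> 'd) \<Rightarrow> bool" where
  "finite_factor p r \<longleftrightarrow> (\<exists>N \<psi>. \<forall>x\<in>space M. r x = \<psi> (window N p x))"

lemma simple_finite_factor:
  assumes p: "simple p" and "finite_factor p r" shows "simple r"
proof -
  obtain N \<psi> where r: "\<And>x. x \<in> space M \<Longrightarrow> r x = \<psi> (window N p x)"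
    using assms by (auto simp: finite_factor_def)
  show ?thesis
    by (rule simple_factor[where f=\<psi>, OF simple_measure_pres[OF mp_Tin[of N] simple_names[OF p, of 0 "2 * N + 1"]]])
       (rule r)
qed

text \<open>A stretch of \<open>r\<close> is computed from a stretch of \<open>p\<close> that is
  longer by a constant, and the constant disappears after division by the length.\<close>

lemma rate_finite_factor_le:
  assumes p: "simple p" and r: "finite_factor p r"
  shows "rate r \<le> rate p"
proof -
  obtain N \<psi> where \<psi>: "\<And>x. x \<in> space M \<Longrightarrow> r x = \<psi> (window N p x)"
    using r unfolding finite_factor_def by blast
  define m where "m = 2 * N + 1"
  note np = simple_names[OF p]
  have le: "ent (names r 0 n) \<le> ent (names p 0 (n + m))" for n
  proof -
    have "ent (names r 0 n) \<le> ent (\<lambda>x. names p 0 (n + m) ((Ti ^^ N) x))"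
    proof (rule ent_factor_le[where f="\<lambda>l. map (\<lambda>j. \<psi> (take m (drop j l))) [0..<n]"])
      show "simple (\<lambda>x. names p 0 (n + m) ((Ti ^^ N) x))"
        by (rule simple_measure_pres[OF mp_Tin np])
      fix x assume x: "x \<in> space M"
      show "names r 0 n x = map (\<lambda>j. \<psi> (take m (drop j (names p 0 (n + m) ((Ti ^^ N) x))))) [0..<n]"
      proof (rule nth_equalityI)
        fix j assume "j < length (names r 0 n x)"
        then have j: "j < n" by simp
        have "(Ti ^^ N) ((T ^^ j) x) = (T ^^ j) ((Ti ^^ N) x)"
        proof (cases "N \<le> j")
          case True
          then show ?thesis using x by (simp add: Tin_Tn_ge Tn_Tin_ge)
        next
          case False
          then have "(Ti ^^ N) ((T ^^ j) x) = (Ti ^^ (N - j)) ((Ti ^^ j) ((T ^^ j) x))"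
            using funpow_add[of "N - j" j Ti] by simp
          then show ?thesis using x False by (simp add: Tn_Tin_le)
        qed
        then have "r ((T ^^ j) x) = \<psi> (names p j (j + m) ((Ti ^^ N) x))"
          using x by (simp add: \<psi>[folded m_def] names_shift add.commute)
        then show "names r 0 n x ! j = map (\<lambda>j. \<psi> (take m (drop j (names p 0 (n + m) ((Ti ^^ N) x))))) [0..<n] ! j"
          using j by (simp add: drop_take_names)
      qed simp
    qed
    also have "\<dots> = ent (names p 0 (n + m))" by (rule ent_measure_pres[OF mp_Tin np])
    finally show ?thesis .
  qed
  have "(\<lambda>n. ent (names p 0 (n + m)) / real (n + m)) \<longlonglongrightarrow> rate p"
    using LIMSEQ_ignore_initial_segment[OF rate_LIMSEQ[OF p]] .
  moreover have "(\<lambda>n. real (n + m) / real n) \<longlonglongrightarrow> 1" by real_asymp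
  ultimately have "(\<lambda>n. ent (names p 0 (n + m)) / real (n + m) * (real (n + m) / real n)) \<longlonglongrightarrow> rate p * 1"
    by (rule tendsto_mult)
  then have lim: "(\<lambda>n. ent (names p 0 (n + m)) / real n) \<longlonglongrightarrow> rate p" by (simp add: m_def)
  show ?thesis
    using le by (intro LIMSEQ_le[OF rate_LIMSEQ[OF simple_finite_factor[OF p r]] lim])
      (auto intro!: divide_right_mono)
qed

end

section \<open>Ergodic averages and Rokhlin towers\<close>

context mp_system begin

lemma expectation_measure_pres:
  fixes f :: "'a \<Rightarrow> real"
  assumes "measure_pres S" "f \<in> borel_measurable M"
  shows "expectation (\<lambda>x. f (S x)) = expectation f"
  using integral_distr[of S M M f] assms by (simp add: measure_pres_def)

text \<open>Equivalent to disjointness of the n levels F, T F, ...: no point of the base returns to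
  it before time n.\<close>

definition tower :: "nat \<Rightarrow> 'a set \<Rightarrow> bool" where
  "tower n F \<longleftrightarrow> F \<in> sets M \<and> (\<forall>x\<in>F. \<forall>i. 0 < i \<and> i < n \<longrightarrow> (T ^^ i) x \<notin> F)"

lemma tower_unique:
  assumes F: "tower n F" and y: "y \<in> space M" and "(Ti ^^ i) y \<in> F" "(Ti ^^ j) y \<in> F" "i < n" "j < n"
  shows "i = j"
proof -
  have False if ij: "i < j" "j < n" "(Ti ^^ i) y \<in> F" "(Ti ^^ j) y \<in> F" for i j
  proof -
    have "(T ^^ (j - i)) ((Ti ^^ j) y) = (Ti ^^ i) y" using y ij by (simp add: Tn_Tin_le)
    moreover have "0 < j - i" "j - i < n" using ij by auto
    ultimately show False using F ij by (metis tower_def)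
  qed
  then show ?thesis using assms by (metis linorder_neqE_nat)
qed

lemma tower_sum_le:
  assumes F: "tower n F" and B: "B \<in> sets M"
  shows "(\<Sum>i<n. prob {y \<in> B. (Ti ^^ i) y \<in> F}) \<le> prob B"
proof -
  have [measurable]: "F \<in> sets M" "B \<in> sets M" using F B by (auto simp: tower_def)
  have Bs: "B \<subseteq> space M" using B by (rule sets.sets_into_space)
  have m: "{y \<in> B. (Ti ^^ i) y \<in> F} \<in> sets M" for i
  proof -
    have "{y \<in> B. (Ti ^^ i) y \<in> F} = B \<inter> {y \<in> space M. (Ti ^^ i) y \<in> F}" using Bs by auto
    also have "\<dots> \<in> sets M" by measurable
    finally show ?thesis .
  qed
  have "(\<Sum>i<n. prob {y \<in> B. (Ti ^^ i) y \<in> F}) = prob (\<Union>i<n. {y \<in> B. (Ti ^^ i) y \<in> F})"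
    using m tower_unique[OF F] Bs
    by (intro finite_measure_finite_Union[symmetric]) (auto simp: disjoint_family_on_def)
  also have "\<dots> \<le> prob B" using B by (intro finite_measure_mono) auto
  finally show ?thesis .
qed

lemma prob_tower_base_le:
  assumes "tower n F" shows "real n * prob F \<le> 1"
proof -
  have F: "F \<in> sets M" using assms by (auto simp: tower_def)
  have "(\<Sum>i<n. prob {y \<in> space M. (Ti ^^ i) y \<in> F}) = (\<Sum>i<n. prob F)"
    using prob_preimage[OF mp_Tin F] by simp
  then show ?thesis using tower_sum_le[OF assms sets.top] prob_space by simp
qed

text \<open>Each of the n levels can serve as a new base without changing the measure of the
  uncovered part. The levels are disjoint, so one of them contains at most the share 1/n of
  \<open>B\<close>.\<close>

lemma tower_shift:
  assumes F: "tower n F" and B: "B \<in> sets M" and "0 < n"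
  shows "\<exists>F'. tower n F' \<and> prob (uncovered n F') = prob (uncovered n F)
    \<and> real n * prob (F' \<inter> B) \<le> prob B"
proof -
  have [measurable]: "F \<in> sets M" "B \<in> sets M" using F B by (auto simp: tower_def)
  have "\<exists>j<n. real n * prob {y \<in> B. (Ti ^^ j) y \<in> F} \<le> prob B"
  proof (rule ccontr)
    assume "\<not> ?thesis"
    then have "(\<Sum>i<n. prob B) < (\<Sum>i<n. real n * prob {y \<in> B. (Ti ^^ i) y \<in> F})"
      using \<open>0 < n\<close> by (intro sum_strict_mono) auto
    then show False using tower_sum_le[OF F B] \<open>0 < n\<close> by (simp flip: sum_distrib_left)
  qed
  then obtain j where j: "j < n" "real n * prob {y \<in> B. (Ti ^^ j) y \<in> F} \<le> prob B" by blast
  let ?F = "{y \<in> space M. (Ti ^^ j) y \<in> F}"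
  have com: "(Ti ^^ j) ((T ^^ i) x) = (T ^^ i) ((Ti ^^ j) x)" if "x \<in> space M" for i x
  proof -
    have "(T ^^ j) ((T ^^ i) ((Ti ^^ j) x)) = (T ^^ i) ((T ^^ j) ((Ti ^^ j) x))"
      by (metis add.commute comp_apply funpow_add)
    also have "\<dots> = (T ^^ i) x" using that by simp
    finally show ?thesis using that by (metis Tin_Tn Tn_space)
  qed
  have "?F \<in> sets M" by measurable
  then have "tower n ?F" using F com unfolding tower_def by auto
  moreover have "prob {y \<in> space M. \<forall>i<n. (Ti ^^ i) y \<notin> ?F} = prob (uncovered n F)"
  proof -
    have "(Ti ^^ j) ((Ti ^^ i) y) = (Ti ^^ i) ((Ti ^^ j) y)" for i y
      by (metis add.commute comp_apply funpow_add)
    then have "{y \<in> space M. \<forall>i<n. (Ti ^^ i) y \<notin> ?F} = {y \<in> space M. (Ti ^^ j) y \<in> (uncovered n F)}"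
      by auto
    also have "prob \<dots> = prob (uncovered n F)"
      by (rule prob_preimage[OF mp_Tin]) measurable
    finally show ?thesis .
  qed
  moreover have "?F \<inter> B = {y \<in> B. (Ti ^^ j) y \<in> F}" using sets.sets_into_space[OF B] by auto
  ultimately show ?thesis using j by (intro exI[of _ ?F]) auto
qed

end

locale ergodic_system = mp_system +
  assumes ergodic: "ergodic M T"
begin

text \<open>The upper half of the ergodic theorem, by stopping times. If averages of at least
  \<open>c0\<close> occurred along almost every orbit, orbits could be cut into short pieces with
  such averages, up to a small correction of \<open>g\<close>; integrating would contradict
  \<open>expectation g < c0\<close>.\<close>

lemma birkhoff_upper_bound:
  fixes g :: "'a \<Rightarrow> real"
  assumes g[measurable]: "g \<in> borel_measurable M"
    and bd: "\<And>x. x \<in> space M \<Longrightarrow> 0 \<le> g x" "\<And>x. x \<in> space M \<Longrightarrow> g x \<le> B"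
    and c: "expectation g < c" and "0 < \<epsilon>"
  shows "\<exists>N0. \<forall>N\<ge>N0. prob {x \<in> space M. (\<Sum>t<N. g ((T ^^ t) x)) > real N * c} < \<epsilon>"
proof -
  obtain c0 where c0: "expectation g < c0" "c0 < c" using dense[OF c] by blast
  have "0 \<le> expectation g" using bd by (intro integral_nonneg_AE) auto
  then have c0_pos: "0 < c0" using c0 by simp
  obtain x0 where "x0 \<in> space M" using not_empty by blast
  then have "0 \<le> B" using bd[of x0] by simp
  define S where "S n x = (\<Sum>t<n. g ((T ^^ t) x))" for n x
  have S_meas[measurable]: "S n \<in> borel_measurable M" for n unfolding S_def by measurable
  have S_Suc: "S (Suc n) x = g x + S n (T x)" for n x
    unfolding S_def by (simp add: sum.lessThan_Suc_shift funpow_swap1 del: sum.lessThan_Suc)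
  define E where "E = {x \<in> space M. \<exists>j::nat. \<forall>m. \<exists>n\<ge>m. S n x \<ge> real n * (c0 + 1 / real (Suc j))}"
  have E_meas: "E \<in> sets M" unfolding E_def by measurable
  have drift: "\<exists>n0::nat. \<forall>n\<ge>n0. real n * (1 / real (Suc j) - 1 / real (Suc (Suc j))) \<ge> C" for j and C :: real
  proof -
    have p: "0 < 1 / real (Suc j) - 1 / real (Suc (Suc j))"
      using frac_less2[of 1 1 "real (Suc j)" "real (Suc (Suc j))"] by simp
    then have "\<exists>n0::nat. C < real n0 * (1 / real (Suc j) - 1 / real (Suc (Suc j)))"
      by (metis reals_Archimedean3)
    then obtain n0 where n0: "C < real n0 * (1 / real (Suc j) - 1 / real (Suc (Suc j)))" by blast
    have "C \<le> real n * (1 / real (Suc j) - 1 / real (Suc (Suc j)))" if "n0 \<le> n" for n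
      using n0 mult_right_mono[of "real n0" "real n", OF _ less_imp_le[OF p]] that by linarith
    then show ?thesis by blast
  qed
  have Einv: "T -` E \<inter> space M = E"
  proof (intro equalityI subsetI)
    fix x assume "x \<in> T -` E \<inter> space M"
    then obtain j where x: "x \<in> space M" and j: "\<And>m. \<exists>n\<ge>m. S n (T x) \<ge> real n * (c0 + 1 / real (Suc j))"
      unfolding E_def by blast
    obtain n0 where n0: "\<And>n. n \<ge> n0 \<Longrightarrow> real n * (1 / real (Suc j) - 1 / real (Suc (Suc j))) \<ge> c0 + 1"
      using drift[of "c0 + 1" j] by blast
    have "\<exists>n\<ge>m. S n x \<ge> real n * (c0 + 1 / real (Suc (Suc j)))" for m
    proof -
      obtain n where n: "n \<ge> max m n0" "S n (T x) \<ge> real n * (c0 + 1 / real (Suc j))" using j by blast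
      have "real (Suc n) * (c0 + 1 / real (Suc (Suc j)))
          = real n * (c0 + 1 / real (Suc j)) - real n * (1 / real (Suc j) - 1 / real (Suc (Suc j))) + (c0 + 1 / real (Suc (Suc j)))"
        by (simp add: algebra_simps add_divide_distrib)
      also have "\<dots> \<le> real n * (c0 + 1 / real (Suc j))"
      proof -
        have "1 / real (Suc (Suc j)) \<le> 1" by simp
        moreover have "c0 + 1 \<le> real n * (1 / real (Suc j) - 1 / real (Suc (Suc j)))" using n by (intro n0) simp
        ultimately show ?thesis by linarith
      qed
      also have "\<dots> \<le> S (Suc n) x" using n bd(1)[OF x] by (simp add: S_Suc)
      finally show ?thesis using n by (intro exI[of _ "Suc n"]) auto
    qed
    then show "x \<in> E" using x unfolding E_def by blast
  next
    fix x assume "x \<in> E"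
    then obtain j where x: "x \<in> space M" and j: "\<And>m. \<exists>n\<ge>m. S n x \<ge> real n * (c0 + 1 / real (Suc j))"
      unfolding E_def by blast
    obtain n0 where n0: "\<And>n. n \<ge> n0 \<Longrightarrow> real n * (1 / real (Suc j) - 1 / real (Suc (Suc j))) \<ge> B"
      using drift[of B j] by blast
    have "\<exists>n\<ge>m. S n (T x) \<ge> real n * (c0 + 1 / real (Suc (Suc j)))" for m
    proof -
      obtain n where n: "n \<ge> Suc (max m n0)" "S n x \<ge> real n * (c0 + 1 / real (Suc j))" using j by blast
      then obtain k where k: "n = Suc k" "k \<ge> m" "k \<ge> n0" by (cases n) auto
      have "real k * (c0 + 1 / real (Suc (Suc j)))
          = real k * (c0 + 1 / real (Suc j)) - real k * (1 / real (Suc j) - 1 / real (Suc (Suc j)))"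
        by (simp add: algebra_simps)
      also have "\<dots> \<le> real k * (c0 + 1 / real (Suc j)) - B" using n0 k by auto
      also have "\<dots> \<le> real n * (c0 + 1 / real (Suc j)) - g x"
      proof -
        have "0 \<le> c0 + 1 / real (Suc j)" using c0_pos by simp
        then have "real k * (c0 + 1 / real (Suc j)) \<le> real n * (c0 + 1 / real (Suc j))"
          using k by (intro mult_right_mono) auto
        then show ?thesis using bd(2)[OF x] by linarith
      qed
      also have "\<dots> \<le> S k (T x)" using n k by (simp add: S_Suc)
      finally show ?thesis using k by blast
    qed
    moreover have "T x \<in> space M" using x Tn_space(1)[of x 1] by simp
    ultimately show "x \<in> T -` E \<inter> space M" using x unfolding E_def by blast
  qed
  have "prob E = 0 \<or> prob E = 1" using ergodic E_meas Einv by (auto simp: ergodic_def)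
  moreover have "prob E \<noteq> 1"
  proof
    assume "prob E = 1"
    \<comment> \<open>The points whose stopping time is longer than \<open>K\<close>; they become
      rare as \<open>K\<close> grows if \<open>E\<close> has full measure.\<close>
    define D where "D K = {x \<in> space M. \<forall>n. 1 \<le> n \<and> n \<le> K \<longrightarrow> S n x < real n * c0}" for K
    have D_meas[measurable]: "D K \<in> sets M" for K unfolding D_def by measurable
    have "decseq D" unfolding D_def by (intro decseq_SucI) auto
    then have "(\<lambda>K. prob (D K)) \<longlonglongrightarrow> prob (\<Inter>K. D K)"
      by (intro finite_Lim_measure_decseq) auto
    moreover have "prob (\<Inter>K. D K) = 0"
    proof -
      have "(\<Inter>K. D K) \<subseteq> space M - E"
      proof
        fix x assume "x \<in> (\<Inter>K. D K)"
        then have x: "x \<in> space M" "\<And>n. 1 \<le> n \<Longrightarrow> S n x < real n * c0" by (auto simp: D_def)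
        have "x \<notin> E"
        proof
          assume "x \<in> E"
          then obtain j where "\<forall>m. \<exists>n\<ge>m. S n x \<ge> real n * (c0 + 1 / real (Suc j))" unfolding E_def by blast
          then obtain n where n: "n \<ge> (1::nat)" "S n x \<ge> real n * (c0 + 1 / real (Suc j))" by blast
          moreover have "real n * c0 \<le> real n * (c0 + 1 / real (Suc j))" by (intro mult_left_mono) auto
          ultimately show False using x(2)[of n] by linarith
        qed
        with x show "x \<in> space M - E" by simp
      qed
      then have "prob (\<Inter>K. D K) \<le> prob (space M - E)" using E_meas by (intro finite_measure_mono) auto
      then show ?thesis using \<open>prob E = 1\<close> prob_compl[OF E_meas] measure_nonneg[of M "\<Inter>K. D K"] by linarith
    qed
    ultimately have lim: "(\<lambda>K. prob (D K)) \<longlonglongrightarrow> 0" by simp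
    have "\<exists>K\<ge>1. prob (D K) < (c0 - expectation g) / c0"
    proof -
      have "0 < (c0 - expectation g) / c0" using c0 c0_pos by simp
      from order_tendstoD(2)[OF lim this] obtain K0 where "\<And>K. K \<ge> K0 \<Longrightarrow> prob (D K) < (c0 - expectation g) / c0"
        by (auto simp: eventually_sequentially)
      then show ?thesis by (intro exI[of _ "max 1 K0"]) auto
    qed
    then obtain K where K: "1 \<le> K" "prob (D K) < (c0 - expectation g) / c0" by blast
    \<comment> \<open>Adding \<open>c0\<close> on \<open>D K\<close> lets its points stop after a
      single step, so every stopping time is at most \<open>K\<close>. By the choice of
      \<open>K\<close> the expectation of \<open>f\<close> remains below \<open>c0\<close>.\<close>
    define f where "f x = g x + c0 * indicator (D K) x" for x
    have f_meas[measurable]: "f \<in> borel_measurable M" unfolding f_def by measurable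
    have f0: "0 \<le> f x" if "x \<in> space M" for x using bd(1)[OF that] c0_pos by (simp add: f_def)
    have int_g: "integrable M g"
      using bd by (intro integrable_const_bound[where B=B]) auto
    have Ef: "expectation f = expectation g + c0 * prob (D K)"
      unfolding f_def using int_g by (subst Bochner_Integration.integral_add) (auto simp: emeasure_eq_measure)
    have step: "\<exists>m. 1 \<le> m \<and> m \<le> K \<and> real m * c0 \<le> (\<Sum>t<m. f ((T ^^ t) x))" if x: "x \<in> space M" for x
    proof (cases "x \<in> D K")
      case True
      then show ?thesis using K bd(1)[OF x] by (intro exI[of _ 1]) (auto simp: f_def)
    next
      case False
      then obtain m where m: "1 \<le> m" "m \<le> K" "real m * c0 \<le> S m x" using x by (force simp: D_def not_less)
      have "S m x \<le> (\<Sum>t<m. f ((T ^^ t) x))" unfolding S_def f_def using c0_pos by (intro sum_mono) auto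
      then show ?thesis using m by (intro exI[of _ m]) auto
    qed
    \<comment> \<open>Cut the orbit greedily at stopping times; only a last piece of length at most
      \<open>K\<close> is lost.\<close>
    have sum_ge: "(real L - real K) * c0 \<le> (\<Sum>t<L. f ((T ^^ t) x))" if x: "x \<in> space M" for x L
      using x
    proof (induction L arbitrary: x rule: less_induct)
      case (less L)
      show ?case
      proof (cases "L \<le> K")
        case True
        then have "(real L - real K) * c0 \<le> 0" using c0_pos by (intro mult_nonpos_nonneg) auto
        also have "0 \<le> (\<Sum>t<L. f ((T ^^ t) x))" using f0 less.prems by (intro sum_nonneg) auto
        finally show ?thesis .
      next
        case False
        obtain m where m: "1 \<le> m" "m \<le> K" "real m * c0 \<le> (\<Sum>t<m. f ((T ^^ t) x))" using step[OF less.prems] by blast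
        have "(real (L - m) - real K) * c0 \<le> (\<Sum>t<L - m. f ((T ^^ t) ((T ^^ m) x)))"
          using False m less.prems by (intro less.IH) auto
        also have "\<dots> = (\<Sum>t<L - m. f ((T ^^ (t + m)) x))" by (simp add: funpow_add)
        also have "\<dots> = (\<Sum>t\<in>{m..<L}. f ((T ^^ t) x))"
          using False m by (intro sum.reindex_bij_witness[of _ "\<lambda>t. t - m" "\<lambda>t. t + m"]) auto
        finally have "(real (L - m) - real K) * c0 \<le> (\<Sum>t\<in>{m..<L}. f ((T ^^ t) x))" .
        moreover have "(\<Sum>t<L. f ((T ^^ t) x)) = (\<Sum>t<m. f ((T ^^ t) x)) + (\<Sum>t\<in>{m..<L}. f ((T ^^ t) x))"
          using False m sum.atLeastLessThan_concat[of 0 m L "\<lambda>t. f ((T ^^ t) x)"] by (simp add: lessThan_atLeast0)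
        moreover have "real (L - m) = real L - real m" using False m by simp
        ultimately show ?thesis using m(3) by (simp add: algebra_simps)
      qed
    qed
    have int_fT: "integrable M (\<lambda>x. f ((T ^^ t) x))" for t
    proof (rule integrable_const_bound[where B="B + c0"])
      show "AE x in M. norm (f ((T ^^ t) x)) \<le> B + c0"
      proof (rule AE_I2)
        fix x assume "x \<in> space M"
        then have y: "(T ^^ t) x \<in> space M" by simp
        show "norm (f ((T ^^ t) x)) \<le> B + c0"
          using f0[OF y] bd(2)[OF y] c0_pos by (auto simp: f_def indicator_def)
      qed
    qed simp
    have ineq: "(real L - real K) * c0 \<le> real L * expectation f" for L
    proof -
      have "(real L - real K) * c0 = expectation (\<lambda>x. (real L - real K) * c0)" by (simp add: prob_space)
      also have "\<dots> \<le> expectation (\<lambda>x. \<Sum>t<L. f ((T ^^ t) x))"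
        using sum_ge int_fT by (intro integral_mono) auto
      also have "\<dots> = (\<Sum>t<L. expectation f)"
        using int_fT expectation_measure_pres[OF mp_Tn f_meas] by (subst Bochner_Integration.integral_sum) auto
      finally show ?thesis by simp
    qed
    have "c0 \<le> expectation f"
    proof (rule ccontr)
      assume "\<not> ?thesis"
      then obtain L :: nat where "real K * c0 < real L * (c0 - expectation f)"
        by (metis reals_Archimedean3 diff_gt_0_iff_gt linorder_not_le)
      then show False using ineq[of L] by (simp add: algebra_simps)
    qed
    moreover have "c0 * prob (D K) < c0 - expectation g" using K c0_pos by (simp add: field_simps)
    ultimately show False using Ef by linarith
  qed
  ultimately have E0: "prob E = 0" by simp
  define W where "W N = {x \<in> space M. \<exists>n\<ge>N. S n x > real n * c}" for N
  have W_meas: "W N \<in> sets M" for N unfolding W_def by measurable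
  have "decseq W" unfolding W_def by (intro decseq_SucI) (auto dest: Suc_leD)
  then have "(\<lambda>N. prob (W N)) \<longlonglongrightarrow> prob (\<Inter>N. W N)"
    using W_meas by (intro finite_Lim_measure_decseq) auto
  moreover have "prob (\<Inter>N. W N) = 0"
  proof -
    obtain j where j: "c0 + 1 / real (Suc j) < c"
      using reals_Archimedean[of "c - c0"] c0 by (auto simp: inverse_eq_divide algebra_simps)
    have "(\<Inter>N. W N) \<subseteq> E"
    proof
      fix x assume x: "x \<in> (\<Inter>N. W N)"
      have "\<exists>n\<ge>m. S n x \<ge> real n * (c0 + 1 / real (Suc j))" for m
      proof -
        obtain n where n: "n \<ge> m" "S n x > real n * c" using x by (auto simp: W_def)
        moreover have "real n * (c0 + 1 / real (Suc j)) \<le> real n * c" using j by (intro mult_left_mono) auto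
        ultimately show ?thesis by (intro exI[of _ n]) auto
      qed
      moreover have "x \<in> space M" using x by (auto simp: W_def)
      ultimately show "x \<in> E" unfolding E_def by blast
    qed
    then have "prob (\<Inter>N. W N) \<le> prob E" using E_meas by (intro finite_measure_mono) auto
    then show ?thesis using E0 measure_nonneg[of M "\<Inter>N. W N"] by linarith
  qed
  ultimately have "(\<lambda>N. prob (W N)) \<longlonglongrightarrow> 0" by simp
  from order_tendstoD(2)[OF this \<open>0 < \<epsilon>\<close>] obtain N0 where N0: "\<And>N. N \<ge> N0 \<Longrightarrow> prob (W N) < \<epsilon>"
    by (auto simp: eventually_sequentially)
  have "prob {x \<in> space M. (\<Sum>t<N. g ((T ^^ t) x)) > real N * c} < \<epsilon>" if "N \<ge> N0" for N
  proof -
    have "prob {x \<in> space M. (\<Sum>t<N. g ((T ^^ t) x)) > real N * c} \<le> prob (W N)"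
      using W_meas by (intro finite_measure_mono) (auto simp: W_def S_def)
    then show ?thesis using N0[OF that] by simp
  qed
  then show ?thesis by blast
qed

text \<open>The sets \<open>C m\<close> of points that visit \<open>A\<close> at time m or later are
  successive preimages, hence of equal measure. Their intersection is invariant and has positive
  measure, so ergodicity makes it full.\<close>

lemma AE_enters:
  assumes A[measurable]: "A \<in> sets M" and pos: "0 < prob A"
  shows "AE x in M. \<exists>k. (T ^^ k) x \<in> A"
proof -
  define C where "C m = {x \<in> space M. \<exists>k\<ge>m. (T ^^ k) x \<in> A}" for m
  have C_meas: "C m \<in> sets M" for m unfolding C_def by measurable
  have C_Suc: "C (Suc m) = {x \<in> space M. T x \<in> C m}" for m
  proof -
    have "(\<exists>k\<ge>Suc m. (T ^^ k) x \<in> A) \<longleftrightarrow> (\<exists>k\<ge>m. (T ^^ Suc k) x \<in> A)" for x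
      by (metis Suc_le_D Suc_le_mono)
    then show ?thesis using Tn_space(1)[of _ 1] by (auto simp: C_def funpow_swap1)
  qed
  have eq: "prob (C m) = prob (C 0)" for m
    by (induction m) (simp_all add: C_Suc prob_preimage[OF measure_pres_T C_meas])
  have "decseq C" unfolding C_def by (intro decseq_SucI) (auto dest: Suc_leD)
  then have "(\<lambda>m. prob (C m)) \<longlonglongrightarrow> prob (\<Inter>m. C m)"
    using C_meas by (intro finite_Lim_measure_decseq) auto
  moreover have "(\<lambda>m. prob (C m)) = (\<lambda>_. prob (C 0))" by (intro ext eq)
  ultimately have "(\<lambda>_. prob (C 0)) \<longlonglongrightarrow> prob (\<Inter>m. C m)" by (simp only:)
  then have p: "prob (\<Inter>m. C m) = prob (C 0)" using LIMSEQ_unique tendsto_const by blast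
  have "prob A \<le> prob (C 0)"
    using C_meas sets.sets_into_space[OF A] by (intro finite_measure_mono) (auto simp: C_def intro: exI[of _ 0])
  with p pos have "prob (\<Inter>m. C m) \<noteq> 0" by simp
  moreover have "T -` (\<Inter>m. C m) \<inter> space M = (\<Inter>m. C m)"
  proof -
    have "T -` (\<Inter>m. C m) \<inter> space M = (\<Inter>m. C (Suc m))" by (auto simp: C_Suc)
    also have "\<dots> = (\<Inter>m. C m)" using \<open>decseq C\<close> by (auto simp: decseq_Suc_iff)
    finally show ?thesis .
  qed
  moreover have "(\<Inter>m. C m) \<in> sets M" using C_meas by auto
  ultimately have "prob (\<Inter>m. C m) = 1" using ergodic unfolding ergodic_def by blast
  then have "AE x in M. x \<in> (\<Inter>m. C m)" by (rule AE_prob_1)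
  then show ?thesis by (rule eventually_mono) (auto simp: C_def)
qed

text \<open>Take a set \<open>A\<close> of measure below \<open>\<epsilon> / n\<close> and let
  \<open>F\<close> be the points whose first hitting time of \<open>A\<close> is a positive multiple
  of n. A point is missed only if it never hits \<open>A\<close> or left \<open>A\<close> fewer than
  n steps ago, and the second event has probability at most n times that of
  \<open>A\<close>.\<close>

lemma rokhlin:
  assumes small: "\<And>\<delta>. 0 < \<delta> \<Longrightarrow> \<exists>A\<in>sets M. 0 < prob A \<and> prob A < \<delta>" and "0 < n" "0 < \<epsilon>"
  shows "\<exists>F. tower n F \<and> prob (uncovered n F) < \<epsilon>"
proof -
  obtain A where A[measurable]: "A \<in> sets M" and pos: "0 < prob A" and le: "prob A < \<epsilon> / real n"
    using small[of "\<epsilon> / real n"] \<open>0 < n\<close> \<open>0 < \<epsilon>\<close> by (meson divide_pos_pos of_nat_0_less_iff)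
  define r where "r x = (LEAST k. (T ^^ k) x \<in> A)" for x
  define F where "F = {x \<in> space M. (\<exists>k. (T ^^ k) x \<in> A) \<and> 0 < r x \<and> n dvd r x}"
  have F_meas[measurable]: "F \<in> sets M" unfolding F_def r_def by measurable
  have r_eqI: "r x = k" if "(T ^^ k) x \<in> A" "\<And>j. j < k \<Longrightarrow> (T ^^ j) x \<notin> A" for x k
    unfolding r_def using that by (intro Least_equality) (auto simp: not_less[symmetric])
  have "(T ^^ i) x \<notin> F" if x: "x \<in> F" and i: "0 < i" "i < n" for x i
  proof
    assume iF: "(T ^^ i) x \<in> F"
    have ri: "i < r x" using x i by (auto simp: F_def dest: dvd_imp_le)
    have rA: "(T ^^ r x) x \<in> A" unfolding r_def using x by (auto simp: F_def intro: LeastI_ex)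
    have "r ((T ^^ i) x) = r x - i"
    proof (rule r_eqI)
      show "(T ^^ (r x - i)) ((T ^^ i) x) \<in> A" using rA ri funpow_add[of "r x - i" i T] by simp
      fix j assume "j < r x - i"
      then have "j + i < r x" by simp
      then have "(T ^^ (j + i)) x \<notin> A" unfolding r_def by (rule not_less_Least)
      then show "(T ^^ j) ((T ^^ i) x) \<notin> A" by (simp add: funpow_add)
    qed
    then have "n dvd r x - i" "n dvd r x" using x iF by (auto simp: F_def)
    then have "n dvd i" using ri by (metis dvd_diffD1 less_imp_le_nat)
    then show False using i by (auto dest: dvd_imp_le)
  qed
  then have tow: "tower n F" by (auto simp: tower_def)
  let ?bad = "\<Union>i<n. {y \<in> space M. (Ti ^^ i) y \<in> A}"
  have cover: "\<exists>i<n. (Ti ^^ i) y \<in> F" if y: "y \<in> space M" "y \<notin> ?bad" "\<exists>k. (T ^^ k) y \<in> A" for y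
  proof -
    have rA: "(T ^^ r y) y \<in> A" unfolding r_def using y(3) by (rule LeastI_ex)
    have nA: "(Ti ^^ i) y \<notin> A" if "i < n" for i using y that by auto
    have "r y \<noteq> 0"
    proof
      assume "r y = 0"
      then show False using rA nA[of 0] \<open>0 < n\<close> by simp
    qed
    \<comment> \<open>Going back i steps rounds the hitting time up to a multiple of n. Those steps
      do not meet \<open>A\<close>, so the first hitting time really grows by i.\<close>
    define i where "i = (n - r y mod n) mod n"
    have i: "i < n" using \<open>0 < n\<close> by (simp add: i_def)
    have dv: "n dvd r y + i"
    proof (cases "r y mod n = 0")
      case True then show ?thesis by (simp add: i_def mod_eq_0_iff_dvd)
    next
      case False
      have "r y mod n < n" using \<open>0 < n\<close> by simp
      then have "i = n - r y mod n" using False by (simp add: i_def)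
      then have "r y + i = r y - r y mod n + n"
        using \<open>r y mod n < n\<close> mod_less_eq_dividend[of "r y" n] by linarith
      then show ?thesis by (simp add: minus_mod_eq_mult_div)
    qed
    have "r ((Ti ^^ i) y) = r y + i"
    proof (rule r_eqI)
      show "(T ^^ (r y + i)) ((Ti ^^ i) y) \<in> A" using rA y by (simp add: Tn_Tin_ge)
      fix j assume j: "j < r y + i"
      show "(T ^^ j) ((Ti ^^ i) y) \<notin> A"
      proof (cases "j \<le> i")
        case True
        then show ?thesis using y nA[of "i - j"] i by (simp add: Tn_Tin_le)
      next
        case False
        then have "j - i < r y" using j by simp
        then have "(T ^^ (j - i)) y \<notin> A" unfolding r_def by (rule not_less_Least)
        then show ?thesis using y False by (simp add: Tn_Tin_ge)
      qed
    qed
    moreover have "(T ^^ (r y + i)) ((Ti ^^ i) y) \<in> A" using rA y by (simp add: Tn_Tin_ge)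
    ultimately have "(Ti ^^ i) y \<in> F" using y dv \<open>r y \<noteq> 0\<close> by (auto simp: F_def)
    with i show ?thesis by blast
  qed
  have bad_meas: "?bad \<in> sets M" by measurable
  have "prob (uncovered n F) \<le> prob ?bad"
  proof (rule finite_measure_mono_AE[OF _ bad_meas])
    show "AE x in M. x \<in> (uncovered n F) \<longrightarrow> x \<in> ?bad"
      using AE_enters[OF A pos] by (rule eventually_mono) (use cover in blast)
  qed
  also have "\<dots> \<le> (\<Sum>i<n. prob {y \<in> space M. (Ti ^^ i) y \<in> A})"
    by (rule finite_measure_subadditive_finite) auto
  also have "\<dots> = real n * prob A" by (simp add: prob_preimage[OF mp_Tin A])
  also have "\<dots> < \<epsilon>" using le \<open>0 < n\<close> by (simp add: field_simps)
  finally show ?thesis using tow by blast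
qed

lemma rokhlin_avoiding:
  assumes small: "\<And>\<delta>. 0 < \<delta> \<Longrightarrow> \<exists>A\<in>sets M. 0 < prob A \<and> prob A < \<delta>" and "0 < n" "0 < \<epsilon>"
    and B: "B \<in> sets M"
  shows "\<exists>F. tower n F \<and> prob (uncovered n F) < \<epsilon> \<and> real n * prob (F \<inter> B) \<le> prob B"
proof -
  obtain F where F: "tower n F" "prob (uncovered n F) < \<epsilon>"
    using rokhlin[OF small assms(2,3)] by blast
  obtain F' where "tower n F'" "real n * prob (F' \<inter> B) \<le> prob B"
    "prob (uncovered n F') = prob (uncovered n F)"
    using tower_shift[OF F(1) B assms(2)] by blast
  with F show ?thesis by (intro exI[of _ F']) simp
qed

end

section \<open>Sets of small positive measure in aperiodic systems\<close>

context mp_system begin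

text \<open>A point different from its next N - 1 images is separated from them by a finite
  intersection V of the sets \<open>U k\<close>. The points of V that do not return to V before time
  N form a tower base, of measure at most 1/N. Countably many such bases cover almost everything, so
  one of them has positive measure.\<close>

lemma small_sets:
  fixes U :: "nat \<Rightarrow> 'a set"
  assumes U[measurable]: "\<And>k. U k \<in> sets M"
    and sep: "\<And>x y. x \<in> space M \<Longrightarrow> y \<in> space M \<Longrightarrow> x \<noteq> y \<Longrightarrow> \<exists>k. x \<in> U k \<and> y \<notin> U k"
    and ap: "aperiodic M T" and "0 < \<delta>"
  shows "\<exists>A\<in>sets M. 0 < prob A \<and> prob A < \<delta>"
proof -
  obtain m where m: "inverse (real (Suc m)) < \<delta>" using reals_Archimedean[OF \<open>0 < \<delta>\<close>] by blast
  define N where "N = Suc m"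
  have N: "0 < N" "1 / real N < \<delta>" using m unfolding N_def inverse_eq_divide by simp_all
  define V where "V ks = {x \<in> space M. \<forall>k\<in>set ks. x \<in> U k}" for ks
  have V_meas[measurable]: "V ks \<in> sets M" for ks unfolding V_def by measurable
  define A where "A ks = {x \<in> V ks. \<forall>i<N. 0 < i \<longrightarrow> (T ^^ i) x \<notin> V ks}" for ks
  have "A ks = {x \<in> space M. x \<in> V ks \<and> (\<forall>i<N. 0 < i \<longrightarrow> (T ^^ i) x \<notin> V ks)}" for ks
    by (auto simp: A_def V_def)
  moreover have "\<dots> ks \<in> sets M" for ks by measurable
  ultimately have A_meas[measurable]: "A ks \<in> sets M" for ks by simp
  have "AE x in M. x \<in> (\<Union>ks. A ks)"
    using ap[unfolded aperiodic_def] AE_space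
  proof eventually_elim
    case (elim x)
    have "\<exists>k. x \<in> U k \<and> (T ^^ i) x \<notin> U k" if "0 < i" for i
      using elim that by (intro sep) (auto simp: Suc_le_eq eq_commute[of x])
    then obtain k where k: "\<And>i. 0 < i \<Longrightarrow> x \<in> U (k i) \<and> (T ^^ i) x \<notin> U (k i)" by metis
    have "x \<in> V (map k [1..<N])" using k elim by (simp add: V_def)
    moreover have "(T ^^ i) x \<notin> V (map k [1..<N])" if "i < N" "0 < i" for i
    proof -
      have "k i \<in> set (map k [1..<N])" using that by simp
      then show ?thesis using k[OF that(2)] by (auto simp: V_def)
    qed
    ultimately have "x \<in> A (map k [1..<N])" by (simp add: A_def)
    then show ?case by blast
  qed
  have "\<exists>ks. prob (A ks) \<noteq> 0"
  proof (rule ccontr)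
    assume "\<not> ?thesis"
    then have "(\<Union>ks. A ks) \<in> null_sets M"
      by (intro null_sets_UN') (auto simp: null_sets_def emeasure_eq_measure)
    then have "AE x in M. x \<notin> (\<Union>ks. A ks)" by (rule AE_not_in)
    with \<open>AE x in M. x \<in> (\<Union>ks. A ks)\<close> have "AE x in M. False" by eventually_elim simp
    then show False by simp
  qed
  then obtain ks where ks: "prob (A ks) \<noteq> 0" by blast
  have "tower N (A ks)" by (auto simp: tower_def A_def)
  then have "real N * prob (A ks) \<le> 1" by (rule prob_tower_base_le)
  then have "prob (A ks) \<le> 1 / real N" using N by (simp add: field_simps)
  then have "prob (A ks) < \<delta>" using N by linarith
  moreover have "0 < prob (A ks)" using ks measure_nonneg[of M "A ks"] by linarith
  ultimately show ?thesis using A_meas by blast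
qed

end

section \<open>Counting conditional names\<close>

text \<open>With \<open>w (v # V)\<close> the conditional probability of the letter \<open>v\<close> given the later letters \<open>V\<close>, the
  logarithm of the weight of a name is an ergodic sum, while the weights of all words of a given
  length sum to at most \<open>1\<close>.\<close>

primrec suffix_weight :: "('c list \<Rightarrow> real) \<Rightarrow> 'c list \<Rightarrow> real" where
  "suffix_weight w [] = 1"
| "suffix_weight w (v # V) = w (v # V) * suffix_weight w V"

lemma suffix_weight_nonneg: "(\<And>V. 0 \<le> w V) \<Longrightarrow> 0 \<le> suffix_weight w V"
  by (induction V) auto

lemma sum_suffix_weight_le_1:
  assumes "finite S" "\<And>V. 0 \<le> w V" "\<And>V. (\<Sum>v\<in>S. w (v # V)) \<le> 1"
  shows "(\<Sum>V\<in>{V. set V \<subseteq> S \<and> length V = N}. suffix_weight w V) \<le> 1"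
proof (induction N)
  case 0
  have "{V. set V \<subseteq> S \<and> length V = 0} = {[]}" by auto
  then show ?case by simp
next
  case (Suc N)
  let ?L = "{V. set V \<subseteq> S \<and> length V = N}"
  have "(\<Sum>V\<in>{V. set V \<subseteq> S \<and> length V = Suc N}. suffix_weight w V)
      = (\<Sum>(V, v)\<in>?L \<times> S. suffix_weight w (v # V))"
    unfolding lists_length_Suc_eq by (subst sum.reindex) (auto simp: inj_on_def intro!: sum.cong)
  also have "\<dots> = (\<Sum>V\<in>?L. (\<Sum>v\<in>S. w (v # V)) * suffix_weight w V)"
    by (simp add: sum.cartesian_product[symmetric] sum_distrib_right)
  also have "\<dots> \<le> (\<Sum>V\<in>?L. 1 * suffix_weight w V)"
    using assms suffix_weight_nonneg[of w] by (intro sum_mono mult_right_mono) auto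
  also have "\<dots> \<le> 1" using Suc by simp
  finally show ?case .
qed

text \<open>The weights form a subprobability on words of one length, so at most
  \<open>1 / \<beta>\<close> of them can reach \<open>\<beta>\<close>.\<close>

lemma card_heavy_words_le:
  assumes "finite S" "\<And>V. 0 \<le> w V" "\<And>V. (\<Sum>v\<in>S. w (v # V)) \<le> 1" "0 < \<beta>"
  shows "real (card {V. set V \<subseteq> S \<and> length V = N \<and> \<beta> \<le> suffix_weight w V}) \<le> 1 / \<beta>"
proof -
  let ?L = "{V. set V \<subseteq> S \<and> length V = N}" and ?H = "{V. set V \<subseteq> S \<and> length V = N \<and> \<beta> \<le> suffix_weight w V}"
  have fin: "finite ?L" by (rule finite_lists_length_eq[OF assms(1)])
  have "real (card ?H) * \<beta> = (\<Sum>V\<in>?H. \<beta>)" by simp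
  also have "\<dots> \<le> (\<Sum>V\<in>?H. suffix_weight w V)" by (intro sum_mono) auto
  also have "\<dots> \<le> (\<Sum>V\<in>?L. suffix_weight w V)"
    using fin suffix_weight_nonneg[of w] assms by (intro sum_mono2) auto
  also have "\<dots> \<le> 1" using sum_suffix_weight_le_1[OF assms(1-3)] .
  finally show ?thesis using assms(4) by (simp add: field_simps)
qed

lemma log_nonpos:
  fixes b t :: real
  assumes "0 \<le> t" "t \<le> 1" "1 < b" shows "log b t \<le> 0"
proof (cases "t = 0")
  case True
  then show ?thesis by (simp add: log_def)
next
  case False
  then show ?thesis using assms by (subst log_le_zero_cancel_iff) auto
qed

lemma exists_small_decrement:
  fixes f :: "nat \<Rightarrow> real"
  assumes "f 0 - f n < real n * c" shows "\<exists>i<n. f i - f (Suc i) < c"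
proof (rule ccontr)
  assume "\<not> ?thesis"
  then have "(\<Sum>i<n. c) \<le> (\<Sum>i<n. f i - f (Suc i))" by (intro sum_mono) auto
  also have "\<dots> = f 0 - f n" by (rule sum_lessThan_telescope')
  finally show False using assms by simp
qed

context mp_system begin

lemma take_names: "i + m \<le> j \<Longrightarrow> take m (names q i j x) = names q i (i + m) x"
  by (rule nth_equalityI) auto

lemma suffix_weight_names:
  "j \<le> n \<Longrightarrow> suffix_weight w (names q j n x) = (\<Prod>l\<in>{j..<n}. w (names q l n x))"
proof (induction "n - j" arbitrary: j)
  case 0
  then show ?case by (simp add: names_def)
next
  case (Suc k)
  then have "j < n" by simp
  have "suffix_weight w (names q j n x) = w (names q j n x) * suffix_weight w (names q (Suc j) n x)"
    by (simp only: names_Cons[OF \<open>j < n\<close>] suffix_weight.simps)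
  also have "suffix_weight w (names q (Suc j) n x) = (\<Prod>l\<in>{Suc j..<n}. w (names q l n x))"
    using Suc.hyps(2) \<open>j < n\<close> by (intro Suc.hyps(1)) auto
  finally show ?case using \<open>j < n\<close> by (simp add: prod.atLeast_Suc_lessThan)
qed

end

context ergodic_system begin

text \<open>The counting half of the Shannon-McMillan theorem, relative to \<open>r\<close>. For a
  typical point the product of conditional probabilities along its \<open>q\<close>-name is at least
  about \<open>b powr (- c * N)\<close>, and only \<open>b powr (c * N)\<close> words can weigh that
  much.\<close>

lemma conditional_covering:
  assumes q: "simple q" and r: "simple r"
    and S: "finite S" "q ` space M \<subseteq> S"
    and c: "ent (\<lambda>x. (names q 0 n0 x, names r 0 n0 x)) - ent (names r 0 n0) < real n0 * c"
    and "0 < \<epsilon>"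
  shows "\<exists>N0. \<forall>N\<ge>N0. \<exists>G\<in>sets M. prob (space M - G) < \<epsilon> \<and>
    (\<forall>u. real (card (names q 0 N ` {x \<in> G. names r 0 N x = u})) \<le> b powr (c * real N))"
proof -
  \<comment> \<open>The decrement at i is the conditional entropy of the letter of \<open>q\<close>
    at time i given its later letters and the whole \<open>r\<close>-name. Some decrement is at most
    the average, hence below \<open>c\<close>.\<close>
  define f where "f i = ent (\<lambda>x. (names q i n0 x, names r 0 n0 x))" for i
  have "f n0 = ent (names r 0 n0)"
  proof -
    have "names q n0 n0 = (\<lambda>x. [])" by (simp add: names_def fun_eq_iff)
    then show ?thesis unfolding f_def
      by (intro ent_eqI[symmetric, where f="\<lambda>u. ([], u)" and g=snd] simple_names[OF r]) auto
  qed
  then have "f 0 - f n0 < real n0 * c" using c by (simp add: f_def)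
  from exists_small_decrement[OF this] obtain i where i: "i < n0" "f i - f (Suc i) < c" by blast
  let ?W = "\<lambda>x. (names q i n0 x, names r 0 n0 x)" and ?Y = "\<lambda>x. (names q (Suc i) n0 x, names r 0 n0 x)"
  have W: "simple ?W" and Y: "simple ?Y"
    by (intro simple_function_Pair simple_names q r)+
  define PW where "PW v = prob {x \<in> space M. ?W x = v}" for v
  define PY where "PY v = prob {x \<in> space M. ?Y x = v}" for v
  have W_nonempty: "names q i n0 x = q ((T ^^ i) x) # names q (Suc i) n0 x" for x
    using i by (simp add: names_Cons)
  define \<kappa> where "\<kappa> v V u = PW (v # V, u) / PY (V, u)" for v V u
  have \<kappa>0: "0 \<le> \<kappa> v V u" for v V u by (simp add: \<kappa>_def PW_def PY_def)
  have \<kappa>1: "(\<Sum>v\<in>S. \<kappa> v V u) \<le> 1" for V u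
  proof -
    have "(\<Sum>v\<in>S. PW (v # V, u)) = prob (\<Union>v\<in>S. {x \<in> space M. ?W x = (v # V, u)})"
      unfolding PW_def using S simple_level_set[OF W]
      by (intro finite_measure_finite_Union[symmetric]) (auto simp: disjoint_family_on_def)
    also have "\<dots> \<le> PY (V, u)"
      unfolding PY_def using simple_level_set[OF Y] W_nonempty by (intro finite_measure_mono) auto
    finally have "(\<Sum>v\<in>S. PW (v # V, u)) \<le> PY (V, u)" .
    moreover have "0 \<le> PY (V, u)" by (simp add: PY_def)
    ultimately show ?thesis unfolding \<kappa>_def sum_divide_distrib[symmetric] by (auto simp: divide_le_eq_1)
  qed
  define g where "g x = - log b (\<kappa> (q ((T ^^ i) x)) (names q (Suc i) n0 x) (names r 0 n0 x))" for x
  have g_W: "g x = (\<lambda>(V, u). - log b (\<kappa> (hd V) (tl V) u)) (?W x)" for x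
    by (simp add: g_def W_nonempty)
  have kap: "\<kappa> (q ((T ^^ i) x)) (names q (Suc i) n0 x) (names r 0 n0 x) = point_prob ?W x / point_prob ?Y x" for x
    by (simp add: \<kappa>_def PW_def PY_def point_prob_def W_nonempty)
  have ple: "point_prob ?W x \<le> point_prob ?Y x" if "x \<in> space M" for x
    by (rule point_prob_anti[where f="\<lambda>(V, u). (tl V, u)", OF W Y _ that]) (simp add: W_nonempty)
  have g0: "0 \<le> g x" if "x \<in> space M" for x
  proof -
    have "point_prob ?W x / point_prob ?Y x \<le> 1" "0 \<le> point_prob ?W x / point_prob ?Y x"
      using ple[OF that] by (auto simp: divide_le_eq_1 point_prob_def zero_less_measure_iff)
    then have "log b (point_prob ?W x / point_prob ?Y x) \<le> 0" using b_gt_1 by (intro log_nonpos)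
    then show ?thesis unfolding g_def kap by simp
  qed
  have sg: "simple g"
    by (rule simple_factor[OF W]) (rule g_W)
  then have g_meas: "g \<in> borel_measurable M" by (rule borel_measurable_simple_function)
  have fin_g: "finite (g ` space M)" using sg by (simp add: simple_function_def)
  have gB: "g x \<le> Max (g ` space M)" if "x \<in> space M" for x
    using fin_g that by (intro Max_ge) auto
  have Eg: "expectation g = f i - f (Suc i)"
  proof -
    have "expectation g = expectation (\<lambda>x. log b (point_prob ?Y x) - log b (point_prob ?W x))"
    proof (rule integral_cong_AE)
      show "AE x in M. g x = log b (point_prob ?Y x) - log b (point_prob ?W x)"
        using AE_point_prob_pos[OF W] AE_point_prob_pos[OF Y]
      proof eventually_elim
        case (elim x)
        then show ?case using b_gt_1 unfolding g_def kap by (simp add: log_divide)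
      qed
    qed (use g_meas integrable_log_point_prob[OF W] integrable_log_point_prob[OF Y]
         in \<open>auto intro: borel_measurable_integrable\<close>)
    also have "\<dots> = f i - f (Suc i)"
      unfolding f_def ent_def using integrable_log_point_prob[OF W] integrable_log_point_prob[OF Y] by simp
    finally show ?thesis .
  qed
  obtain c' where c': "expectation g < c'" "c' < c" using dense i(2) Eg by metis
  have "0 \<le> expectation g" using g0 by (intro integral_nonneg_AE) auto
  then have "0 < c'" using c' by simp
  obtain N1 where N1: "\<And>N. N \<ge> N1 \<Longrightarrow> prob {x \<in> space M. (\<Sum>t<N. g ((T ^^ t) x)) > real N * c'} < \<epsilon>"
    using birkhoff_upper_bound[OF g_meas g0 gB c'(1) \<open>0 < \<epsilon>\<close>] by blast
  have "S \<noteq> {}" using S not_empty by auto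
  then have cS: "1 \<le> real (card S)" using S by (simp add: Suc_le_eq card_gt_0_iff)
  \<comment> \<open>From this length on, the slack between \<open>c'\<close> and \<open>c\<close>
    outweighs the fixed factor caused by the n0 - 1 positions near the ends of the name.\<close>
  obtain N2 :: nat where N2: "real (n0 - 1) * log b (real (card S)) < real N2 * (c - c')"
    using c' by (metis reals_Archimedean3 diff_gt_0_iff_gt)
  define N0 where "N0 = N1 + n0 + N2"
  show ?thesis
  proof (intro exI[of _ N0] allI impI)
    fix N assume N: "N \<ge> N0"
    \<comment> \<open>The number of windows of length n0 that fit into a name of length N.\<close>
    define m where "m = N - n0 + 1"
    have m: "m \<ge> N1" "m \<le> N" "N - m = n0 - 1" "n0 \<le> N" using N i by (auto simp: m_def N0_def)
    let ?Z = "{x \<in> space M. point_prob ?W x = 0}"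
    have Z: "?Z \<in> sets M" 
      using simple_pred_sets[OF W, of "\<lambda>v. prob {y \<in> space M. ?W y = v} = 0"]
      by (simp add: point_prob_def)
    have Z0: "prob ?Z = 0"
    proof -
      have "AE x in M. x \<notin> ?Z" using AE_point_prob_pos[OF W] by (rule eventually_mono) auto
      then show ?thesis using Z by (subst (asm) AE_iff_measurable[of ?Z]) (auto simp: measure_def)
    qed
    \<comment> \<open>Points where some conditional probability vanishes are removed: there
      \<open>log b 0 = 0\<close> would make \<open>g\<close> harmless although the weight is
      zero.\<close>
    define G where "G = {x \<in> space M. (\<Sum>t<m. g ((T ^^ t) x)) \<le> real m * c' \<and> (\<forall>t<m. (T ^^ t) x \<notin> ?Z)}"
    have G_meas: "G \<in> sets M" unfolding G_def using g_meas Z by measurable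
    have "prob (space M - G) < \<epsilon>"
    proof -
      let ?A = "{x \<in> space M. (\<Sum>t<m. g ((T ^^ t) x)) > real m * c'}"
      let ?B = "\<Union>t<m. {x \<in> space M. (T ^^ t) x \<in> ?Z}"
      have A: "?A \<in> sets M" using g_meas by measurable
      have Bt: "{x \<in> space M. (T ^^ t) x \<in> ?Z} \<in> sets M" for t using Z by measurable
      then have B: "?B \<in> sets M" by auto
      have "prob ?B \<le> (\<Sum>t<m. prob {x \<in> space M. (T ^^ t) x \<in> ?Z})"
        using Bt by (intro finite_measure_subadditive_finite) auto
      also have "\<dots> = 0" by (simp only: prob_preimage[OF mp_Tn Z] Z0) simp
      finally have "prob ?B \<le> 0" .
      moreover have "prob (space M - G) \<le> prob (?A \<union> ?B)"
        using A B by (intro finite_measure_mono) (auto simp: G_def)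
      moreover have "prob (?A \<union> ?B) \<le> prob ?A + prob ?B" by (rule measure_Un_le[OF A B])
      ultimately show ?thesis using N1[OF m(1)] by linarith
    qed
    moreover have "real (card (names q 0 N ` {x \<in> G. names r 0 N x = u})) \<le> b powr (c * real N)" for u
    proof -
      \<comment> \<open>A suffix knows its position through its length. Where the window around that
        position does not fit into the name, the uniform weight is used.\<close>
      define w where "w V = (let j = N - length V in
        if i \<le> j \<and> j < i + m then \<kappa> (hd V) (take (n0 - Suc i) (tl V)) (take n0 (drop (j - i) u)) else 1 / real (card S))" for V
      have w0: "0 \<le> w V" for V using \<kappa>0 by (simp add: w_def Let_def)
      have w1: "(\<Sum>v\<in>S. w (v # V)) \<le> 1" for V
      proof (cases "i \<le> N - Suc (length V) \<and> N - Suc (length V) < i + m")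
        case True
        then have "(\<Sum>v\<in>S. w (v # V))
          = (\<Sum>v\<in>S. \<kappa> v (take (n0 - Suc i) V) (take n0 (drop (N - Suc (length V) - i) u)))"
          by (intro sum.cong refl) (auto simp: w_def Let_def)
        then show ?thesis using \<kappa>1 by simp
      next
        case False
        then have "(\<Sum>v\<in>S. w (v # V)) = (\<Sum>v\<in>S. 1 / real (card S))"
          by (intro sum.cong refl) (auto simp: w_def Let_def)
        then show ?thesis using cS by simp
      qed
      \<comment> \<open>The least weight of a typical name: m conditional probabilities inside and
        n0 - 1 uniform factors at the ends.\<close>
      define \<beta> where "\<beta> = b powr (- (real m * c')) * (1 / real (card S)) ^ (n0 - 1)"
      have \<beta>: "0 < \<beta>" using cS b_gt_1 by (auto simp: \<beta>_def)
      have heavy: "\<beta> \<le> suffix_weight w (names q 0 N x)" if x: "x \<in> G" "names r 0 N x = u" for x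
      proof -
        have xs: "x \<in> space M" using x by (simp add: G_def)
        have in_win: "w (names q l N x) = b powr (- g ((T ^^ (l - i)) x))" if l: "i \<le> l" "l < i + m" for l
        proof -
          have lN: "l < N" "l + (n0 - i) \<le> N" "l - i + n0 \<le> N" "l - i < m" using l m i by (auto simp: m_def)
          let ?y = "(T ^^ (l - i)) x"
          have ys: "?y \<in> space M" using xs by simp
          have 1: "hd (names q l N x) = q ((T ^^ i) ?y)"
            using l lN by (simp add: names_Cons funpow_add[symmetric] flip: comp_apply[of "T ^^ _" "T ^^ _"])
          have 2: "take (n0 - Suc i) (tl (names q l N x)) = names q (Suc i) n0 ?y"
          proof -
            have "tl (names q l N x) = names q (Suc l) N x" using lN by (simp add: names_Cons)
            then have "take (n0 - Suc i) (tl (names q l N x)) = names q (Suc l) (Suc l + (n0 - Suc i)) x"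
              using lN i by (simp add: take_names)
            also have "\<dots> = names q (Suc i + (l - i)) (n0 + (l - i)) x"
              using l i by (intro arg_cong2[where f="\<lambda>a b. names q a b x"]) auto
            also have "\<dots> = names q (Suc i) n0 ?y" by (rule names_shift[symmetric])
            finally show ?thesis .
          qed
          have 3: "take n0 (drop (l - i) u) = names r 0 n0 ?y"
            using lN x(2)[symmetric] by (simp add: drop_take_names names_shift add.commute)
          have len: "N - length (names q l N x) = l" using lN by simp
          have "w (names q l N x) = \<kappa> (hd (names q l N x)) (take (n0 - Suc i) (tl (names q l N x))) (take n0 (drop (l - i) u))"
            unfolding w_def Let_def len by (rule if_P) (use l in simp)
          then have "w (names q l N x) = \<kappa> (q ((T ^^ i) ?y)) (names q (Suc i) n0 ?y) (names r 0 n0 ?y)"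
            unfolding 1 2 3 .
          moreover have "0 < \<kappa> (q ((T ^^ i) ?y)) (names q (Suc i) n0 ?y) (names r 0 n0 ?y)"
          proof -
            have "?y \<notin> ?Z" using x lN by (auto simp: G_def)
            then have "0 < point_prob ?W ?y" using ys by (auto simp: point_prob_def zero_less_measure_iff)
            then show ?thesis unfolding kap using ple[OF ys] by simp
          qed
          ultimately show ?thesis unfolding g_def using b_gt_1 by simp
        qed
        have out_win: "w (names q l N x) = 1 / real (card S)" if "l < N" "\<not> (i \<le> l \<and> l < i + m)" for l
          using that unfolding w_def Let_def by auto
        let ?I = "{i..<i + m}"
        have I: "?I \<subseteq> {0..<N}" using m i by (auto simp: m_def)
        have "suffix_weight w (names q 0 N x) = (\<Prod>l\<in>{0..<N}. w (names q l N x))"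
          by (rule suffix_weight_names) simp
        also have "\<dots> = (\<Prod>l\<in>{0..<N} - ?I. w (names q l N x)) * (\<Prod>l\<in>?I. w (names q l N x))"
          by (rule prod.subset_diff[OF I]) simp
        also have "(\<Prod>l\<in>{0..<N} - ?I. w (names q l N x)) = (\<Prod>l\<in>{0..<N} - ?I. 1 / real (card S))"
          by (rule prod.cong) (auto intro!: out_win)
        also have "\<dots> = (1 / real (card S)) ^ (n0 - 1)"
          using m(3) by (simp add: card_Diff_subset[OF _ I])
        also have "(\<Prod>l\<in>?I. w (names q l N x)) = (\<Prod>l\<in>?I. b powr (- g ((T ^^ (l - i)) x)))"
          by (rule prod.cong) (auto intro!: in_win)
        also have "\<dots> = (\<Prod>t<m. b powr (- g ((T ^^ t) x)))"
          by (rule prod.reindex_bij_witness[of _ "\<lambda>t. t + i" "\<lambda>l. l - i"]) auto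
        also have "\<dots> = b powr (\<Sum>t<m. - g ((T ^^ t) x))" using b_gt_1 by (simp add: powr_sum)
        finally have eq: "suffix_weight w (names q 0 N x)
          = (1 / real (card S)) ^ (n0 - 1) * b powr (- (\<Sum>t<m. g ((T ^^ t) x)))" by (simp add: sum_negf)
        have "b powr (- (real m * c')) \<le> b powr (- (\<Sum>t<m. g ((T ^^ t) x)))"
          using x b_gt_1 by (intro powr_mono) (auto simp: G_def)
        then show ?thesis unfolding eq \<beta>_def by (subst mult.commute) (intro mult_left_mono, auto)
      qed
      have "names q 0 N ` {x \<in> G. names r 0 N x = u} \<subseteq> {V. set V \<subseteq> S \<and> length V = N \<and> \<beta> \<le> suffix_weight w V}"
        using heavy S by (auto simp: names_def G_def intro!: subsetD[OF S(2)])
      then have "card (names q 0 N ` {x \<in> G. names r 0 N x = u}) \<le> card {V. set V \<subseteq> S \<and> length V = N \<and> \<beta> \<le> suffix_weight w V}"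
        using finite_lists_length_eq[OF S(1), of N] by (intro card_mono) (auto elim: rev_finite_subset)
      then have "real (card (names q 0 N ` {x \<in> G. names r 0 N x = u})) \<le> 1 / \<beta>"
        using card_heavy_words_le[OF S(1) w0 w1 \<beta>, of N] by linarith
      also have "1 / \<beta> = b powr (real m * c') * real (card S) ^ (n0 - 1)"
        by (simp add: \<beta>_def powr_minus_divide power_one_over)
      also have "real (card S) ^ (n0 - 1) = b powr (real (n0 - 1) * log b (real (card S)))"
      proof -
        have "b powr (real (n0 - 1) * log b (real (card S))) = (b powr log b (real (card S))) powr real (n0 - 1)"
          by (simp add: powr_powr mult.commute)
        also have "\<dots> = real (card S) ^ (n0 - 1)" using cS b_gt_1 by (simp add: powr_realpow)
        finally show ?thesis ..
      qed
      also have "b powr (real m * c') * \<dots> = b powr (real m * c' + real (n0 - 1) * log b (real (card S)))"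
        by (simp add: powr_add)
      also have "\<dots> \<le> b powr (c * real N)"
      proof (rule powr_mono)
        have "real N2 * (c - c') \<le> real N * (c - c')" using N c' by (intro mult_right_mono) (auto simp: N0_def)
        moreover have "real m * c' \<le> real N * c'" using m \<open>0 < c'\<close> by (intro mult_right_mono) auto
        ultimately show "real m * c' + real (n0 - 1) * log b (real (card S)) \<le> c * real N"
          using N2 by (simp add: algebra_simps)
      qed (use b_gt_1 in simp)
      finally show ?thesis .
    qed
    ultimately show "\<exists>G\<in>sets M. prob (space M - G) < \<epsilon> \<and>
      (\<forall>u. real (card (names q 0 N ` {x \<in> G. names r 0 N x = u})) \<le> b powr (c * real N))"
      using G_meas by blast
  qed
qed

end

section \<open>Block codes\<close>

lemma card_multiples_le:
  assumes "0 < L" shows "real (card {j. j < m \<and> L dvd j}) \<le> real m / real L + 1"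
proof -
  have "{j. j < m \<and> L dvd j} \<subseteq> (\<lambda>i. L * i) ` {..m div L}"
  proof
    fix j assume "j \<in> {j. j < m \<and> L dvd j}"
    then have "j = L * (j div L)" "j div L \<le> m div L" by (auto simp: div_le_mono)
    then show "j \<in> (\<lambda>i. L * i) ` {..m div L}" by blast
  qed
  then have "card {j. j < m \<and> L dvd j} \<le> card {..m div L}" by (rule surj_card_le[rotated]) simp
  then have "real (card {j. j < m \<and> L dvd j}) \<le> real (m div L) + 1" by simp
  also have "real (m div L) \<le> real m / real L" by (rule of_nat_div_le_of_nat)
  finally show ?thesis by simp
qed

text \<open>The letters on \<open>R\<close> survive the rewriting, so only pairs with the same
  letters there must be told apart. Among these, \<open>u\<close> is fixed by its first k letters
  and its letters on \<open>Bo\<close>, and each \<open>u\<close> allows at most \<open>C2\<close>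
  values of \<open>v\<close>. By hypothesis this product does not exceed the number of words on
  \<open>Fr\<close>.\<close>

lemma exists_block_code:
  fixes G :: "(nat list \<times> 'd) set" and C1 C2 :: real
  assumes G: "finite G" "\<And>u v. (u, v) \<in> G \<Longrightarrow> length u = n \<and> set u \<subseteq> {..<a}"
    and fin: "finite Fr" "finite Bo"
    and cover: "{..<n} = R \<union> Bo \<union> {..<k}"
    and c1: "real (card (take k ` fst ` G)) \<le> C1"
    and c2: "\<And>u. real (card {v. (u, v) \<in> G}) \<le> C2"
    and le: "C1 * real a ^ card Bo * C2 \<le> real a ^ card Fr"
  shows "\<exists>code. (\<forall>w\<in>G. code w \<in> Fr \<rightarrow>\<^sub>E {..<a}) \<and>
    inj_on (\<lambda>w. (restrict (\<lambda>j. fst w ! j) R, code w)) G"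
proof -
  define key where "key w = restrict (\<lambda>j. fst w ! j) R" for w :: "nat list \<times> 'd"
  have "\<exists>e. e ` {w \<in> G. key w = \<kappa>} \<subseteq> (Fr \<rightarrow>\<^sub>E {..<a}) \<and> inj_on e {w \<in> G. key w = \<kappa>}" for \<kappa>
  proof -
    let ?C = "{w \<in> G. key w = \<kappa>}" and ?P = "\<lambda>I. I \<rightarrow>\<^sub>E {..<a}"
    define U where "U = fst ` ?C"
    have finU: "finite U" using G by (simp add: U_def)
    have finV: "finite {v. (u, v) \<in> G}" for u
      by (rule finite_subset[of _ "snd ` G"]) (use G in force)+
    have PF: "finite (?P Fr)" "card (?P Fr) = a ^ card Fr" "finite (?P Bo)" "card (?P Bo) = a ^ card Bo"
      using fin by (auto intro!: finite_PiE simp: card_PiE)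
    have "inj_on (\<lambda>u. (take k u, restrict (\<lambda>j. u ! j) Bo)) U"
    proof (rule inj_onI)
      fix u u' assume u: "u \<in> U" "u' \<in> U"
        and eq: "(take k u, restrict (\<lambda>j. u ! j) Bo) = (take k u', restrict (\<lambda>j. u' ! j) Bo)"
      have len: "length u = n" "length u' = n" using u G by (auto simp: U_def)
      have keq: "restrict (\<lambda>j. u ! j) R = restrict (\<lambda>j. u' ! j) R" using u by (auto simp: U_def key_def)
      show "u = u'"
      proof (rule nth_equalityI)
        fix j assume "j < length u"
        then have "j \<in> R \<or> j \<in> Bo \<or> j < k" using len cover by auto
        then show "u ! j = u' ! j"
          using fun_cong[OF keq, of j] eq by (metis fun_cong nth_take prod.inject restrict_apply')
      qed (simp add: len)
    qed
    moreover have "(\<lambda>u. (take k u, restrict (\<lambda>j. u ! j) Bo)) ` U \<subseteq> take k ` fst ` G \<times> ?P Bo"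
    proof -
      have "Bo \<subseteq> {..<n}" using cover by auto
      then have "u ! j < a" if "(u, v) \<in> G" "j \<in> Bo" for u v j
        using G(2)[OF that(1)] that(2) by (metis lessThan_iff nth_mem subsetD)
      then show ?thesis by (auto simp: U_def intro!: imageI rev_image_eqI)
    qed
    ultimately have "card U \<le> card (take k ` fst ` G \<times> ?P Bo)"
      using G PF by (intro card_inj_on_le) auto
    then have "real (card U) \<le> real (card (take k ` fst ` G)) * real a ^ card Bo"
      by (simp add: card_cartesian_product PF flip: of_nat_mult of_nat_power)
    also have "\<dots> \<le> C1 * real a ^ card Bo" using c1 by (intro mult_right_mono) auto
    finally have U: "real (card U) \<le> C1 * real a ^ card Bo" .
    have C2: "0 \<le> C2" using order_trans[OF of_nat_0_le_iff c2] .
    have "card ?C \<le> card (SIGMA u:U. {v. (u, v) \<in> G})"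
      using finU finV by (intro card_mono) (auto simp: U_def image_iff)
    also have "\<dots> = (\<Sum>u\<in>U. card {v. (u, v) \<in> G})" using finU finV by (simp add: card_SigmaI)
    finally have "real (card ?C) \<le> real (\<Sum>u\<in>U. card {v. (u, v) \<in> G})" by (rule of_nat_mono)
    also have "\<dots> = (\<Sum>u\<in>U. real (card {v. (u, v) \<in> G}))" by simp
    also have "\<dots> \<le> real (card U) * C2" using sum_bounded_above[of U "\<lambda>u. real (card {v. (u, v) \<in> G})" C2] c2 by simp
    also have "\<dots> \<le> C1 * real a ^ card Bo * C2" using U C2 by (intro mult_right_mono)
    also have "\<dots> \<le> real (card (?P Fr))" using le PF by simp
    finally have "card ?C \<le> card (?P Fr)" by simp
    then show ?thesis using G PF card_le_inj[of ?C "?P Fr"] by auto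
  qed
  then have "\<forall>\<kappa>. \<exists>e. e ` {w \<in> G. key w = \<kappa>} \<subseteq> (Fr \<rightarrow>\<^sub>E {..<a}) \<and> inj_on e {w \<in> G. key w = \<kappa>}" by blast
  from choice[OF this] obtain e where e: "\<And>\<kappa>. e \<kappa> ` {w \<in> G. key w = \<kappa>} \<subseteq> (Fr \<rightarrow>\<^sub>E {..<a})"
    "\<And>\<kappa>. inj_on (e \<kappa>) {w \<in> G. key w = \<kappa>}" by blast
  have "inj_on (\<lambda>w. (key w, e (key w) w)) G"
    using e(2) by (auto simp: inj_on_def)
  then show ?thesis using e(1) by (intro exI[of _ "\<lambda>w. e (key w) w"]) (auto simp: key_def)
qed

text \<open>A block is marked by \<open>2L\<close> zeros at its beginning; ones at the later multiples of \<open>L\<close>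
  and at its end keep \<open>2L\<close> consecutive zeros from occurring anywhere else.\<close>

lemma exists_sync_position:
  fixes i n L :: nat
  assumes i: "0 < i" "i < n" and L: "0 < L" "2 * L < n"
  shows "\<exists>t<2 * L. i + t < n \<and> 2 * L \<le> i + t \<and> (L dvd i + t \<or> i + t = n - 1)"
proof (cases "i < 2 * L")
  case True
  then show ?thesis using i L by (intro exI[of _ "2 * L - i"]) auto
next
  case False
  define j where "j = (i + L - 1) div L * L"
  have "(i + L - 1) mod L < L" "i + L - 1 = j + (i + L - 1) mod L" using L by (auto simp: j_def)
  then have j: "i \<le> j" "j < i + L" using L by linarith+
  have "L dvd j" by (simp add: j_def)
  show ?thesis
  proof (cases "j < n")
    case True
    then show ?thesis using j False \<open>L dvd j\<close> by (intro exI[of _ "j - i"]) auto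
  next
    case nj: False
    then show ?thesis using j False i by (intro exI[of _ "n - 1 - i"]) auto
  qed
qed

context mp_system begin

lemma prob_le_sum_preimages:
  assumes I: "finite I" "\<And>i. i \<in> I \<Longrightarrow> measure_pres (S i)" and A: "A \<in> sets M"
    and X: "X \<subseteq> (\<Union>i\<in>I. {y \<in> space M. S i y \<in> A})"
  shows "prob X \<le> real (card I) * prob A"
proof -
  have lev: "{y \<in> space M. S i y \<in> A} \<in> sets M" if "i \<in> I" for i
    using measure_pres_measurable[OF I(2)[OF that]] A by measurable
  have "prob X \<le> prob (\<Union>i\<in>I. {y \<in> space M. S i y \<in> A})"
    using X I lev by (intro finite_measure_mono) auto
  also have "\<dots> \<le> (\<Sum>i\<in>I. prob {y \<in> space M. S i y \<in> A})"
    using I lev by (intro finite_measure_subadditive_finite) auto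
  also have "\<dots> = (\<Sum>i\<in>I. prob A)"
    by (intro sum.cong refl prob_preimage I A)
  finally show ?thesis by simp
qed

text \<open>\<open>Fr\<close> are the positions that carry the code, \<open>Bo\<close> the synchronising positions after the
  initial segment of length \<open>k\<close>.\<close>

lemma rewrite_blocks:
  fixes p q :: "'a \<Rightarrow> nat"
  assumes p: "simple p" "p ` space M \<subseteq> {..<a}" and q: "simple q" "q ` space M \<subseteq> {..<K}"
    and a: "2 \<le> a" and L: "0 < L" "2 * L \<le> k" "k + 2 \<le> n"
    and F: "tower n F" and Gd: "Gd \<in> sets M"
    and Fr_def: "Fr = {j. 2 * L \<le> j \<and> j < k \<and> \<not> L dvd j}"
    and Bo_def: "Bo = {j. k \<le> j \<and> j < n \<and> (L dvd j \<or> j = n - 1)}"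
    and c1: "real (card (names p 0 k ` Gd)) \<le> C1"
    and c2: "\<And>u. real (card (names q 0 n ` {x \<in> Gd. names p 0 n x = u})) \<le> C2"
    and le: "C1 * real a ^ card Bo * C2 \<le> real a ^ card Fr"
  shows "\<exists>p' r. simple p' \<and> p' ` space M \<subseteq> {..<a} \<and>
    prob (differ_within m p p')
      \<le> real m * prob (uncovered n F) + real (k + m + m * card Bo) * prob F \<and>
    finite_factor p' r \<and> r ` space M \<subseteq> {..<K} \<and>
    prob (differ q r)
      \<le> prob (uncovered n F) + real n * prob (F \<inter> (space M - Gd))"
proof -
  have kn: "2 * L < n" "k < n" using L by auto
  have [measurable]: "F \<in> sets M" "Gd \<in> sets M" using F Gd by (auto simp: tower_def)
  have Fs: "F \<subseteq> space M" by (rule sets.sets_into_space) measurable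
  note np = simple_names[OF p(1), of 0 n] and nq = simple_names[OF q(1), of 0 n]
  have p_lt: "p y < a" and q_lt: "q y < K" if "y \<in> space M" for y using p(2) q(2) that by auto
  define nm where "nm x = (names p 0 n x, names q 0 n x)" for x
  have snm: "simple nm" unfolding nm_def by (intro simple_function_Pair np nq)
  have Gds: "Gd \<subseteq> space M" using Gd by (rule sets.sets_into_space)
  define G where "G = nm ` Gd"
  define R where "R = {..<n} - Bo - {..<k}"
  have "finite G" unfolding G_def
    using snm Gds by (auto simp: simple_function_def intro: finite_subset[OF image_mono])
  moreover have names_p_lt: "set (names p 0 n x) \<subseteq> {..<a}" if "x \<in> space M" for x
    using p_lt that by (auto simp: names_def)
  then have "length u = n \<and> set u \<subseteq> {..<a}" if "(u, v) \<in> G" for u v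
    using that Gds by (auto simp: G_def nm_def)
  moreover have "finite Fr" "finite Bo" by (auto simp: Fr_def Bo_def)
  moreover have "{..<n} = R \<union> Bo \<union> {..<k}" using kn by (auto simp: R_def Bo_def)
  moreover have "real (card (take k ` fst ` G)) \<le> C1"
  proof -
    have "take k (fst (nm x)) = names p 0 k x" for x using kn by (simp add: nm_def take_names)
    then have "take k ` fst ` G = names p 0 k ` Gd" by (simp add: G_def image_image)
    then show ?thesis using c1 by simp
  qed
  moreover have "real (card {v. (u, v) \<in> G}) \<le> C2" for u
  proof -
    have "{v. (u, v) \<in> G} = names q 0 n ` {x \<in> Gd. names p 0 n x = u}" by (auto simp: G_def nm_def)
    then show ?thesis using c2 by simp
  qed
  ultimately have "\<exists>code. (\<forall>w\<in>G. code w \<in> Fr \<rightarrow>\<^sub>E {..<a}) \<and>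
      inj_on (\<lambda>w. (restrict (\<lambda>j. fst w ! j) R, code w)) G"
    using le by (rule exists_block_code)
  then obtain code where code: "\<And>w. w \<in> G \<Longrightarrow> code w \<in> Fr \<rightarrow>\<^sub>E {..<a}"
    and inj: "inj_on (\<lambda>w. (restrict (\<lambda>j. fst w ! j) R, code w)) G" by blast
  \<comment> \<open>The rewritten column: zeros as marker, code letters on \<open>Fr\<close>, old
    letters on \<open>R\<close>, ones elsewhere. Outside \<open>G\<close> no code exists, and a
    filler is written; markers and synchronising ones are the same for all \<open>w\<close>, so the
    base remains visible there too.\<close>
  define E where "E w j = (if j \<in> Fr then (if w \<in> G then code w j else 1)
    else if j < 2 * L then 0 else if j \<in> R then fst w ! j else 1)" for w j
  have E0: "E w j = 0" if "j < 2 * L" for w j using that by (auto simp: E_def Fr_def)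
  have ER: "E w j = fst w ! j" if "j < n" "\<not> j < k" "j \<notin> Bo" for w j
    using that L by (auto simp: E_def Fr_def R_def)
  have E1: "E w j = 1" if "2 * L \<le> j" "j < n" "L dvd j \<or> j = n - 1" for w j
    using that L by (auto simp: E_def Fr_def R_def Bo_def)
  have E_lt: "E (nm x) j < a" if "x \<in> space M" "j < n" for x j
  proof -
    have "names p 0 n x ! j < a" using names_p_lt[OF that(1)] that(2) nth_mem[of j "names p 0 n x"] by auto
    moreover have "code w j < a" if "w \<in> G" "j \<in> Fr" for w using code[OF that(1)] that(2) by auto
    ultimately show ?thesis using a by (simp add: E_def nm_def)
  qed
  define enc where "enc w = restrict (E w) {..<n}" for w
  have enc_inj: "inj_on enc G"
  proof (rule inj_onI)
    fix w w' assume w: "w \<in> G" "w' \<in> G" and eq: "enc w = enc w'"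
    have Ee: "E w j = E w' j" if "j < n" for j
      using fun_cong[OF eq, of j] that by (simp add: enc_def)
    have "restrict (\<lambda>j. fst w ! j) R = restrict (\<lambda>j. fst w' ! j) R"
    proof (rule restrict_ext)
      fix j assume "j \<in> R"
      then have "j < n" "\<not> j < k" "j \<notin> Bo" by (auto simp: R_def)
      then show "fst w ! j = fst w' ! j" using ER Ee by metis
    qed
    moreover have "code w = code w'"
    proof (rule PiE_ext[OF code[OF w(1)] code[OF w(2)]])
      fix j assume j: "j \<in> Fr"
      then have "j < n" using kn by (auto simp: Fr_def)
      then show "code w j = code w' j" using Ee[of j] j w by (simp add: E_def)
    qed
    ultimately show "w = w'" using inj w by (auto dest: inj_onD)
  qed

  define \<xi> where "\<xi> x = (x \<in> F, nm x)" for x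
  have s\<xi>: "simple \<xi>"
  proof -
    have "simple (\<lambda>x. x \<in> F)"
    proof -
      have "(\<lambda>x. x \<in> F) \<in> measurable M (count_space UNIV)" by measurable
      then show ?thesis by (auto simp: simple_function_eq_measurable intro: finite_subset[of _ UNIV])
    qed
    then show ?thesis unfolding \<xi>_def by (intro simple_function_Pair snm)
  qed
  \<comment> \<open>Presenting \<open>p'\<close> as a block code of \<open>\<xi>\<close> over the
    times -n, ..., 0 gives measurability at once. Entry n - i belongs to time -i, so i is the height
    above the base. Off the tower the letter is 1, which cannot start a marker.\<close>
  define \<Psi> where "\<Psi> l = (if \<exists>i<n. fst (l ! (n - i)) then
     (let i = LEAST i. i < n \<and> fst (l ! (n - i)) in E (snd (l ! (n - i))) i) else 1)" for l
  define p' where "p' y = \<Psi> (names \<xi> 0 (Suc n) ((Ti ^^ n) y))" for y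
  have sp': "simple p'"
    unfolding p'_def
    by (rule simple_factor[where f=\<Psi>, OF simple_measure_pres[OF mp_Tin simple_names[OF s\<xi>]]])
      (rule refl)
  have \<xi>_at: "names \<xi> 0 (Suc n) ((Ti ^^ n) y) ! (n - i) = \<xi> ((Ti ^^ i) y)" if "y \<in> space M" "i < n" for y i
    using that by (simp add: Tn_Tin_le)
  have \<xi>_fst: "fst (names \<xi> 0 (Suc n) ((Ti ^^ n) y) ! (n - i)) \<longleftrightarrow> (Ti ^^ i) y \<in> F"
    and \<xi>_snd: "snd (names \<xi> 0 (Suc n) ((Ti ^^ n) y) ! (n - i)) = nm ((Ti ^^ i) y)" if "y \<in> space M" "i < n" for y i
    unfolding \<xi>_at[OF that] by (simp_all add: \<xi>_def)
  have p'_in: "p' y = E (nm ((Ti ^^ i) y)) i" if y: "y \<in> space M" "i < n" "(Ti ^^ i) y \<in> F" for y i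
  proof -
    let ?l = "names \<xi> 0 (Suc n) ((Ti ^^ n) y)"
    have iff: "j < n \<and> fst (?l ! (n - j)) \<longleftrightarrow> j = i" for j
    proof
      assume j: "j < n \<and> fst (?l ! (n - j))"
      then have "(Ti ^^ j) y \<in> F" using \<xi>_fst[OF y(1)] by blast
      then show "j = i" using tower_unique[OF F y(1)] y j by blast
    next
      assume "j = i" then show "j < n \<and> fst (?l ! (n - j))" using \<xi>_fst[OF y(1)] y by blast
    qed
    then have ex: "\<exists>i<n. fst (?l ! (n - i))" by blast
    have "(LEAST j. j < n \<and> fst (?l ! (n - j))) = i" unfolding iff by (rule Least_equality) auto
    then show ?thesis unfolding p'_def \<Psi>_def Let_def if_P[OF ex] by (simp only: \<xi>_snd[OF y(1,2)])
  qed
  have p'_out: "p' y = 1" if y: "y \<in> space M" "\<And>i. i < n \<Longrightarrow> (Ti ^^ i) y \<notin> F" for y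
  proof -
    have "\<not> (\<exists>i<n. fst (names \<xi> 0 (Suc n) ((Ti ^^ n) y) ! (n - i)))"
      using \<xi>_fst[OF y(1)] y(2) by blast
    then show ?thesis unfolding p'_def \<Psi>_def by (rule if_not_P)
  qed
  have p'_base: "p' ((T ^^ t) x) = E (nm x) t" if "x \<in> F" "t < n" for x t
    using p'_in[of "(T ^^ t) x" t] that Fs by auto
  have p'_lt: "p' ` space M \<subseteq> {..<a}"
  proof
    fix v assume "v \<in> p' ` space M"
    then obtain y where y: "y \<in> space M" "v = p' y" by blast
    show "v \<in> {..<a}"
    proof (cases "\<exists>i<n. (Ti ^^ i) y \<in> F")
      case True
      then show ?thesis using p'_in[OF y(1)] E_lt Fs y by fastforce
    next
      case False
      then show ?thesis using p'_out[OF y(1)] y a by auto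
    qed
  qed
  \<comment> \<open>Any run of 2L positions that starts at positive height meets a synchronising 1
    before the column ends, whatever the code letters are.\<close>
  have marker: "x \<in> F \<longleftrightarrow> (\<forall>t<2 * L. p' ((T ^^ t) x) = 0)" if x: "x \<in> space M" for x
  proof
    assume "x \<in> F"
    then show "\<forall>t<2 * L. p' ((T ^^ t) x) = 0" using p'_base kn E0 by auto
  next
    assume z: "\<forall>t<2 * L. p' ((T ^^ t) x) = 0"
    show "x \<in> F"
    proof (cases "\<exists>i<n. (Ti ^^ i) x \<in> F")
      case True
      then obtain i where i: "i < n" "(Ti ^^ i) x \<in> F" by blast
      have "i = 0"
      proof (rule ccontr)
        assume "i \<noteq> 0"
        then obtain t where t: "t < 2 * L" "i + t < n" "2 * L \<le> i + t" "L dvd i + t \<or> i + t = n - 1"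
          using exists_sync_position[of i n L] i L kn by auto
        have "p' ((T ^^ (i + t)) ((Ti ^^ i) x)) = 1" using p'_base[OF i(2) t(2)] E1[OF t(3,2,4)] by simp
        then show False using z t x by (simp add: Tn_Tin_ge)
      qed
      then show ?thesis using i by simp
    next
      case False
      then have "p' x = 1" using p'_out[OF x] by blast
      moreover have "p' x = 0" using z[rule_format, of 0] L by simp
      ultimately show ?thesis by simp
    qed
  qed
  define mk where "mk l i \<longleftrightarrow> (\<forall>t<2 * L. l ! (n - i + t) = (0::nat))" for l i
  \<comment> \<open>The decoder looks back for the marker, which gives the height i, reads the whole
    column, inverts the encoding and outputs letter i of the \<open>q\<close>-name. The times -n,
    ..., n contain the entire column.\<close>
  define \<psi> where "\<psi> l = (if \<exists>i<n. mk l i then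
     (let i = LEAST i. i < n \<and> mk l i; W = restrict (\<lambda>t. l ! (n - i + t)) {..<n} in
       if W \<in> enc ` G then snd (inv_into G enc W) ! i else 0) else 0)" for l
  define r where "r y = \<psi> (names p' 0 (2 * n + 1) ((Ti ^^ n) y))" for y
  have at: "names p' 0 (2 * n + 1) ((Ti ^^ n) y) ! (n - i + t) = p' ((T ^^ t) ((Ti ^^ i) y))"
    if "y \<in> space M" "i < n" "t \<le> n" for y i t
  proof -
    have "names p' 0 (2 * n + 1) ((Ti ^^ n) y) ! (n - i + t) = p' ((T ^^ (t + (n - i))) ((Ti ^^ n) y))"
      using that by (subst nth_names) (auto simp: add.commute)
    also have "\<dots> = p' ((T ^^ t) ((T ^^ (n - i)) ((Ti ^^ n) y)))" by (simp add: funpow_add)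
    also have "(T ^^ (n - i)) ((Ti ^^ n) y) = (Ti ^^ i) y" using that by (simp add: Tn_Tin_le)
    finally show ?thesis .
  qed
  have mk_iff: "mk (names p' 0 (2 * n + 1) ((Ti ^^ n) y)) i \<longleftrightarrow> (Ti ^^ i) y \<in> F" if "y \<in> space M" "i < n" for y i
    unfolding mk_def using at[OF that] kn marker[of "(Ti ^^ i) y"] that by auto
  have r_ok: "r y = q y" if y: "y \<in> space M" "i < n" "(Ti ^^ i) y \<in> F" "(Ti ^^ i) y \<in> Gd" for y i
  proof -
    let ?l = "names p' 0 (2 * n + 1) ((Ti ^^ n) y)" and ?x = "(Ti ^^ i) y"
    have iff: "j < n \<and> mk ?l j \<longleftrightarrow> j = i" for j
      using mk_iff[OF y(1)] tower_unique[OF F y(1)] y by blast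
    then have ex: "\<exists>i<n. mk ?l i" by blast
    have le: "(LEAST j. j < n \<and> mk ?l j) = i" unfolding iff by (rule Least_equality) auto
    have W: "restrict (\<lambda>t. ?l ! (n - i + t)) {..<n} = enc (nm ?x)"
      unfolding enc_def using at[OF y(1,2)] p'_base[OF y(3)] by (intro restrict_ext) auto
    have "nm ?x \<in> G" using y by (simp add: G_def)
    then have "r y = snd (nm ?x) ! i"
      unfolding r_def \<psi>_def Let_def le W using ex enc_inj by (simp add: inv_into_f_f)
    also have "\<dots> = q y" using y by (simp add: nm_def)
    finally show ?thesis .
  qed
  have "finite_factor p' r" unfolding finite_factor_def r_def by blast
  then have sr: "simple r" by (rule simple_finite_factor[OF sp'])
  have "0 < K" using q(2) not_empty by auto
  have r_lt: "r ` space M \<subseteq> {..<K}"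
  proof
    fix v assume "v \<in> r ` space M"
    then obtain y where y: "y \<in> space M" "v = r y" by blast
    have G_lt: "snd w ! i < K" if "w \<in> G" "i < n" for w i
      using that q_lt Gds by (auto simp: G_def nm_def)
    let ?l = "names p' 0 (2 * n + 1) ((Ti ^^ n) y)"
    have "(LEAST i. i < n \<and> mk ?l i) < n" if "\<exists>i<n. mk ?l i"
      using LeastI_ex[of "\<lambda>i. i < n \<and> mk ?l i"] that by blast
    then have "snd (inv_into G enc W) ! (LEAST i. i < n \<and> mk ?l i) < K"
      if "\<exists>i<n. mk ?l i" "W \<in> enc ` G" for W
      using G_lt[OF inv_into_into[OF that(2)]] that(1) by blast
    then have "\<psi> ?l < K" unfolding \<psi>_def Let_def using \<open>0 < K\<close> by (simp split: if_split)
    then show "v \<in> {..<K}" using y by (simp add: r_def)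
  qed
  let ?out = "uncovered n F"
  have out_meas: "?out \<in> sets M" and F_meas: "F \<in> sets M" by measurable
  have P1: "prob (differ_within m p p')
    \<le> real m * prob ?out + real (k + m + m * card Bo) * prob F"
  proof -
    let ?U = "\<Union>j\<in>{..<m}. {y \<in> space M. (T ^^ j) y \<in> ?out}"
    \<comment> \<open>The altered initial segments are intervals, so meeting one within m steps
      costs k + m levels instead of m * k. Only the scattered positions in \<open>Bo\<close> are
      charged m times each.\<close>
    let ?X1 = "\<Union>l\<in>{..<k + m}. {y \<in> space M. ((Ti ^^ l) \<circ> (T ^^ m)) y \<in> F}"
    let ?X2 = "\<Union>(j, i)\<in>{..<m} \<times> Bo. {y \<in> space M. ((Ti ^^ i) \<circ> (T ^^ j)) y \<in> F}"
    let ?X = "differ_within m p p'"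
    have "?X \<subseteq> ?U \<union> ?X1 \<union> ?X2"
    proof
      fix x assume "x \<in> ?X"
      then obtain j where x: "x \<in> space M" and j: "j < m" and ne: "p ((T ^^ j) x) \<noteq> p' ((T ^^ j) x)" by blast
      let ?y = "(T ^^ j) x"
      have y: "?y \<in> space M" using x by simp
      show "x \<in> ?U \<union> ?X1 \<union> ?X2"
      proof (cases "\<exists>i<n. (Ti ^^ i) ?y \<in> F")
        case True
        then obtain i where i: "i < n" "(Ti ^^ i) ?y \<in> F" by blast
        have "i < k \<or> i \<in> Bo"
        proof (rule ccontr)
          assume "\<not> ?thesis"
          then have "p' ?y = p ?y" using p'_in[OF y i] ER[OF i(1)] i y by (simp add: nm_def)
          then show False using ne by simp
        qed
        then show ?thesis
        proof
          assume "i < k"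
          moreover have "(Ti ^^ (i + (m - j))) ((T ^^ m) x) = (Ti ^^ i) ?y"
            using Tin_Tn_ge[OF x, of "m - j" m] j by (simp only: funpow_add comp_apply) simp
          ultimately have "i + (m - j) < k + m" "((Ti ^^ (i + (m - j))) \<circ> (T ^^ m)) x \<in> F" using i j by auto
          then show ?thesis using x by blast
        next
          assume "i \<in> Bo"
          then show ?thesis using i j x by auto
        qed
      next
        case False
        then have "?y \<in> ?out" using y by simp
        then have "x \<in> ?U" using x j by auto
        then show ?thesis by (intro UnI1)
      qed
    qed
    moreover have sX: "?U \<in> sets M" "?X1 \<in> sets M" "?X2 \<in> sets M"
    proof -
      have "finite Bo" by (simp add: Bo_def)
      then show "?U \<in> sets M" "?X1 \<in> sets M" "?X2 \<in> sets M"
        using out_meas by (auto intro!: sets.finite_UN)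
    qed
    ultimately have "prob ?X \<le> prob (?U \<union> ?X1 \<union> ?X2)" by (intro finite_measure_mono) auto
    also have "\<dots> \<le> prob (?U \<union> ?X1) + prob ?X2" by (rule measure_Un_le) (use sX in auto)
    also have "prob (?U \<union> ?X1) \<le> prob ?U + prob ?X1" by (rule measure_Un_le[OF sX(1,2)])
    also have "prob ?U \<le> real (card {..<m}) * prob ?out"
      by (rule prob_le_sum_preimages[where S="\<lambda>j. T ^^ j", OF _ mp_Tn out_meas]) auto
    also have "prob ?X1 \<le> real (card {..<k + m}) * prob F"
      by (rule prob_le_sum_preimages[where S="\<lambda>l. (Ti ^^ l) \<circ> (T ^^ m)", OF _ measure_pres_comp[OF mp_Tin mp_Tn] F_meas]) auto
    also have "prob ?X2 \<le> real (card ({..<m} \<times> Bo)) * prob F"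
      by (rule prob_le_sum_preimages[where S="\<lambda>(j, i). (Ti ^^ i) \<circ> (T ^^ j)", OF _ _ F_meas])
        (auto simp: Bo_def intro!: measure_pres_comp mp_Tin mp_Tn)
    finally show ?thesis by (simp add: card_cartesian_product algebra_simps)
  qed
  have P2: "prob (differ q r) \<le> prob ?out + real n * prob (F \<inter> (space M - Gd))"
  proof -
    let ?B = "F \<inter> (space M - Gd)"
    \<comment> \<open>Decoding can fail only off the tower or in a column whose base point lies
      outside \<open>Gd\<close>.\<close>
    let ?X1 = "\<Union>i\<in>{..<n}. {y \<in> space M. (Ti ^^ i) y \<in> ?B}"
    have B: "?B \<in> sets M" by measurable
    have "differ q r \<subseteq> ?out \<union> ?X1"
    proof
      fix y assume "y \<in> differ q r"
      then have y: "y \<in> space M" "r y \<noteq> q y" by auto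
      show "y \<in> ?out \<union> ?X1"
      proof (cases "\<exists>i<n. (Ti ^^ i) y \<in> F")
        case True
        then obtain i where i: "i < n" "(Ti ^^ i) y \<in> F" by blast
        then have "(Ti ^^ i) y \<notin> Gd" using r_ok[OF y(1) i] y by blast
        then show ?thesis using i y by auto
      qed (use y in blast)
    qed
    moreover have sX: "?X1 \<in> sets M" by measurable
    ultimately have "prob (differ q r) \<le> prob (?out \<union> ?X1)"
      using out_meas by (intro finite_measure_mono) auto
    also have "\<dots> \<le> prob ?out + prob ?X1" by (rule measure_Un_le[OF out_meas sX])
    also have "prob ?X1 \<le> real (card {..<n}) * prob ?B"
      by (rule prob_le_sum_preimages[where S="\<lambda>i. Ti ^^ i", OF _ mp_Tin B]) auto
    finally show ?thesis by simp
  qed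
  show ?thesis
    using sp' p'_lt P1 \<open>finite_factor p' r\<close> r_lt P2 by blast
qed

end

section \<open>Systems of entropy h and the coding step\<close>

locale finite_entropy_system = ergodic_system +
  fixes h :: real
  assumes small_sets_exist: "\<And>\<delta>. 0 < \<delta> \<Longrightarrow> \<exists>A\<in>sets M. 0 < prob A \<and> prob A < \<delta>"
    and rate_le: "\<And>z K. simple z \<Longrightarrow> z ` space M \<subseteq> {..<K::nat} \<Longrightarrow> rate z \<le> h"
    and rate_approx: "\<And>\<delta>. 0 < \<delta> \<Longrightarrow> \<exists>z K. simple z \<and> z ` space M \<subseteq> {..<K::nat} \<and> h - \<delta> < rate z"
begin

text \<open>The order of quantifiers is the point: one deficit \<open>\<delta>\<close> serves all
  windows \<open>m\<close>, all alphabets \<open>K\<close> and all accuracies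
  \<open>\<eta>\<close>.\<close>

definition codable :: "nat \<Rightarrow> real \<Rightarrow> real \<Rightarrow> bool" where
  "codable a \<epsilon> \<delta> \<longleftrightarrow> (\<forall>p q K \<eta> m. simple p \<and> p ` space M \<subseteq> {..<a} \<and> h - \<delta> < rate p \<and>
      simple q \<and> q ` space M \<subseteq> {..<K::nat} \<and> 0 < \<eta> \<longrightarrow>
    (\<exists>p' r. simple p' \<and> p' ` space M \<subseteq> {..<a} \<and> prob (differ_within m p p') < \<epsilon> \<and>
      finite_factor p' r \<and> r ` space M \<subseteq> {..<K} \<and> prob (differ q r) < \<eta>))"

text \<open>All choices are made so that the code fits and the altered part stays small:
  \<open>J\<close> bounds the share of the initial segment, \<open>L\<close> the density of
  synchronising letters, \<open>k\<close> the boundary effects.\<close>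

lemma coding_step:
  assumes a: "2 \<le> a" and h: "h < log b (real a)" and "0 < \<epsilon>"
  obtains \<delta> where "0 < \<delta>" "codable a \<epsilon> \<delta>"
proof -
  define lg where "lg = log b (real a)"
  have lg: "0 < lg" unfolding lg_def using a b_gt_1 by simp
  define \<gamma> where "\<gamma> = lg - h"
  have \<gamma>: "0 < \<gamma>" using h by (simp add: \<gamma>_def lg_def)
  obtain J0 :: nat where J0: "8 / \<epsilon> < real J0" using reals_Archimedean2 by blast
  define J where "J = J0 + 2"
  have J: "2 \<le> J" "8 / \<epsilon> < real J" using J0 by (auto simp: J_def)
  \<comment> \<open>Chosen so that describing the \<open>q\<close>-name of a column of height J * k
    costs just a quarter of the surplus \<open>\<gamma> * k\<close>.\<close>
  define \<delta> where "\<delta> = \<gamma> / (4 * real J)"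
  have "0 < \<delta>" using \<gamma> J by (simp add: \<delta>_def)
  have key: "\<exists>p' r. simple p' \<and> p' ` space M \<subseteq> {..<a} \<and> prob (differ_within m p p') < \<epsilon> \<and>
      finite_factor p' r \<and> r ` space M \<subseteq> {..<K} \<and> prob (differ q r) < \<eta>"
    if p: "simple p" "p ` space M \<subseteq> {..<a}" and hp: "h - \<delta> < rate p"
      and q: "simple q" "q ` space M \<subseteq> {..<K::nat}" and "0 < \<eta>" for p q K \<eta> m
  proof -
    \<comment> \<open>The first bound makes synchronising letters rare enough to be met within m
      steps with probability at most \<open>\<epsilon> / 8\<close>; the second keeps their cost
      below a quarter of the surplus.\<close>
    obtain L0 :: nat where L0: "max (8 * real m / \<epsilon>) (4 * (real J + 1) * lg / \<gamma>) < real L0" using reals_Archimedean2 by blast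
    define L where "L = Suc L0"
    have L: "0 < L" "8 * real m / \<epsilon> < real L" "4 * (real J + 1) * lg / \<gamma> < real L" using L0 by (auto simp: L_def)
    note np = simple_names[OF p(1)] and nq = simple_names[OF q(1)]
    \<comment> \<open>The pair of \<open>p\<close> and \<open>q\<close> as one letter. Its rate is
      at most \<open>h\<close> while that of \<open>p\<close> exceeds \<open>h - \<delta>\<close>,
      so the conditional entropy of \<open>q\<close>-names given \<open>p\<close>-names is below
      \<open>\<delta>\<close> per letter.\<close>
    define z where "z x = p x + a * q x" for x
    have sz: "simple z"
      by (rule simple_factor[where f="\<lambda>(u, v). u + a * v", OF simple_function_Pair[OF p(1) q(1)]])
         (simp add: z_def)
    have zK: "z ` space M \<subseteq> {..<a * K}"
    proof
      fix v assume "v \<in> z ` space M"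
      then obtain x where x: "p x < a" "q x < K" "v = p x + a * q x" using p(2) q(2) by (auto simp: z_def)
      then have "v < a + a * q x" by simp
      also have "\<dots> = a * Suc (q x)" by simp
      also have "\<dots> \<le> a * K" using x by (intro mult_le_mono) auto
      finally show "v \<in> {..<a * K}" by simp
    qed
    have pz: "p x = z x mod a" "q x = z x div a" if "x \<in> space M" for x
    proof -
      have "p x < a" using p(2) that by auto
      then show "p x = z x mod a" "q x = z x div a" by (auto simp: z_def)
    qed
    have "(\<lambda>n. ent (names z 0 n) / real n - ent (names p 0 n) / real n) \<longlonglongrightarrow> rate z - rate p"
      by (intro tendsto_diff rate_LIMSEQ sz p)
    moreover have "rate z - rate p < \<delta>" using rate_le[OF sz zK] hp by simp
    ultimately have "\<forall>\<^sub>F n in sequentially. ent (names z 0 n) / real n - ent (names p 0 n) / real n < \<delta>"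
      by (rule order_tendstoD(2))
    then obtain n0 where n0: "\<And>n. n \<ge> n0 \<Longrightarrow> ent (names z 0 n) / real n - ent (names p 0 n) / real n < \<delta>"
      by (auto simp: eventually_sequentially)
    define n2 where "n2 = Suc n0"
    have "ent (names z 0 n2) / real n2 - ent (names p 0 n2) / real n2 < \<delta>" by (rule n0) (simp add: n2_def)
    then have d2: "ent (names z 0 n2) - ent (names p 0 n2) < real n2 * \<delta>"
      by (simp add: n2_def diff_divide_distrib[symmetric] pos_divide_less_eq mult.commute del: of_nat_Suc)
    have "ent (\<lambda>x. (names q 0 n2 x, names p 0 n2 x)) \<le> ent (names z 0 n2)"
    proof (rule ent_factor_le[where f="\<lambda>l. (map (\<lambda>v. v div a) l, map (\<lambda>v. v mod a) l)"])
      show "simple (names z 0 n2)" by (rule simple_names[OF sz])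
      fix x assume "x \<in> space M"
      then show "(names q 0 n2 x, names p 0 n2 x) = (map (\<lambda>v. v div a) (names z 0 n2 x), map (\<lambda>v. v mod a) (names z 0 n2 x))"
        by (auto simp: names_def pz)
    qed
    with d2 have c2: "ent (\<lambda>x. (names q 0 n2 x, names p 0 n2 x)) - ent (names p 0 n2) < real n2 * \<delta>" by simp
    have "rate p < h + \<gamma> / 4" using rate_le[OF p] \<gamma> by simp
    with rate_LIMSEQ[OF p(1)] have "\<forall>\<^sub>F n in sequentially. ent (names p 0 n) / real n < h + \<gamma> / 4"
      by (rule order_tendstoD(2))
    then obtain m0 where m0: "\<And>n. n \<ge> m0 \<Longrightarrow> ent (names p 0 n) / real n < h + \<gamma> / 4"
      by (auto simp: eventually_sequentially)
    define n1 where "n1 = Suc m0"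
    have "ent (names p 0 n1) / real n1 < h + \<gamma> / 4" by (rule m0) (simp add: n1_def)
    then have d1: "ent (names p 0 n1) < real n1 * (h + \<gamma> / 4)"
      by (simp add: n1_def pos_divide_less_eq mult.commute del: of_nat_Suc)
    \<comment> \<open>Conditioning on a trivial process turns the relative count into an absolute
      one.\<close>
    let ?o = "\<lambda>x::'a. 0::nat"
    have so: "simple ?o" by simp
    have "ent (\<lambda>x. (names p 0 n1 x, names ?o 0 n1 x)) \<le> ent (names p 0 n1)"
      by (rule ent_factor_le[where f="\<lambda>l. (l, replicate n1 0)", OF np]) (simp add: names_def map_replicate_const)
    with d1 ent_nonneg[OF simple_names[OF so, of 0 n1]]
    have c1: "ent (\<lambda>x. (names p 0 n1 x, names ?o 0 n1 x)) - ent (names ?o 0 n1) < real n1 * (h + \<gamma> / 4)" by simp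
    have "0 < \<eta> / 4" using \<open>0 < \<eta>\<close> by simp
    obtain N1 where N1: "\<And>N. N \<ge> N1 \<Longrightarrow> \<exists>G\<in>sets M. prob (space M - G) < \<eta> / 4 \<and>
      (\<forall>u. real (card (names p 0 N ` {x \<in> G. names ?o 0 N x = u})) \<le> b powr ((h + \<gamma> / 4) * real N))"
      using conditional_covering[OF p(1) so _ p(2) c1 \<open>0 < \<eta> / 4\<close>] by auto
    obtain N2 where N2: "\<And>N. N \<ge> N2 \<Longrightarrow> \<exists>G\<in>sets M. prob (space M - G) < \<eta> / 4 \<and>
      (\<forall>u. real (card (names q 0 N ` {x \<in> G. names p 0 N x = u})) \<le> b powr (\<delta> * real N))"
      using conditional_covering[OF q(1) p(1) _ q(2) c2 \<open>0 < \<eta> / 4\<close>] by auto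
    \<comment> \<open>The first bound controls the terms of order m / n in the alteration; the
      second pays for the marker and the rounding terms.\<close>
    obtain k0 :: nat where k0: "max (24 * real m / \<epsilon>) (4 * (3 + 2 * real L) * lg / \<gamma>) < real k0" using reals_Archimedean2 by blast
    define k where "k = k0 + N1 + N2 + 2 * L + 2"
    define n where "n = J * k"
    have k: "24 * real m / \<epsilon> < real k" "4 * (3 + 2 * real L) * lg / \<gamma> < real k" "N1 \<le> k" "N2 \<le> k" "2 * L \<le> k" "2 \<le> k"
      using k0 by (auto simp: k_def)
    have "2 * k \<le> n" using J unfolding n_def by (intro mult_le_mono) auto
    then have kn: "k + 2 \<le> n" "N2 \<le> n" "0 < n" using k by auto
    obtain G1 where G1: "G1 \<in> sets M" "prob (space M - G1) < \<eta> / 4"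
      "\<And>u. real (card (names p 0 k ` {x \<in> G1. names ?o 0 k x = u})) \<le> b powr ((h + \<gamma> / 4) * real k)"
      using N1[OF k(3)] by blast
    obtain G2 where G2: "G2 \<in> sets M" "prob (space M - G2) < \<eta> / 4"
      "\<And>u. real (card (names q 0 n ` {x \<in> G2. names p 0 n x = u})) \<le> b powr (\<delta> * real n)"
      using N2[OF kn(2)] by blast
    define Gd where "Gd = G1 \<inter> G2"
    have Gd: "Gd \<in> sets M" using G1 G2 by (simp add: Gd_def)
    have Gs: "G1 \<subseteq> space M" "G2 \<subseteq> space M" using G1 G2 sets.sets_into_space by blast+
    have Bd: "prob (space M - Gd) < \<eta> / 2"
    proof -
      have "prob (space M - Gd) \<le> prob ((space M - G1) \<union> (space M - G2))"
        using G1 G2 by (intro finite_measure_mono) (auto simp: Gd_def)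
      also have "\<dots> \<le> prob (space M - G1) + prob (space M - G2)" using G1 G2 by (intro measure_Un_le) auto
      finally show ?thesis using G1 G2 by linarith
    qed
    define Fr where "Fr = {j. 2 * L \<le> j \<and> j < k \<and> \<not> L dvd j}"
    define Bo where "Bo = {j. k \<le> j \<and> j < n \<and> (L dvd j \<or> j = n - 1)}"
    have cBo: "real (card Bo) \<le> real n / real L + 2"
    proof -
      have "card Bo \<le> card (insert (n - 1) {j. j < n \<and> L dvd j})"
        by (rule card_mono) (auto simp: Bo_def)
      also have "\<dots> \<le> card {j. j < n \<and> L dvd j} + 1" by (simp add: card_insert_if)
      finally show ?thesis using card_multiples_le[OF L(1), of n] by linarith
    qed
    have cFr: "real k - 2 * real L - (real k / real L + 1) \<le> real (card Fr)"
    proof -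
      have "k = card {..<k}" by simp
      also have "\<dots> \<le> card (Fr \<union> ({..<2 * L} \<union> {j. j < k \<and> L dvd j}))"
        by (rule card_mono) (auto simp: Fr_def)
      also have "\<dots> \<le> card Fr + (card {..<2 * L} + card {j. j < k \<and> L dvd j})"
        by (meson add_left_mono card_Un_le order_trans)
      finally have "real k \<le> real (card Fr) + (2 * real L + real (card {j. j < k \<and> L dvd j}))" by simp
      then show ?thesis using card_multiples_le[OF L(1), of k] by linarith
    qed
    have room: "(h + \<gamma> / 4) * real k + real (card Bo) * lg + \<delta> * real n \<le> real (card Fr) * lg"
    proof -
      \<comment> \<open>A quarter of the surplus. The four quarters cover
        \<open>\<delta> * n\<close>, the excess in the count of \<open>p\<close>-names, the terms
        \<open>U\<close> proportional to k / L, and the constant terms \<open>V\<close>.\<close>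
      define g where "g = \<gamma> / 4 * real k"
      define X where "X = (real J * real k / real L + 2) * lg"
      define Y where "Y = (2 * real L + (real k / real L + 1)) * lg"
      define U where "U = (real J + 1) * lg / real L * real k"
      define V where "V = (3 + 2 * real L) * lg"
      have "\<delta> * real n = g" using J by (simp add: g_def \<delta>_def n_def)
      moreover have "real (card Bo) * lg \<le> X"
        unfolding X_def using cBo lg by (intro mult_right_mono) (auto simp: n_def)
      moreover have "real k * lg - Y \<le> real (card Fr) * lg"
      proof -
        have "real k * lg - Y = (real k - 2 * real L - (real k / real L + 1)) * lg" by (simp add: Y_def algebra_simps)
        also have "\<dots> \<le> real (card Fr) * lg" using cFr lg by (intro mult_right_mono) auto
        finally show ?thesis .
      qed
      moreover have "X + Y = U + V"
        by (simp add: X_def Y_def U_def V_def algebra_simps add_divide_distrib)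
      moreover have "U \<le> g"
        unfolding U_def g_def
      proof (rule mult_right_mono)
        have "(real J + 1) * lg * 4 < \<gamma> * real L" using L(3) \<gamma> by (simp add: field_simps)
        then show "(real J + 1) * lg / real L \<le> \<gamma> / 4" using L(1) by (simp add: divide_le_eq)
      qed simp
      moreover have "V \<le> g" unfolding V_def g_def using k(2) \<gamma> by (simp add: field_simps)
      moreover have "real k * lg = h * real k + \<gamma> * real k" by (simp add: \<gamma>_def algebra_simps)
      moreover have "\<gamma> * real k = 4 * g" by (simp add: g_def)
      moreover have "(h + \<gamma> / 4) * real k = h * real k + g" by (simp add: g_def algebra_simps)
      ultimately show ?thesis by linarith
    qed
    have pw: "real a ^ m = b powr (real m * lg)" for m
    proof -
      have "b powr (real m * lg) = (b powr lg) powr real m" by (simp add: powr_powr mult.commute)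
      also have "b powr lg = real a" using a b_gt_1 by (simp add: lg_def)
      finally show ?thesis using a by (simp add: powr_realpow)
    qed
    have le: "b powr ((h + \<gamma> / 4) * real k) * real a ^ card Bo * b powr (\<delta> * real n) \<le> real a ^ card Fr"
      unfolding pw powr_add[symmetric] using room b_gt_1 by (intro powr_mono) auto
    have cnt1: "real (card (names p 0 k ` Gd)) \<le> b powr ((h + \<gamma> / 4) * real k)"
    proof -
      have "finite (names p 0 k ` space M)" using np by (simp add: simple_function_def)
      then have "card (names p 0 k ` Gd) \<le> card (names p 0 k ` {x \<in> G1. names ?o 0 k x = replicate k 0})"
        using Gs by (intro card_mono)
          (auto simp: Gd_def names_def map_replicate_const intro: finite_subset[rotated])
      then show ?thesis using G1(3)[of "replicate k 0"] by linarith
    qed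
    have cnt2: "real (card (names q 0 n ` {x \<in> Gd. names p 0 n x = u})) \<le> b powr (\<delta> * real n)" for u
    proof -
      have fin: "finite (names q 0 n ` space M)" using nq by (simp add: simple_function_def)
      have "card (names q 0 n ` {x \<in> Gd. names p 0 n x = u}) \<le> card (names q 0 n ` {x \<in> G2. names p 0 n x = u})"
      proof (rule card_mono)
        show "finite (names q 0 n ` {x \<in> G2. names p 0 n x = u})"
          by (rule finite_subset[OF _ fin]) (use Gs in auto)
      qed (auto simp: Gd_def)
      then show ?thesis using G2(3)[of u] by linarith
    qed
    \<comment> \<open>The base meets the complement of \<open>Gd\<close> in at most the share 1/n,
      so the columns that cannot be decoded have total measure below
      \<open>\<eta> / 2\<close>.\<close>
    obtain F where F: "tower n F" "prob (uncovered n F) < min (\<epsilon> / (4 * (real m + 1))) (\<eta> / 2)"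
      "real n * prob (F \<inter> (space M - Gd)) \<le> prob (space M - Gd)"
      using rokhlin_avoiding[OF small_sets_exist kn(3), of "min (\<epsilon> / (4 * (real m + 1))) (\<eta> / 2)" "space M - Gd"] Gd \<open>0 < \<epsilon>\<close> \<open>0 < \<eta>\<close> by auto
    let ?out = "uncovered n F"
    obtain p' r where p': "simple p'" "p' ` space M \<subseteq> {..<a}"
        "prob (differ_within m p p')
          \<le> real m * prob ?out + real (k + m + m * card Bo) * prob F"
      and r: "finite_factor p' r" "r ` space M \<subseteq> {..<K}"
        "prob (differ q r) \<le> prob ?out + real n * prob (F \<inter> (space M - Gd))"
      using rewrite_blocks[OF p q a L(1) k(5) kn(1) F(1) Gd Fr_def Bo_def cnt1 cnt2 le, of m] by blast
    \<comment> \<open>Three eighths of \<open>\<epsilon>\<close>: initial segments, regularly spaced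
      synchronising letters, and boundary terms. A quarter more goes to the part off the
      tower.\<close>
    have "real (k + m + m * card Bo) * prob F \<le> 3 / 8 * \<epsilon>"
    proof -
      have n: "0 < real n" using kn by simp
      have pF: "prob F \<le> 1 / real n" using prob_tower_base_le[OF F(1)] n by (simp add: field_simps)
      have "real m * real (card Bo) \<le> real m * (real n / real L + 2)" using cBo by (intro mult_left_mono) auto
      then have "real (k + m + m * card Bo) * prob F \<le> (real k + real m + real m * (real n / real L + 2)) * (1 / real n)"
        using pF by (intro mult_mono) auto
      also have "\<dots> = real k / real n + real m / real L + 3 * real m / real n" using n by (simp add: field_simps)
      also have "real k / real n = 1 / real J" using k by (simp add: n_def)
      also have "1 / real J \<le> \<epsilon> / 8" using J \<open>0 < \<epsilon>\<close> by (simp add: field_simps)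
      also have "real m / real L \<le> \<epsilon> / 8" using L \<open>0 < \<epsilon>\<close> by (simp add: field_simps)
      also have "3 * real m / real n \<le> \<epsilon> / 8"
      proof -
        have "24 * real m / \<epsilon> < real n" using k(1) kn by linarith
        then show ?thesis using n \<open>0 < \<epsilon>\<close> by (simp add: field_simps)
      qed
      finally show ?thesis by simp
    qed
    moreover have "real m * prob ?out \<le> \<epsilon> / 4"
    proof -
      have "(real m + 1) * prob ?out \<le> (real m + 1) * (\<epsilon> / (4 * (real m + 1)))"
        using F(2) by (intro mult_left_mono) auto
      also have "\<dots> = \<epsilon> / 4"
      proof -
        have "real m + 1 \<noteq> 0" by linarith
        then show ?thesis by (simp add: divide_simps)
      qed
      finally have "(real m + 1) * prob ?out \<le> \<epsilon> / 4" .
      moreover have "real m * prob ?out \<le> (real m + 1) * prob ?out" by (intro mult_right_mono) auto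
      ultimately show ?thesis by linarith
    qed
    ultimately have "prob (differ_within m p p') < \<epsilon>"
      using p'(3) \<open>0 < \<epsilon>\<close> by linarith
    moreover have "prob (differ q r) < \<eta>" using r(3) F(2,3) Bd by linarith
    ultimately show ?thesis using p' r by blast
  qed
  show ?thesis
    by (rule that[OF \<open>0 < \<delta>\<close>]; unfold codable_def; intro allI impI; elim conjE; rule key; assumption)
qed

end

section \<open>Generic approximation\<close>

context finite_entropy_system begin

text \<open>A finite window and a strict inequality make this an open condition on
  \<open>p\<close>.\<close>

definition approximates :: "('a \<Rightarrow> nat) \<Rightarrow> 'a set \<Rightarrow> real \<Rightarrow> bool" where
  "approximates p B \<eta> \<longleftrightarrow> (\<exists>r::'a \<Rightarrow> nat. finite_factor p r \<and> prob {x \<in> space M. of_bool (x \<in> B) \<noteq> r x} < \<eta>)"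

text \<open>The decoder errs only if some letter in its window has changed. Shifting the window to
  start at time 0 bounds this by one event, without a factor for the window length.\<close>

lemma window_decoder_stable:
  fixes \<psi> :: "'c list \<Rightarrow> 'd"
  assumes p: "simple p" "simple p'" and m: "2 * N + 1 \<le> m"
  shows "prob {x \<in> space M. \<psi> (window N p x) \<noteq> \<psi> (window N p' x)}
    \<le> prob (differ_within m p p')"
proof -
  let ?D = "differ_within m p p'"
  have D: "?D \<in> sets M" by (rule differ_within_sets[OF p])
  have "{x \<in> space M. \<psi> (window N p x) \<noteq> \<psi> (window N p' x)}
      \<subseteq> {x \<in> space M. (Ti ^^ N) x \<in> ?D}"
  proof
    fix x assume "x \<in> {x \<in> space M. \<psi> (window N p x) \<noteq> \<psi> (window N p' x)}"
    then have x: "x \<in> space M" and ne: "window N p x \<noteq> window N p' x" by auto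
    have "\<exists>j<2 * N + 1. p ((T ^^ j) ((Ti ^^ N) x)) \<noteq> p' ((T ^^ j) ((Ti ^^ N) x))"
    proof (rule ccontr)
      assume "\<not> ?thesis"
      then have "window N p x = window N p' x"
        by (auto simp: names_def)
      with ne show False by simp
    qed
    then obtain j where "j < m" "p ((T ^^ j) ((Ti ^^ N) x)) \<noteq> p' ((T ^^ j) ((Ti ^^ N) x))" using m by (meson less_le_trans)
    then show "x \<in> {x \<in> space M. (Ti ^^ N) x \<in> ?D}" using x by auto
  qed
  moreover have "{x \<in> space M. (Ti ^^ N) x \<in> ?D} \<in> sets M" using D by measurable
  ultimately have "prob {x \<in> space M. \<psi> (window N p x) \<noteq> \<psi> (window N p' x)}
      \<le> prob {x \<in> space M. (Ti ^^ N) x \<in> ?D}" by (intro finite_measure_mono)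
  also have "\<dots> = prob ?D" by (rule prob_preimage[OF mp_Tin D])
  finally show ?thesis .
qed

lemma prob_neq_triangle:
  assumes q: "simple q" "simple r" "simple s"
  shows "prob (differ q s) \<le> prob (differ q r) + prob (differ r s)"
proof -
  have "prob (differ q s) \<le> prob (differ q r \<union> differ r s)"
    using q by (intro finite_measure_mono sets.Un differ_sets) auto
  also have "\<dots> \<le> prob (differ q r) + prob (differ r s)"
    using q by (intro measure_Un_le differ_sets)
  finally show ?thesis .
qed

lemma simple_of_bool:
  assumes "B \<in> sets M" shows "simple (\<lambda>x. of_bool (x \<in> B) :: nat)"
proof -
  have "(\<lambda>x. of_bool (x \<in> B) :: nat) ` space M \<subseteq> {0, 1}" by auto
  moreover have "(\<lambda>x. x \<in> B) \<in> measurable M (count_space UNIV)" using assms by measurable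
  then have "(\<lambda>x. of_bool (x \<in> B) :: nat) \<in> measurable M (count_space UNIV)" by measurable
  ultimately show ?thesis by (auto simp: simple_function_eq_measurable intro: finite_subset)
qed

text \<open>The admissible radius is the slack in the strict inequality divided by the window
  length, by a union bound over the window.\<close>

lemma approximates_stable:
  assumes p: "simple p" and B: "B \<in> sets M" and ap: "approximates p B \<eta>"
  shows "\<exists>\<rho>>0. \<forall>p'. simple p' \<and> prob (differ p p') < \<rho> \<longrightarrow> approximates p' B \<eta>"
proof -
  obtain N and \<psi> :: "nat list \<Rightarrow> nat" and r where r: "\<And>x. x \<in> space M \<Longrightarrow> r x = \<psi> (window N p x)"
    and ff: "finite_factor p r" and lt: "prob {x \<in> space M. of_bool (x \<in> B) \<noteq> r x} < \<eta>"
    using ap unfolding approximates_def finite_factor_def by blast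
  let ?m = "2 * N + 1" and ?e = "\<eta> - prob {x \<in> space M. of_bool (x \<in> B) \<noteq> r x}"
  have "approximates p' B \<eta>" if p': "simple p'" and d: "prob (differ p p') < ?e / real ?m" for p'
  proof -
    let ?D = "differ p p'"
    have D: "?D \<in> sets M" by (rule differ_sets[OF p p'])
    define r' where "r' x = \<psi> (names p' 0 ?m ((Ti ^^ N) x))" for x
    have ff': "finite_factor p' r'" unfolding finite_factor_def r'_def by blast
    have "prob (differ r r') = prob {x \<in> space M. \<psi> (names p 0 ?m ((Ti ^^ N) x)) \<noteq> \<psi> (names p' 0 ?m ((Ti ^^ N) x))}"
      by (rule arg_cong[where f=prob]) (auto simp: r r'_def)
    also have "\<dots> \<le> prob (differ_within ?m p p')"
      by (rule window_decoder_stable[OF p p' order_refl])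
    also have "\<dots> \<le> real (card {..<?m}) * prob ?D"
      by (rule prob_le_sum_preimages[where S="\<lambda>j. T ^^ j", OF _ mp_Tn D]) auto
    also have "\<dots> < ?e" using d by (simp add: field_simps)
    finally have "prob (differ r r') < ?e" .
    moreover have "prob {x \<in> space M. of_bool (x \<in> B) \<noteq> r' x}
        \<le> prob {x \<in> space M. of_bool (x \<in> B) \<noteq> r x} + prob (differ r r')"
      by (rule prob_neq_triangle[OF simple_of_bool[OF B] simple_finite_factor[OF p ff] simple_finite_factor[OF p' ff']])
    ultimately show ?thesis using ff' unfolding approximates_def by (intro exI[of _ r'] conjI) auto
  qed
  then show ?thesis using lt by (intro exI[of _ "?e / real ?m"]) auto
qed

lemma finite_factor_comp: "finite_factor p r \<Longrightarrow> finite_factor p (\<lambda>x. g (r x))"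
  unfolding finite_factor_def by (metis comp_apply)

definition refinable :: "nat \<Rightarrow> real \<Rightarrow> real \<Rightarrow> bool" where
  "refinable a \<epsilon> \<delta> \<longleftrightarrow> (\<forall>p B \<eta> \<delta>' m. simple p \<and> p ` space M \<subseteq> {..<a} \<and> h - \<delta> < rate p \<and>
      B \<in> sets M \<and> 0 < \<eta> \<and> 0 < \<delta>' \<longrightarrow>
    (\<exists>p'. simple p' \<and> p' ` space M \<subseteq> {..<a} \<and> prob (differ_within m p p') < \<epsilon> \<and>
      approximates p' B \<eta> \<and> h - \<delta>' < rate p'))"

text \<open>Encode the indicator of \<open>B\<close> together with a partition \<open>z\<close> of
  nearly full entropy. Decoding the first approximates \<open>B\<close>; decoding the second forces
  the rate of \<open>p'\<close> above \<open>h - \<delta>'\<close>, for a new deficit of free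
  choice.\<close>

lemma approximation_step:
  assumes a: "2 \<le> a" and h: "h < log b (real a)" and "0 < \<epsilon>"
  obtains \<delta> where "0 < \<delta>" "refinable a \<epsilon> \<delta>"
proof -
  obtain \<delta> where "0 < \<delta>" and \<delta>: "codable a \<epsilon> \<delta>" by (rule coding_step[OF assms])
  have key: "\<exists>p'. simple p' \<and> p' ` space M \<subseteq> {..<a} \<and>
      prob (differ_within m p p') < \<epsilon> \<and>
      approximates p' B \<eta> \<and> h - \<delta>' < rate p'"
    if p: "simple p" "p ` space M \<subseteq> {..<a}" "h - \<delta> < rate p" and B: "B \<in> sets M" and "0 < \<eta>" "0 < \<delta>'"
    for p B \<eta> \<delta>' m
  proof -
    obtain z and K :: nat where z: "simple z" "z ` space M \<subseteq> {..<K}" "h - \<delta>' / 2 < rate z"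
      using rate_approx[of "\<delta>' / 2"] \<open>0 < \<delta>'\<close> by auto
    have "0 < \<delta>' / 2" using \<open>0 < \<delta>'\<close> by simp
    from rate_uniformly_continuous[OF finite_lessThan[of K] this]
    obtain e where "0 < e" and e0: "\<And>q r. simple q \<Longrightarrow> q ` space M \<subseteq> {..<K} \<Longrightarrow>
        simple r \<Longrightarrow> r ` space M \<subseteq> {..<K} \<Longrightarrow>
        prob (differ q r) < e \<Longrightarrow> rate q \<le> rate r + \<delta>' / 2" by blast
    note e = e0[OF z(1,2)]
    \<comment> \<open>The parity stores membership in \<open>B\<close>, the quotient stores
      \<open>z\<close>.\<close>
    define q where "q x = of_bool (x \<in> B) + 2 * z x" for x
    have sq: "simple q"
      by (rule simple_factor[where f="\<lambda>(u, v). u + 2 * v", OF simple_function_Pair[OF simple_of_bool[OF B] z(1)]])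
        (simp add: q_def)
    have z_lt: "z x < K" if "x \<in> space M" for x using z(2) that by auto
    have qK: "q ` space M \<subseteq> {..<2 * K}"
    proof
      fix v assume "v \<in> q ` space M"
      then obtain x where x: "x \<in> space M" "v = q x" by blast
      then show "v \<in> {..<2 * K}" using z_lt[OF x(1)] by (auto simp: q_def of_bool_def)
    qed
    have q2: "q x mod 2 = of_bool (x \<in> B)" "q x div 2 = z x" for x by (auto simp: q_def)
    obtain p' r where p': "simple p'" "p' ` space M \<subseteq> {..<a}"
        "prob (differ_within m p p') < \<epsilon>"
      and r: "finite_factor p' r" "r ` space M \<subseteq> {..<2 * K}" "prob (differ q r) < min \<eta> e"
      using \<delta>[unfolded codable_def, rule_format, of p q "2 * K" "min \<eta> e" m] p sq qK \<open>0 < \<eta>\<close> \<open>0 < e\<close> by auto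
    note sr = simple_finite_factor[OF p'(1) r(1)]
    have ne: "differ q r \<in> sets M" by (rule differ_sets[OF sq sr])
    have "q x \<noteq> r x" if "of_bool (x \<in> B) \<noteq> r x mod 2" for x using that q2(1)[of x] by metis
    then have "{x \<in> space M. of_bool (x \<in> B) \<noteq> r x mod 2} \<subseteq> differ q r" by blast
    then have "prob {x \<in> space M. of_bool (x \<in> B) \<noteq> r x mod 2} \<le> prob (differ q r)"
      using ne by (intro finite_measure_mono)
    then have 1: "approximates p' B \<eta>"
      unfolding approximates_def using r finite_factor_comp[OF r(1), of "\<lambda>v. v mod 2"]
      by (intro exI[of _ "\<lambda>x. r x mod 2"]) auto
    have "q x \<noteq> r x" if "z x \<noteq> r x div 2" for x using that q2(2)[of x] by metis
    then have "{x \<in> space M. z x \<noteq> r x div 2} \<subseteq> differ q r" by blast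
    then have "prob {x \<in> space M. z x \<noteq> r x div 2} \<le> prob (differ q r)"
      using ne by (intro finite_measure_mono)
    moreover have "(\<lambda>x. r x div 2) ` space M \<subseteq> {..<K}"
    proof
      fix v assume "v \<in> (\<lambda>x. r x div 2) ` space M"
      then obtain x where x: "x \<in> space M" "v = r x div 2" by blast
      then have "r x < 2 * K" using r(2) by auto
      then show "v \<in> {..<K}" using x by auto
    qed
    ultimately have "rate z \<le> rate (\<lambda>x. r x div 2) + \<delta>' / 2"
      using r(3) by (intro e simple_function_compose1[OF sr]) auto
    also have "rate (\<lambda>x. r x div 2) \<le> rate p'"
      using rate_finite_factor_le[OF p'(1) finite_factor_comp[OF r(1), of "\<lambda>v. v div 2"]] .
    finally have "h - \<delta>' < rate p'" using z(3) by simp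
    with p' 1 show ?thesis by blast
  qed
  show ?thesis
    by (rule that[OF \<open>0 < \<delta>\<close>]; unfold refinable_def; intro allI impI; elim conjE; rule key; assumption)
qed

text \<open>All deficits are chosen first, one for each step. The windows then grow along the
  construction, so every later change is small as seen by every earlier decoder, and the total is a
  geometric series.\<close>

lemma approximating_limit:
  fixes a :: nat and B :: "nat \<Rightarrow> 'a set" and \<eta> :: "nat \<Rightarrow> real"
  assumes a: "2 \<le> a" and h: "h < log b (real a)" and "0 < \<epsilon>"
    and p: "simple p" "p ` space M \<subseteq> {..<a}" "rate p = h"
    and B: "\<And>s. B s \<in> sets M" and \<eta>: "\<And>s. 0 < \<eta> s"
  shows "\<exists>p'. simple p' \<and> p' ` space M \<subseteq> {..<a} \<and> prob (differ p p') \<le> \<epsilon> \<and>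
    rate p' = h \<and> (\<forall>s. approximates p' (B s) (\<eta> s + \<epsilon> * (1/2) ^ s))"
proof -
  \<comment> \<open>The exponent is shifted so that the changes from step s on add up to
    \<open>\<epsilon> * (1/2) ^ s\<close>.\<close>
  define \<epsilon>s where "\<epsilon>s s = \<epsilon> * (1/2) ^ Suc s" for s
  have \<epsilon>s: "0 < \<epsilon>s s" for s using \<open>0 < \<epsilon>\<close> by (simp add: \<epsilon>s_def)
  have "\<forall>s. \<exists>\<delta>>0. refinable a (\<epsilon>s s) \<delta>" using approximation_step[OF a h \<epsilon>s] by metis
  from choice[OF this] obtain \<delta> where \<delta>0: "\<And>s. 0 < \<delta> s" and \<delta>: "\<And>s. refinable a (\<epsilon>s s) (\<delta> s)" by blast
  \<comment> \<open>A state consists of a partition and the window to be protected from now on. The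
    deficit is small enough for the next step and also tends to 0, so that the limit loses no
    entropy.\<close>
  define P where "P s f \<longleftrightarrow> simple (fst f) \<and> fst f ` space M \<subseteq> {..<a} \<and> h - min (\<delta> s) (1 / real (Suc s)) < rate (fst f) \<and> 1 \<le> snd f \<and> (s = 0 \<longrightarrow> fst f = p)"
    for s and f :: "('a \<Rightarrow> nat) \<times> nat"
  define Q where "Q s f f' \<longleftrightarrow> prob (differ_within (snd f) (fst f) (fst f')) < \<epsilon>s s \<and> snd f \<le> snd f' \<and>
    (\<exists>N \<psi>. 2 * N + 1 \<le> snd f' \<and> prob {x \<in> space M. of_bool (x \<in> B s) \<noteq> (\<psi> (window N (fst f') x) :: nat)} < \<eta> s)"
    for s and f f' :: "('a \<Rightarrow> nat) \<times> nat"
  have "\<exists>f. \<forall>s. P s (f s) \<and> Q s (f s) (f (Suc s))"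
  proof (rule dependent_nat_choice)
    show "\<exists>f. P 0 f" using p \<delta>0[of 0] by (intro exI[of _ "(p, 1)"]) (auto simp: P_def)
  next
    fix f s assume f: "P s f"
    obtain p' where p': "simple p'" "p' ` space M \<subseteq> {..<a}"
      "prob (differ_within (snd f) (fst f) p') < \<epsilon>s s"
      "approximates p' (B s) (\<eta> s)" "h - min (\<delta> (Suc s)) (1 / real (Suc (Suc s))) < rate p'"
    proof -
      have "h - \<delta> s < rate (fst f)" using f unfolding P_def by linarith
      moreover have "0 < min (\<delta> (Suc s)) (1 / real (Suc (Suc s)))" using \<delta>0[of "Suc s"] by simp
      ultimately show ?thesis
        using \<delta>[unfolded refinable_def, rule_format, of "fst f" s "B s" "\<eta> s" "min (\<delta> (Suc s)) (1 / real (Suc (Suc s)))" "snd f"]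
          f B \<eta> that unfolding P_def by blast
    qed
    obtain r N \<psi> where r: "\<And>x. x \<in> space M \<Longrightarrow> r x = \<psi> (window N p' x)"
      and lt: "prob {x \<in> space M. of_bool (x \<in> B s) \<noteq> (r x :: nat)} < \<eta> s"
      using p'(4) unfolding approximates_def finite_factor_def by blast
    have "{x \<in> space M. of_bool (x \<in> B s) \<noteq> r x} = {x \<in> space M. of_bool (x \<in> B s) \<noteq> \<psi> (window N p' x)}"
      using r by auto
    with lt have lt': "prob {x \<in> space M. of_bool (x \<in> B s) \<noteq> \<psi> (window N p' x)} < \<eta> s" by (simp only:)
    have "P (Suc s) (p', snd f + 2 * N + 1)" using p' by (simp add: P_def)
    moreover have "Q s f (p', snd f + 2 * N + 1)"
      unfolding Q_def fst_conv snd_conv using p'(3) lt' by (intro conjI exI[of _ N] exI[of _ \<psi>]) auto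
    ultimately show "\<exists>f'. P (Suc s) f' \<and> Q s f f'" by blast
  qed
  then obtain f where f: "\<And>s. P s (f s)" "\<And>s. Q s (f s) (f (Suc s))" by blast
  define ps where "ps s = fst (f s)" for s
  define ms where "ms s = snd (f s)" for s
  have ps: "simple (ps s)" "ps s ` space M \<subseteq> {..<a}" "1 \<le> ms s" for s
    using f(1)[of s] by (auto simp: P_def ps_def ms_def)
  have ps_lt: "ps s x < a" if "x \<in> space M" for s x using ps(2)[of s] that by auto
  have ps0: "ps 0 = p" using f(1)[of 0] by (simp add: P_def ps_def)
  have ms_mono: "ms s \<le> ms t" if "s \<le> t" for s t
  proof (rule lift_Suc_mono_le[OF _ that])
    show "ms n \<le> ms (Suc n)" for n using f(2)[of n] unfolding Q_def ms_def by blast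
  qed
  have close: "prob (differ_within (ms s) (ps s) (ps (Suc s))) < \<epsilon>s s" for s
    using f(2)[of s] by (simp add: Q_def ps_def ms_def)
  \<comment> \<open>The eventual value, with 0 where the letters never settle.\<close>
  define pl where "pl x = (if \<exists>v. \<exists>s. \<forall>t\<ge>s. ps t x = v then (THE v. \<exists>s. \<forall>t\<ge>s. ps t x = v) else 0)" for x
  have pl_eq: "pl x = v" if "\<And>t. t \<ge> s \<Longrightarrow> ps t x = v" for x v s
  proof -
    have "(THE v. \<exists>s. \<forall>t\<ge>s. ps t x = v) = v"
    proof (rule the_equality)
      show "\<exists>s. \<forall>t\<ge>s. ps t x = v" using that by blast
      fix w assume "\<exists>s. \<forall>t\<ge>s. ps t x = w"
      then obtain s' where "\<And>t. t \<ge> s' \<Longrightarrow> ps t x = w" by blast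
      then show "w = v" using that[of "max s s'"] by auto
    qed
    then show ?thesis unfolding pl_def using that by auto
  qed
  have pl_lt: "pl x < a" if "x \<in> space M" for x
  proof (cases "\<exists>v. \<exists>s. \<forall>t\<ge>s. ps t x = v")
    case True
    then obtain v s where v: "\<And>t. t \<ge> s \<Longrightarrow> ps t x = v" by blast
    then have "pl x = v" by (rule pl_eq)
    then show ?thesis using v[of s] ps_lt[OF that, of s] by simp
  next
    case False
    then have "pl x = 0" unfolding pl_def by (rule if_not_P)
    then show ?thesis using a by simp
  qed
  have lev: "{x \<in> space M. ps t x = v} \<in> sets M" for t v by (rule simple_level_set[OF ps(1)])
  have spl: "simple pl"
    unfolding simple_function_def
  proof (intro conjI ballI)
    show "finite (pl ` space M)" by (rule finite_subset[of _ "{..<a}"]) (use pl_lt in auto)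
    fix v assume "v \<in> pl ` space M"
    let ?C = "\<lambda>v. \<Union>s. \<Inter>t\<in>{s..}. {x \<in> space M. ps t x = v}"
    have C: "?C v \<in> sets M" for v using lev by (intro sets.countable_UN sets.countable_INT) auto
    show "pl -` {v} \<inter> space M \<in> sets M"
    proof (cases "v = 0")
      case False
      have "pl -` {v} \<inter> space M = ?C v"
      proof (intro equalityI subsetI)
        fix x assume x: "x \<in> pl -` {v} \<inter> space M"
        then have "\<exists>w. \<exists>s. \<forall>t\<ge>s. ps t x = w" using False by (auto simp: pl_def split: if_splits)
        then obtain w s where w: "\<And>t. t \<ge> s \<Longrightarrow> ps t x = w" by blast
        then have "pl x = w" by (rule pl_eq)
        then show "x \<in> ?C v" using w x by auto
      next
        fix x assume "x \<in> ?C v"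
        then obtain s where s: "\<And>t. t \<ge> s \<Longrightarrow> x \<in> space M \<and> ps t x = v" by blast
        then have "pl x = v" by (intro pl_eq) blast
        then show "x \<in> pl -` {v} \<inter> space M" using s[of s] by auto
      qed
      then show ?thesis using C by simp
    next
      \<comment> \<open>The label 0 also collects the points without a limit, so this level set is
        obtained as a complement.\<close>
      case True
      have "pl -` {v} \<inter> space M = space M - (\<Union>w\<in>{1..<a}. ?C w)"
      proof (intro equalityI subsetI)
        fix x assume x: "x \<in> pl -` {v} \<inter> space M"
        show "x \<in> space M - (\<Union>w\<in>{1..<a}. ?C w)"
        proof (rule ccontr)
          assume "\<not> ?thesis"
          then obtain w where "w \<in> {1..<a}" "x \<in> ?C w" using x by blast
          then obtain s where w: "w \<ge> 1" "\<And>t. t \<ge> s \<Longrightarrow> ps t x = w" by auto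
          then have "pl x = w" by (intro pl_eq) blast
          then show False using x True w by auto
        qed
      next
        fix x assume x: "x \<in> space M - (\<Union>w\<in>{1..<a}. ?C w)"
        have "pl x = 0"
        proof (rule ccontr)
          assume "pl x \<noteq> 0"
          then have "\<exists>w. \<exists>s. \<forall>t\<ge>s. ps t x = w" by (auto simp: pl_def split: if_splits)
          then obtain w s where w: "\<And>t. t \<ge> s \<Longrightarrow> ps t x = w" by blast
          then have "pl x = w" by (rule pl_eq)
          then have "w \<in> {1..<a}" using \<open>pl x \<noteq> 0\<close> pl_lt[of x] x by auto
          moreover have "x \<in> ?C w" using w x by auto
          ultimately show False using x by blast
        qed
        then show "x \<in> pl -` {v} \<inter> space M" using x True by auto
      qed
      then show ?thesis using C by auto
    qed
  qed
  have tail: "prob (differ_within (ms s) (ps s) pl) \<le> \<epsilon> * (1/2) ^ s" for s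
  proof -
    let ?W = "\<lambda>i. differ_within (ms (s + i)) (ps (s + i)) (ps (Suc (s + i)))"
    have Wm: "?W i \<in> sets M" for i by (rule differ_within_sets[OF ps(1) ps(1)])
    \<comment> \<open>If no later step changed a letter in its own window, which contains the window
      of step s, the letters seen there would already be final.\<close>
    have "differ_within (ms s) (ps s) pl \<subseteq> (\<Union>i. ?W i)"
    proof (rule subsetI, rule ccontr)
      fix x assume "x \<in> differ_within (ms s) (ps s) pl" and no: "x \<notin> (\<Union>i. ?W i)"
      then obtain j where x: "x \<in> space M" and j: "j < ms s" "ps s ((T ^^ j) x) \<noteq> pl ((T ^^ j) x)" by blast
      have eq: "ps (s + i) ((T ^^ j) x) = ps (Suc (s + i)) ((T ^^ j) x)" for i
      proof -
        have "j < ms (s + i)" using j ms_mono[of s "s + i"] by simp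
        moreover have "x \<notin> ?W i" using no by blast
        ultimately show ?thesis using x by blast
      qed
      have "ps (s + i) ((T ^^ j) x) = ps s ((T ^^ j) x)" for i
        by (induction i) (use eq in auto)
      then have "ps t ((T ^^ j) x) = ps s ((T ^^ j) x)" if "t \<ge> s" for t
        using that by (metis le_add_diff_inverse)
      then have "pl ((T ^^ j) x) = ps s ((T ^^ j) x)" by (rule pl_eq)
      then show False using j by simp
    qed
    then have "prob (differ_within (ms s) (ps s) pl) \<le> prob (\<Union>i. ?W i)"
      by (intro finite_measure_mono sets.countable_UN image_subsetI Wm)
    also have "\<dots> \<le> 2 * \<epsilon>s s"
    proof (rule prob_UN_geometric_le[OF Wm])
      show "prob (?W i) \<le> \<epsilon>s s * (1/2) ^ i" for i
        using close[of "s + i"] by (simp add: \<epsilon>s_def power_add mult.assoc)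
    qed
    also have "\<dots> = \<epsilon> * (1/2) ^ s" by (simp add: \<epsilon>s_def)
    finally show ?thesis .
  qed
  have "approximates pl (B s) (\<eta> s + \<epsilon> * (1/2) ^ s)" for s
  proof -
    \<comment> \<open>The decoder of \<open>B s\<close> reads partition number s + 1, whose recorded
      window contains its own.\<close>
    obtain N \<psi> where N: "2 * N + 1 \<le> ms (Suc s)"
      and lt: "prob {x \<in> space M. of_bool (x \<in> B s) \<noteq> (\<psi> (window N (ps (Suc s)) x) :: nat)} < \<eta> s"
      using f(2)[of s] by (auto simp: Q_def ps_def ms_def)
    let ?r = "\<lambda>p x. \<psi> (window N p x)"
    have ff: "finite_factor p (?r p)" for p unfolding finite_factor_def by blast
    have "prob {x \<in> space M. of_bool (x \<in> B s) \<noteq> ?r pl x}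
      \<le> prob {x \<in> space M. of_bool (x \<in> B s) \<noteq> ?r (ps (Suc s)) x} + prob {x \<in> space M. ?r (ps (Suc s)) x \<noteq> ?r pl x}"
      by (rule prob_neq_triangle[OF simple_of_bool[OF B]
        simple_finite_factor[OF ps(1) ff] simple_finite_factor[OF spl ff]])
    moreover have "prob {x \<in> space M. ?r (ps (Suc s)) x \<noteq> ?r pl x}
      \<le> prob (differ_within (ms (Suc s)) (ps (Suc s)) pl)"
      by (rule window_decoder_stable[OF ps(1) spl N])
    moreover have "\<epsilon> * (1/2) ^ Suc s \<le> \<epsilon> * (1/2) ^ s" using \<open>0 < \<epsilon>\<close> by simp
    ultimately have "prob {x \<in> space M. of_bool (x \<in> B s) \<noteq> ?r pl x} < \<eta> s + \<epsilon> * (1/2) ^ s"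
      using lt tail[of "Suc s"] by linarith
    then show ?thesis unfolding approximates_def using ff by blast
  qed
  moreover have d: "prob (differ (ps s) pl) \<le> \<epsilon> * (1/2) ^ s" for s
  proof -
    have "prob (differ (ps s) pl) \<le> prob (differ_within (ms s) (ps s) pl)"
    proof (rule finite_measure_mono[OF _ differ_within_sets[OF ps(1) spl]])
      have "0 < ms s" using ps(3)[of s] by simp
      then show "differ (ps s) pl \<subseteq> differ_within (ms s) (ps s) pl"
        by (auto intro!: exI[of _ 0])
    qed
    then show ?thesis using tail[of s] by linarith
  qed
  moreover have "rate pl = h"
  proof (rule antisym)
    show "rate pl \<le> h" using pl_lt by (intro rate_le[OF spl, of a]) auto
    show "h \<le> rate pl"
    proof (rule field_le_epsilon)
      fix e :: real assume "0 < e"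
      then have "0 < e / 2" by simp
      from rate_uniformly_continuous[OF finite_lessThan[of a] this]
      obtain \<rho> where "0 < \<rho>" and \<rho>: "\<And>q r. simple q \<Longrightarrow> q ` space M \<subseteq> {..<a} \<Longrightarrow>
        simple r \<Longrightarrow> r ` space M \<subseteq> {..<a} \<Longrightarrow>
        prob (differ q r) < \<rho> \<Longrightarrow> rate q \<le> rate r + e / 2" by blast
      have "(\<lambda>s. \<epsilon> * (1/2) ^ s) \<longlonglongrightarrow> 0" by real_asymp
      then have "\<forall>\<^sub>F s in sequentially. \<epsilon> * (1/2) ^ s < \<rho>" using \<open>0 < \<rho>\<close> by (rule order_tendstoD(2))
      moreover have "(\<lambda>s. 1 / real (Suc s)) \<longlonglongrightarrow> 0" by real_asymp
      then have "\<forall>\<^sub>F s in sequentially. 1 / real (Suc s) < e / 2" using \<open>0 < e / 2\<close> by (rule order_tendstoD(2))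
      ultimately have "\<forall>\<^sub>F s in sequentially. \<epsilon> * (1/2) ^ s < \<rho> \<and> 1 / real (Suc s) < e / 2" by (rule eventually_conj)
      then obtain s where s: "\<epsilon> * (1/2) ^ s < \<rho>" "1 / real (Suc s) < e / 2"
        by (auto dest: eventually_happens)
      have "rate (ps s) \<le> rate pl + e / 2"
        using ps spl pl_lt d[of s] s(1) by (intro \<rho>) auto
      moreover have "h - 1 / real (Suc s) < rate (ps s)"
        using f(1)[of s] unfolding P_def ps_def by linarith
      ultimately show "h \<le> rate pl + e" using s(2) by linarith
    qed
  qed
  moreover have "pl ` space M \<subseteq> {..<a}" using pl_lt by auto
  ultimately show ?thesis using spl d[of 0] by (intro exI[of _ pl]) (simp add: ps0)
qed

end

section \<open>Generators among labelled partitions\<close>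

text \<open>A countable base of the Polish topology separates points, by the T1 property, and
  generates the Borel sets; completion changes sets only by null sets.\<close>

lemma standard_prob_space_base:
  fixes M :: "'a measure"
  assumes "standard_prob_space M"
  obtains U :: "nat \<Rightarrow> 'a set" where "\<And>k. U k \<in> sets M"
    "\<And>x y. x \<in> space M \<Longrightarrow> y \<in> space M \<Longrightarrow> x \<noteq> y \<Longrightarrow> \<exists>k. x \<in> U k \<and> y \<notin> U k"
    "\<And>B. B \<in> sets M \<Longrightarrow> \<exists>B0\<in>sigma_sets (space M) (range U). sym_diff B0 B \<in> null_sets M"
proof -
  obtain N where N: "standard_borel N" and MN: "M = N \<or> M = completion N"
    using assms by (auto simp: standard_prob_space_def)
  obtain \<tau> where \<tau>: "completely_metrizable_space \<tau>" "second_countable \<tau>" "topspace \<tau> = space N"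
    "sets N = sigma_sets (space N) {U. openin \<tau> U}"
    using N by (auto simp: standard_borel_def)
  have sp: "space M = space N" using MN by auto
  have sub: "sets N \<subseteq> sets M" using MN by auto
  obtain \<B> where \<B>: "countable \<B>" "\<And>V. V \<in> \<B> \<Longrightarrow> openin \<tau> V"
    "\<And>U x. openin \<tau> U \<Longrightarrow> x \<in> U \<Longrightarrow> \<exists>V\<in>\<B>. x \<in> V \<and> V \<subseteq> U"
    using \<tau>(2) unfolding second_countable_def by metis
  \<comment> \<open>The empty set is added so that the family to be enumerated is never
    empty.\<close>
  define U where "U = from_nat_into (insert {} \<B>)"
  have rU: "range U = insert {} \<B>" unfolding U_def using \<B>(1) by (intro range_from_nat_into) auto
  have openU: "openin \<tau> (U k)" for k using \<B>(2) rU by (metis insertE openin_empty rangeI)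
  show ?thesis
  proof (rule that[of U])
    show "U k \<in> sets M" for k using openU \<tau>(4) sub by auto
    have "t1_space \<tau>"
      using \<tau>(1) completely_metrizable_imp_metrizable_space metrizable_imp_t1_space by blast
    then show "\<exists>k. x \<in> U k \<and> y \<notin> U k" if xy: "x \<in> space M" "y \<in> space M" "x \<noteq> y" for x y
    proof -
      obtain W where "openin \<tau> W" "x \<in> W" "y \<notin> W"
        using \<open>t1_space \<tau>\<close> xy \<tau>(3) sp unfolding t1_space_def by metis
      then obtain V where "V \<in> \<B>" "x \<in> V" "y \<notin> V" using \<B>(3) by blast
      moreover then obtain k where "U k = V" using rU by (metis imageE insertCI)
      ultimately show ?thesis by blast
    qed
    have gen: "sets N \<subseteq> sigma_sets (space M) (range U)"
    proof -
      have "{W. openin \<tau> W} \<subseteq> sigma_sets (space N) (range U)"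
      proof
        fix W assume "W \<in> {W. openin \<tau> W}"
        then have W: "openin \<tau> W" by simp
        define K where "K = {V \<in> \<B>. V \<subseteq> W}"
        have "W = \<Union>K" using \<B>(3)[OF W] by (auto simp: K_def)
        moreover have "\<Union>K \<in> sigma_sets (space N) (range U)"
        proof (rule sigma_sets_UNION)
          show "countable K" unfolding K_def using \<B>(1) by (rule countable_subset[rotated]) auto
          show "V \<in> sigma_sets (space N) (range U)" if "V \<in> K" for V
            using that rU by (intro sigma_sets.Basic) (auto simp: K_def)
        qed
        ultimately show "W \<in> sigma_sets (space N) (range U)" by simp
      qed
      then show ?thesis unfolding \<tau>(4) sp by (rule sigma_sets_mono)
    qed
    show "\<exists>B0\<in>sigma_sets (space M) (range U). sym_diff B0 B \<in> null_sets M" if B: "B \<in> sets M" for B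
      using MN
    proof
      assume "M = N"
      then show ?thesis using B gen by (intro bexI[of _ B]) auto
    next
      assume M: "M = completion N"
      obtain S Z Z' where S: "B = S \<union> Z" "Z \<subseteq> Z'" "Z' \<in> null_sets N" "S \<in> sets N"
        using B unfolding M by (rule sets_completionE)
      have "sym_diff S B \<subseteq> Z'" using S by auto
      then have "sym_diff S B \<in> null_sets M" unfolding M using S(3) null_sets_completion_subset null_sets_completionI by metis
      then show ?thesis using S gen by blast
    qed
  qed
qed

text \<open>Borel-Cantelli: the limit superior of approximations with errors
  \<open>(1/2) ^ m\<close> differs from \<open>B\<close> by a null set.\<close>

lemma approximable_modulo_null:
  assumes "prob_space M" and S: "sigma_algebra (space M) \<A>" "\<A> \<subseteq> sets M" and B: "B \<in> sets M"
    and ap: "\<And>\<eta>. 0 < \<eta> \<Longrightarrow> \<exists>A\<in>\<A>. measure M (sym_diff A B) < \<eta>"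
  shows "\<exists>A\<in>\<A>. sym_diff A B \<in> null_sets M"
proof -
  interpret prob_space M by fact
  interpret S: sigma_algebra "space M" \<A> by fact
  have "\<forall>m::nat. \<exists>A. A \<in> \<A> \<and> prob (sym_diff A B) < (1/2) ^ m" using ap by (simp add: Bex_def)
  from choice[OF this] obtain A where A: "\<And>m::nat. A m \<in> \<A>" "\<And>m. prob (sym_diff (A m) B) < (1/2) ^ m" by blast
  define L where "L = (\<Inter>n. \<Union>m\<in>{n..}. A m)"
  have "L \<in> \<A>" unfolding L_def using A by (intro S.countable_INT S.countable_UN') auto
  have AM: "A m \<in> sets M" for m using A(1) S(2) by auto
  have LM: "L \<in> sets M" using \<open>L \<in> \<A>\<close> S(2) by auto
  have bound: "prob (sym_diff L B) \<le> 2 * (1/2) ^ n" for n :: nat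
  proof -
    let ?D = "\<Union>i. sym_diff (A (n + i)) B"
    have "sym_diff L B \<subseteq> ?D"
    proof
      fix x assume x: "x \<in> sym_diff L B"
      show "x \<in> ?D"
      proof (cases "x \<in> B")
        case True
        then obtain n' where n': "\<And>m. m \<ge> n' \<Longrightarrow> x \<notin> A m" using x by (auto simp: L_def)
        have "x \<notin> A (n + n')" by (rule n') simp
        then show ?thesis using True by blast
      next
        case False
        then obtain m where "m \<ge> n" "x \<in> A m" using x by (auto simp: L_def)
        then have "x \<in> sym_diff (A (n + (m - n))) B" using False by simp
        then show ?thesis by blast
      qed
    qed
    then have "prob (sym_diff L B) \<le> prob ?D" using AM B by (intro finite_measure_mono) auto
    also have "\<dots> \<le> 2 * (1/2) ^ n"
    proof (rule prob_UN_geometric_le)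
      show "sym_diff (A (n + i)) B \<in> sets M" for i using AM B by auto
      show "prob (sym_diff (A (n + i)) B) \<le> (1/2) ^ n * (1/2) ^ i" for i
        using A(2)[of "n + i"] by (simp add: power_add)
    qed
    finally show ?thesis .
  qed
  have "(\<lambda>n. 2 * (1/2) ^ n :: real) \<longlonglongrightarrow> 0" by real_asymp
  then have "prob (sym_diff L B) \<le> 0" by (rule LIMSEQ_le_const) (use bound in blast)
  then have "prob (sym_diff L B) = 0" using measure_nonneg[of M "sym_diff L B"] by linarith
  moreover have "sym_diff L B \<in> sets M" using LM B by auto
  ultimately have "sym_diff L B \<in> null_sets M" by (simp add: null_sets_def emeasure_eq_measure)
  then show ?thesis using \<open>L \<in> \<A>\<close> by blast
qed

lemma sigma_sets_approximable_modulo_null: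
  assumes S: "sigma_algebra (space M) \<A>" "\<A> \<subseteq> sets M" and \<G>: "\<G> \<subseteq> sets M"
    and gen: "\<And>U. U \<in> \<G> \<Longrightarrow> \<exists>A\<in>\<A>. sym_diff A U \<in> null_sets M"
    and B: "B \<in> sigma_sets (space M) \<G>"
  shows "\<exists>A\<in>\<A>. sym_diff A B \<in> null_sets M"
  using B
proof induction
  interpret S: sigma_algebra "space M" \<A> by fact
  case Empty
  show ?case by (intro bexI[of _ "{}"]) auto
next
  case (Compl B)
  interpret S: sigma_algebra "space M" \<A> by fact
  obtain A where A: "A \<in> \<A>" "sym_diff A B \<in> null_sets M" using Compl by blast
  have "B \<subseteq> space M"
    using Compl(1) \<G> sets.sets_into_space sigma_sets_into_sp[of \<G> "space M" B] by blast
  moreover have "A \<subseteq> space M" using A S(2) sets.sets_into_space by blast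
  ultimately have "sym_diff (space M - A) (space M - B) = sym_diff A B" by blast
  then show ?case using A by (intro bexI[of _ "space M - A"]) auto
next
  case (Union B)
  interpret S: sigma_algebra "space M" \<A> by fact
  from Union have "\<forall>i. \<exists>A. A \<in> \<A> \<and> sym_diff A (B i) \<in> null_sets M" by blast
  from choice[OF this] obtain A where A: "\<And>i::nat. A i \<in> \<A>" "\<And>i. sym_diff (A i) (B i) \<in> null_sets M" by blast
  have Bi: "B i \<in> sets M" for i
    using Union(1)[of i] \<G> by (metis sets.sigma_sets_subset subsetD)
  have "(\<Union>i. sym_diff (A i) (B i)) \<in> null_sets M" using A by (intro null_sets_UN') auto
  moreover have "sym_diff (\<Union>i. A i) (\<Union>i. B i) \<in> sets M" using A(1) S(2) Bi by (intro sets.Un sets.Diff sets.countable_UN) auto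
  ultimately have "sym_diff (\<Union>i. A i) (\<Union>i. B i) \<in> null_sets M" by (rule null_sets_subset) blast
  then show ?case using A(1) by (intro bexI[of _ "\<Union>i. A i"]) auto
qed (rule gen)

section \<open>Labelled partitions as simple functions\<close>

definition label :: "nat \<Rightarrow> (nat \<Rightarrow> 'a set) \<Rightarrow> 'a \<Rightarrow> nat" where
  "label a P x = (THE i. i < a \<and> x \<in> P i)"

text \<open>Inverse to \<open>label\<close> on \<open>space M\<close>; the restriction is there
  because labelled partitions are extensional functions.\<close>

definition level_sets :: "'a measure \<Rightarrow> nat \<Rightarrow> ('a \<Rightarrow> nat) \<Rightarrow> nat \<Rightarrow> 'a set" where
  "level_sets M a p = restrict (\<lambda>i. {x \<in> space M. p x = i}) {..<a}"

lemma label_eqI: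
  assumes "P \<in> labelled_partitions M a" "i < a" "x \<in> P i" shows "label a P x = i"
  unfolding label_def using assms by (intro the_equality) (auto simp: labelled_partitions_def disjoint_family_on_def)

lemma label_mem:
  assumes P: "P \<in> labelled_partitions M a" and x: "x \<in> space M"
  shows "label a P x < a" "x \<in> P (label a P x)"
proof -
  have "x \<in> (\<Union>i<a. P i)" using P x by (simp add: labelled_partitions_def)
  then obtain i where "i < a" "x \<in> P i" by blast
  then show "label a P x < a" "x \<in> P (label a P x)" using label_eqI[OF P] by auto
qed

lemma label_iff:
  assumes "P \<in> labelled_partitions M a" "x \<in> space M" "i < a"
  shows "label a P x = i \<longleftrightarrow> x \<in> P i"
  using label_eqI[OF assms(1,3)] label_mem[OF assms(1,2)] by auto

context mp_system begin

lemma simple_label: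
  assumes P: "P \<in> labelled_partitions M a" shows "simple (label a P)"
  unfolding simple_function_def
proof (intro conjI ballI)
  show "finite (label a P ` space M)"
    by (rule finite_subset[of _ "{..<a}"]) (use label_mem[OF P] in auto)
  fix i assume "i \<in> label a P ` space M"
  then have i: "i < a" using label_mem[OF P] by auto
  have "label a P -` {i} \<inter> space M = P i"
    using label_iff[OF P _ i] sets.sets_into_space[OF labelled_partitions_sets[OF P i]] by auto
  then show "label a P -` {i} \<inter> space M \<in> sets M" using labelled_partitions_sets[OF P i] by simp
qed

lemma label_image: "P \<in> labelled_partitions M a \<Longrightarrow> label a P ` space M \<subseteq> {..<a}"
  using label_mem by auto

lemma level_sets_partition:
  assumes "simple p" "p ` space M \<subseteq> {..<a}"
  shows "level_sets M a p \<in> labelled_partitions M a"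
  using simple_level_set[OF assms(1)] assms(2)
  by (auto simp: labelled_partitions_def level_sets_def disjoint_family_on_def)

lemma label_level_sets:
  assumes p: "simple p" "p ` space M \<subseteq> {..<a}" and x: "x \<in> space M"
  shows "label a (level_sets M a p) x = p x"
  using p x by (intro label_eqI[OF level_sets_partition[OF p]]) (auto simp: level_sets_def)

lemma join_entropy_eq_ent:
  assumes P: "P \<in> labelled_partitions M a"
  shows "join_entropy b M T a P n = ent (names (label a P) 0 n)"
proof -
  let ?X = "\<lambda>x. restrict (\<lambda>i. label a P ((T ^^ i) x)) {..<n}" and ?W = "{..<n} \<rightarrow>\<^sub>E {..<a}"
  note sN = simple_names[OF simple_label[OF P], of 0 n]
  have X_names: "?X x = restrict (\<lambda>i. names (label a P) 0 n x ! i) {..<n}" for x by (auto simp: restrict_def)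
  have sX: "simple ?X"
    by (rule simple_factor[where f="\<lambda>l. restrict (\<lambda>i. l ! i) {..<n}", OF sN]) (rule X_names)
  have names_X: "names (label a P) 0 n x = map (?X x) [0..<n]" for x by (auto simp: names_def)
  have "ent (names (label a P) 0 n) = ent ?X"
    by (rule ent_eqI[where f="\<lambda>l. restrict (\<lambda>i. l ! i) {..<n}" and g="\<lambda>w. map w [0..<n]", OF sN])
      (rule X_names names_X)+
  also have "\<dots> = - (\<Sum>w\<in>?W. prob {y \<in> space M. ?X y = w} * log b (prob {y \<in> space M. ?X y = w}))"
  proof (rule ent_eq_sum[OF sX])
    show "finite ?W" by (intro finite_PiE) auto
    show "?X ` space M \<subseteq> ?W" by (intro image_subsetI) (simp add: restrict_PiE_iff label_mem[OF P])
  qed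
  also have "\<dots> = join_entropy b M T a P n"
    unfolding join_entropy_def
  proof (rule arg_cong[where f=uminus], rule sum.cong[OF refl])
    fix w assume w: "w \<in> ?W"
    have "?X y = w \<longleftrightarrow> (\<forall>i<n. (T ^^ i) y \<in> P (w i))" if y: "y \<in> space M" for y
    proof -
      have "?X y = w \<longleftrightarrow> (\<forall>i<n. label a P ((T ^^ i) y) = w i)"
        using w by (auto simp: fun_eq_iff PiE_iff extensional_def)
      also have "\<dots> \<longleftrightarrow> (\<forall>i<n. (T ^^ i) y \<in> P (w i))"
        using w y label_iff[OF P, of "(T ^^ _) y"] by (auto simp: PiE_iff)
      finally show ?thesis .
    qed
    then have "{y \<in> space M. ?X y = w} = join_atom M T P n w" by (auto simp: join_atom_def)
    then show "prob {y \<in> space M. ?X y = w} * log b (prob {y \<in> space M. ?X y = w})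
        = prob (join_atom M T P n w) * log b (prob (join_atom M T P n w))" by simp
  qed
  finally show ?thesis ..
qed

lemma process_entropy_eq_rate:
  "P \<in> labelled_partitions M a \<Longrightarrow> process_entropy b M T a P = rate (label a P)"
  by (simp add: process_entropy_def rate_def join_entropy_eq_ent)

lemma rate_cong:
  assumes "\<And>x. x \<in> space M \<Longrightarrow> p x = q x" shows "rate p = rate q"
proof -
  have "ent (names p 0 n) = ent (names q 0 n)" for n
    by (rule ent_cong) (simp add: names_def assms)
  then show ?thesis by (simp add: rate_def)
qed

text \<open>A point with different labels lies in exactly two of the symmetric differences, which
  the factor 1/2 in the metric compensates.\<close>

lemma tuple_dist_eq_prob:
  assumes P: "P \<in> labelled_partitions M a" and Q: "Q \<in> labelled_partitions M a"
  shows "tuple_dist M a P Q = prob (differ (label a P) (label a Q))"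
proof -
  have half: "(\<Sum>i<a. prob (P i - Q i)) = prob (differ (label a P) (label a Q))"
    if P: "P \<in> labelled_partitions M a" and Q: "Q \<in> labelled_partitions M a" for P Q
  proof -
    have "disjoint_family_on P {..<a}" using P by (simp add: labelled_partitions_def)
    then have "disjoint_family_on (\<lambda>i. P i - Q i) {..<a}" unfolding disjoint_family_on_def by blast
    then have "(\<Sum>i<a. prob (P i - Q i)) = prob (\<Union>i<a. P i - Q i)"
      using labelled_partitions_sets[OF P] labelled_partitions_sets[OF Q]
      by (intro finite_measure_finite_Union[symmetric]) auto
    also have "(\<Union>i<a. P i - Q i) = differ (label a P) (label a Q)"
    proof (intro equalityI subsetI)
      fix x assume "x \<in> (\<Union>i<a. P i - Q i)"
      then obtain i where i: "i < a" "x \<in> P i" "x \<notin> Q i" by blast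
      then have "x \<in> space M" using sets.sets_into_space[OF labelled_partitions_sets[OF P]] by blast
      then show "x \<in> differ (label a P) (label a Q)"
        using i label_iff[OF P \<open>x \<in> space M\<close> i(1)] label_iff[OF Q \<open>x \<in> space M\<close> i(1)] by simp
    next
      fix x assume "x \<in> differ (label a P) (label a Q)"
      then have x: "x \<in> space M" "label a P x \<noteq> label a Q x" by auto
      then have "x \<in> P (label a P x) - Q (label a P x)"
        using label_mem[OF P x(1)] label_iff[OF Q x(1) label_mem(1)[OF P x(1)]] by auto
      then show "x \<in> (\<Union>i<a. P i - Q i)" using label_mem(1)[OF P x(1)] by blast
    qed
    finally show ?thesis .
  qed
  have "(\<Sum>i<a. prob (sym_diff (P i) (Q i))) = (\<Sum>i<a. prob (P i - Q i) + prob (Q i - P i))"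
    using labelled_partitions_sets[OF P] labelled_partitions_sets[OF Q]
    by (intro sum.cong finite_measure_Union refl) auto
  also have "\<dots> = 2 * prob (differ (label a P) (label a Q))"
    using half[OF P Q] half[OF Q P] by (simp add: sum.distrib eq_commute[of "label a Q _"])
  finally show ?thesis by (simp add: tuple_dist_def)
qed

text \<open>A window takes finitely many values, so a level set is a finite union of cylinders, each
  a finite intersection of translates of partition elements.\<close>

lemma finite_factor_level_set:
  assumes P: "P \<in> labelled_partitions M a" and r: "finite_factor (label a P) r"
  shows "{x \<in> space M. r x = c} \<in> sigma_sets (space M) {int_iterate M T n -` P i \<inter> space M | n i. i < a}"
    (is "_ \<in> sigma_sets _ ?\<G>")
proof -
  have "?\<G> \<subseteq> Pow (space M)" by auto
  then interpret S: sigma_algebra "space M" "sigma_sets (space M) ?\<G>" by (rule sigma_algebra_sigma_sets)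
  obtain N \<psi> where \<psi>: "\<And>x. x \<in> space M \<Longrightarrow> r x = \<psi> (names (label a P) 0 (2 * N + 1) ((Ti ^^ N) x))"
    using r unfolding finite_factor_def by blast
  let ?m = "2 * N + 1"
  define D where "D j i = {x \<in> space M. label a P ((T ^^ j) ((Ti ^^ N) x)) = i}" for j i
  have it: "(T ^^ j) ((Ti ^^ N) x) = int_iterate M T (int j - int N) x" if "x \<in> space M" for j x
  proof (cases "N \<le> j")
    case True
    then have "nat (int j - int N) = j - N" by simp
    then show ?thesis using True that by (simp add: int_iterate_def Tn_Tin_ge)
  next
    case False
    then have "nat (- (int j - int N)) = N - j" by simp
    then show ?thesis using False that by (simp add: int_iterate_def Tn_Tin_le)
  qed
  have D: "D j i \<in> sigma_sets (space M) ?\<G>" if "i < a" for j i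
  proof -
    have "D j i = int_iterate M T (int j - int N) -` P i \<inter> space M"
    proof (rule set_eqI)
      fix x
      show "x \<in> D j i \<longleftrightarrow> x \<in> int_iterate M T (int j - int N) -` P i \<inter> space M"
      proof (cases "x \<in> space M")
        case True
        let ?y = "(T ^^ j) ((Ti ^^ N) x)"
        have "?y \<in> space M" using True by (intro Tn_space)
        then have "label a P ?y = i \<longleftrightarrow> ?y \<in> P i" by (rule label_iff[OF P _ that])
        moreover have "x \<in> D j i \<longleftrightarrow> label a P ?y = i" using True unfolding D_def mem_Collect_eq by (simp only: simp_thms)
        ultimately show ?thesis using True unfolding it[OF True, of j] Int_iff vimage_eq by (simp only: simp_thms)
      qed (simp only: D_def Int_iff mem_Collect_eq simp_thms)
    qed
    then show ?thesis using that by (intro sigma_sets.Basic) blast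
  qed
  let ?L = "{l. set l \<subseteq> {..<a} \<and> length l = ?m \<and> \<psi> l = c}"
  have "finite ?L" by (rule finite_subset[OF _ finite_lists_length_eq[of "{..<a}" ?m]]) auto
  have "{x \<in> space M. r x = c} = (\<Union>l\<in>?L. \<Inter>j\<in>{..<?m}. D j (l ! j))"
  proof (intro equalityI subsetI)
    fix x assume "x \<in> {x \<in> space M. r x = c}"
    then have x: "x \<in> space M" "r x = c" by auto
    let ?l = "names (label a P) 0 ?m ((Ti ^^ N) x)"
    have "set ?l \<subseteq> {..<a}" using label_mem(1)[OF P] x by (auto simp: names_def)
    then have "?l \<in> ?L" using x \<psi> by simp
    moreover have "x \<in> D j (?l ! j)" if "j < ?m" for j using that x by (simp add: D_def)
    ultimately show "x \<in> (\<Union>l\<in>?L. \<Inter>j\<in>{..<?m}. D j (l ! j))" by blast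
  next
    fix x assume "x \<in> (\<Union>l\<in>?L. \<Inter>j\<in>{..<?m}. D j (l ! j))"
    then obtain l where l: "l \<in> ?L" "\<And>j. j < ?m \<Longrightarrow> x \<in> D j (l ! j)" by blast
    have x: "x \<in> space M" using l(2)[of 0] by (simp add: D_def)
    have "names (label a P) 0 ?m ((Ti ^^ N) x) = l"
      by (rule nth_equalityI) (use l in \<open>auto simp: D_def\<close>)
    then show "x \<in> {x \<in> space M. r x = c}" using x \<psi>[OF x] l by simp
  qed
  also have "\<dots> \<in> sigma_sets (space M) ?\<G>"
  proof (intro S.finite_UN \<open>finite ?L\<close> S.finite_INT)
    fix l j assume "l \<in> ?L" "j \<in> {..<?m}"
    then have "l ! j \<in> set l" "set l \<subseteq> {..<a}" by auto
    then show "D j (l ! j) \<in> sigma_sets (space M) ?\<G>" by (intro D) auto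
  qed auto
  finally show ?thesis .
qed

end

context finite_entropy_system begin

lemma generator_if_approximates:
  assumes P: "P \<in> labelled_partitions M a" and U: "\<And>k::nat. U k \<in> sets M"
    and dense: "\<And>B. B \<in> sets M \<Longrightarrow> \<exists>B0\<in>sigma_sets (space M) (range U). sym_diff B0 B \<in> null_sets M"
    and ap: "\<And>k \<eta>. 0 < \<eta> \<Longrightarrow> approximates (label a P) (U k) \<eta>"
  shows "generator M T a P"
  unfolding generator_def
proof
  let ?\<G> = "{int_iterate M T n -` P i \<inter> space M | n i. i < a}"
  let ?\<A> = "sigma_sets (space M) ?\<G>"
  have G: "?\<G> \<subseteq> sets M"
  proof
    fix A assume "A \<in> ?\<G>"
    then obtain n i where A: "A = int_iterate M T n -` P i \<inter> space M" "i < a" by blast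
    have "int_iterate M T n \<in> measurable M M" by (simp add: int_iterate_def)
    then show "A \<in> sets M" using A labelled_partitions_sets[OF P A(2)] by (simp add: measurable_sets)
  qed
  have "?\<G> \<subseteq> Pow (space M)" by auto
  then have S: "sigma_algebra (space M) ?\<A>" by (rule sigma_algebra_sigma_sets)
  have AM: "?\<A> \<subseteq> sets M" using G by (rule sets.sigma_sets_subset)
  have gen: "\<exists>A\<in>?\<A>. sym_diff A (U k) \<in> null_sets M" for k
  proof (rule approximable_modulo_null[OF prob_space_axioms S AM U])
    fix \<eta> :: real assume "0 < \<eta>"
    then obtain r :: "'a \<Rightarrow> nat" where r: "finite_factor (label a P) r" "prob {x \<in> space M. of_bool (x \<in> U k) \<noteq> r x} < \<eta>"
      using ap[of \<eta> k] unfolding approximates_def by blast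
    let ?A = "{x \<in> space M. r x = 1}"
    have ne: "{x \<in> space M. of_bool (x \<in> U k) \<noteq> r x} \<in> sets M"
      by (rule differ_sets[OF simple_of_bool[OF U[of k]]
        simple_finite_factor[OF simple_label[OF P] r(1)]])
    have "sym_diff ?A (U k) \<subseteq> {x \<in> space M. of_bool (x \<in> U k) \<noteq> r x}"
      using sets.sets_into_space[OF U[of k]] by auto
    then have "prob (sym_diff ?A (U k)) \<le> prob {x \<in> space M. of_bool (x \<in> U k) \<noteq> r x}"
      using ne by (intro finite_measure_mono)
    then have "prob (sym_diff ?A (U k)) < \<eta>" using r(2) by linarith
    moreover have "?A \<in> ?\<A>" by (rule finite_factor_level_set[OF P r(1)])
    ultimately show "\<exists>A\<in>?\<A>. prob (sym_diff A (U k)) < \<eta>" by blast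
  qed
  fix B assume B: "B \<in> sets M"
  obtain B0 where B0: "B0 \<in> sigma_sets (space M) (range U)" "sym_diff B0 B \<in> null_sets M" using dense[OF B] by blast
  have "range U \<subseteq> sets M" using U by auto
  then have "\<exists>A\<in>?\<A>. sym_diff A B0 \<in> null_sets M"
    using gen by (intro sigma_sets_approximable_modulo_null[OF S AM _ _ B0(1)]) auto
  then obtain A where A: "A \<in> ?\<A>" "sym_diff A B0 \<in> null_sets M" by blast
  have "sym_diff A B0 \<union> sym_diff B0 B \<in> null_sets M" by (rule null_sets.Un[OF A(2) B0(2)])
  moreover have "sym_diff A B \<in> sets M" using A(1) AM B by blast
  ultimately have "sym_diff A B \<in> null_sets M" by (rule null_sets_subset) blast
  then show "\<exists>A\<in>?\<A>. sym_diff A B \<in> null_sets M" using A(1) by blast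
qed

lemma generic_generator:
  fixes a :: nat and U :: "nat \<Rightarrow> 'a set"
  assumes a: "2 \<le> a" and h: "h < log b (real a)" and U: "\<And>k::nat. U k \<in> sets M"
    and dense: "\<And>B. B \<in> sets M \<Longrightarrow> \<exists>B0\<in>sigma_sets (space M) (range U). sym_diff B0 B \<in> null_sets M"
  shows "\<exists>G. gdelta_in (full_entropy_space b M T a h) G \<and>
             full_entropy_space b M T a h closure_of G = full_entropy_classes b M T a h \<and>
             (\<forall>C\<in>G. \<forall>P\<in>C. generator M T a P)"
proof -
  interpret MS: Metric_space "partition_classes M a" "partition_dist M a"
    by (rule Metric_space_partition_classes[OF prob_space_axioms])
  note eqv = equiv_partition_rel[OF prob_space_axioms, of a]
  let ?cls = "\<lambda>P. partition_rel M a `` {P}" and ?LP = "labelled_partitions M a"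
  define X where "X = full_entropy_space b M T a h"
  define S where "S = full_entropy_classes b M T a h"
  have X: "X = subtopology MS.mtopology S"
    by (simp add: X_def S_def full_entropy_space_def partition_topology_def)
  have S_sub: "S \<subseteq> partition_classes M a"
    by (auto simp: S_def full_entropy_classes_def partition_classes_def quotientI)
  have topX: "topspace X = S" using S_sub by (auto simp: X)
  have mem_LP: "P \<in> ?LP" "?cls P = C" if C: "C \<in> partition_classes M a" and P: "P \<in> C" for C P
  proof -
    obtain P0 where P0: "P0 \<in> ?LP" "C = ?cls P0"
      using C unfolding partition_classes_def by (rule quotientE)
    then show "P \<in> ?LP" using P by (auto simp: partition_rel_def)
    show "?cls P = C" using P P0 equiv_class_eq[OF eqv, of P0 P] by auto
  qed
  have dist: "partition_dist M a C D = prob (differ (label a P) (label a Q))"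
    if "C \<in> partition_classes M a" "D \<in> partition_classes M a" "P \<in> C" "Q \<in> D" for C D P Q
    using partition_dist_class[OF prob_space_axioms mem_LP(1)[OF that(1,3)] mem_LP(1)[OF that(2,4)]]
      tuple_dist_eq_prob[OF mem_LP(1)[OF that(1,3)] mem_LP(1)[OF that(2,4)]]
      mem_LP(2)[OF that(1,3)] mem_LP(2)[OF that(2,4)] by simp
  have ne: "\<exists>P. P \<in> C" if "C \<in> partition_classes M a" for C
    using that in_quotient_imp_non_empty[OF eqv] unfolding partition_classes_def by blast
  \<comment> \<open>Quantifying over all representatives makes this a condition on the class
    itself.\<close>
  define W where "W k m = {C \<in> partition_classes M a. \<forall>P\<in>C. approximates (label a P) (U k) (1 / real (Suc m))}" for k m
  have W_open: "openin MS.mtopology (W k m)" for k m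
    unfolding MS.openin_mtopology
  proof (intro conjI allI impI)
    show "W k m \<subseteq> partition_classes M a" by (auto simp: W_def)
    fix C assume C: "C \<in> W k m"
    then have Cc: "C \<in> partition_classes M a" by (simp add: W_def)
    obtain P where P: "P \<in> C" using ne[OF Cc] by blast
    have "approximates (label a P) (U k) (1 / real (Suc m))" using C P by (simp add: W_def)
    from approximates_stable[OF simple_label[OF mem_LP(1)[OF Cc P]] U this]
    obtain \<rho> where "0 < \<rho>" and \<rho>: "\<And>p'. simple p' \<Longrightarrow>
      prob (differ (label a P) p') < \<rho> \<Longrightarrow> approximates p' (U k) (1 / real (Suc m))" by blast
    have "MS.mball C \<rho> \<subseteq> W k m"
    proof
      fix D assume "D \<in> MS.mball C \<rho>"
      then have D: "D \<in> partition_classes M a" "partition_dist M a C D < \<rho>" by (auto simp: MS.in_mball)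
      have "approximates (label a Q) (U k) (1 / real (Suc m))" if Q: "Q \<in> D" for Q
        using D(2) dist[OF Cc D(1) P Q] by (intro \<rho> simple_label[OF mem_LP(1)[OF D(1) Q]]) simp
      then show "D \<in> W k m" using D by (simp add: W_def)
    qed
    then show "\<exists>r>0. MS.mball C r \<subseteq> W k m" using \<open>0 < \<rho>\<close> by blast
  qed
  define G where "G = (\<Inter>km. W (fst km) (snd km) \<inter> S)"
  have "gdelta_in X G"
    unfolding G_def
  proof (rule gdelta_in_Inter)
    fix V assume "V \<in> range (\<lambda>km. W (fst km) (snd km) \<inter> S)"
    then obtain km where "V = W (fst km) (snd km) \<inter> S" by blast
    then have "openin X V" unfolding X openin_subtopology using W_open by blast
    then show "gdelta_in X V" by (rule open_imp_gdelta_in)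
  qed auto
  moreover have "X closure_of G = S"
  proof
    show "X closure_of G \<subseteq> S" using closure_of_subset_topspace[of X G] topX by simp
    show "S \<subseteq> X closure_of G"
    proof
      fix C assume C: "C \<in> S"
      then obtain P where P: "P \<in> ?LP" "process_entropy b M T a P = h" "C = ?cls P"
        by (auto simp: S_def full_entropy_classes_def)
      have Cc: "C \<in> partition_classes M a" using C S_sub by blast
      have PC: "P \<in> C" using equiv_class_self[OF eqv P(1)] P(3) by simp
      have "\<exists>D\<in>G. D \<in> V" if V: "C \<in> V" "openin X V" for V
      proof -
        obtain V' where V': "openin MS.mtopology V'" "V = V' \<inter> S" using V(2) by (auto simp: X openin_subtopology)
        then obtain e where "0 < e" and e: "MS.mball C e \<subseteq> V'" using V by (auto simp: MS.openin_mtopology)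
        have "0 < e / 2" using \<open>0 < e\<close> by simp
        have rP: "rate (label a P) = h" using process_entropy_eq_rate[OF P(1)] P(2) by simp
        \<comment> \<open>Along \<open>prod_decode\<close> every k recurs at arbitrarily large s,
          where the error bound is arbitrarily small; so each \<open>U k\<close> is approximated to
          every accuracy.\<close>
        obtain p' where p': "simple p'" "p' ` space M \<subseteq> {..<a}" "rate p' = h"
          "prob (differ (label a P) p') \<le> e / 2"
          "\<And>s. approximates p' (U (fst (prod_decode s))) (1 / real (Suc s) + e / 2 * (1/2) ^ s)"
          using approximating_limit[OF a h \<open>0 < e / 2\<close> simple_label[OF P(1)] label_image[OF P(1)] rP,
            of "\<lambda>s. U (fst (prod_decode s))" "\<lambda>s. 1 / real (Suc s)"] U by auto
        define Q where "Q = level_sets M a p'"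
        define D where "D = ?cls Q"
        have Q: "Q \<in> ?LP" unfolding Q_def by (rule level_sets_partition[OF p'(1,2)])
        have lQ: "label a Q x = p' x" if "x \<in> space M" for x
          unfolding Q_def by (rule label_level_sets[OF p'(1,2) that])
        have Dc: "D \<in> partition_classes M a" using Q by (simp add: D_def partition_classes_def quotientI)
        have QD: "Q \<in> D" using equiv_class_self[OF eqv Q] by (simp add: D_def)
        have "process_entropy b M T a Q = h"
          using process_entropy_eq_rate[OF Q] rate_cong[of "label a Q" p'] lQ p'(3) by simp
        then have DS: "D \<in> S" using Q by (auto simp: S_def full_entropy_classes_def D_def)
        have "differ (label a P) (label a Q) = differ (label a P) p'" using lQ by auto
        then have "partition_dist M a C D \<le> e / 2" using dist[OF Cc Dc PC QD] p'(4) by simp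
        then have DV: "D \<in> V" using e V'(2) Cc Dc DS \<open>0 < e\<close> by (auto simp: MS.in_mball)
        have appr: "approximates p' (U k) \<eta>" if "0 < \<eta>" for k \<eta>
        proof -
          have "(\<lambda>s. 1 / real (Suc s) + e / 2 * (1/2) ^ s) \<longlonglongrightarrow> 0" by real_asymp
          then have "\<forall>\<^sub>F s in sequentially. 1 / real (Suc s) + e / 2 * (1/2) ^ s < \<eta>"
            using that by (rule order_tendstoD(2))
          then obtain s0 where s0: "\<And>s. s \<ge> s0 \<Longrightarrow> 1 / real (Suc s) + e / 2 * (1/2) ^ s < \<eta>"
            by (auto simp: eventually_sequentially)
          define s where "s = prod_encode (k, s0)"
          have "s \<ge> s0" unfolding s_def by (rule le_prod_encode_2)
          have "approximates p' (U k) (1 / real (Suc s) + e / 2 * (1/2) ^ s)" using p'(5)[of s] by (simp add: s_def)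
          then show ?thesis unfolding approximates_def using s0[OF \<open>s \<ge> s0\<close>] less_trans by blast
        qed
        have "D \<in> W k m" for k m
        proof -
          \<comment> \<open>Another representative has distance 0 from \<open>Q\<close>, so
            stability of the approximation carries over to it.\<close>
          have "approximates (label a R) (U k) (1 / real (Suc m))" if R: "R \<in> D" for R
          proof -
            have RL: "R \<in> ?LP" by (rule mem_LP(1)[OF Dc R])
            have "approximates p' (U k) (1 / real (Suc m))" by (rule appr) simp
            from approximates_stable[OF p'(1) U this] obtain \<rho> where "0 < \<rho>" and
              \<rho>: "\<And>p''. simple p'' \<Longrightarrow> prob (differ p' p'') < \<rho> \<Longrightarrow> approximates p'' (U k) (1 / real (Suc m))"
              by blast
            have "partition_dist M a D D = 0" using Dc by simp
            then have "prob (differ (label a Q) (label a R)) = 0" using dist[OF Dc Dc QD R] by simp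
            moreover have "differ (label a Q) (label a R) = differ p' (label a R)" using lQ by auto
            ultimately show ?thesis using \<open>0 < \<rho>\<close> by (intro \<rho> simple_label[OF RL]) simp
          qed
          then show ?thesis using Dc by (simp add: W_def)
        qed
        then have "D \<in> G" using DS by (auto simp: G_def)
        then show ?thesis using DV by blast
      qed
      then show "C \<in> X closure_of G" using C topX by (auto simp: in_closure_of)
    qed
  qed
  moreover have "generator M T a P" if C: "C \<in> G" and P: "P \<in> C" for C P
  proof -
    have CS: "C \<in> S" and CW: "\<And>k m. C \<in> W k m" using C by (auto simp: G_def)
    have Cc: "C \<in> partition_classes M a" using CS S_sub by blast
    show ?thesis
    proof (rule generator_if_approximates[OF mem_LP(1)[OF Cc P] U dense])
      fix k and \<eta> :: real assume "0 < \<eta>"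
      then obtain m where m: "inverse (real (Suc m)) < \<eta>" using reals_Archimedean by blast
      have "approximates (label a P) (U k) (1 / real (Suc m))" using CW[of k m] P by (simp add: W_def)
      then show "approximates (label a P) (U k) \<eta>"
        unfolding approximates_def using m less_trans unfolding inverse_eq_divide by blast
    qed
  qed
  ultimately show ?thesis unfolding X_def S_def by blast
qed

end

theorem theorem8:
  fixes M :: "'a measure" and T :: "'a \<Rightarrow> 'a" and a :: nat and b h :: real
  assumes "2 \<le> a"
    and "1 < b"
    and "standard_prob_space M"
    and "invertible_mpt M T"
    and "ergodic M T"
    and "aperiodic M T"
    and "system_entropy b M T = ereal h"
    and "h < log b (real a)"
  shows "\<exists>G. gdelta_in (full_entropy_space b M T a h) G \<and>
             full_entropy_space b M T a h closure_of G = full_entropy_classes b M T a h \<and>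
             (\<forall>C\<in>G. \<forall>P\<in>C. generator M T a P)"
proof -
  interpret prob_space M using assms(3) by (simp add: standard_prob_space_def)
  interpret mp_system M b T using assms(2,4) by unfold_locales
  obtain U :: "nat \<Rightarrow> 'a set" where U: "\<And>k. U k \<in> sets M"
    and sep: "\<And>x y. x \<in> space M \<Longrightarrow> y \<in> space M \<Longrightarrow> x \<noteq> y \<Longrightarrow> \<exists>k. x \<in> U k \<and> y \<notin> U k"
    and dense: "\<And>B. B \<in> sets M \<Longrightarrow> \<exists>B0\<in>sigma_sets (space M) (range U). sym_diff B0 B \<in> null_sets M"
    using standard_prob_space_base[OF assms(3)] by blast
  note SUP = assms(7)[unfolded system_entropy_def]
  interpret finite_entropy_system M b T h
  proof unfold_locales
    show "ergodic M T" by fact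
    show "\<exists>A\<in>sets M. 0 < prob A \<and> prob A < \<delta>" if "0 < \<delta>" for \<delta>
      by (rule small_sets[OF U sep assms(6) that])
    show "rate z \<le> h" if z: "simple_function M z" "z ` space M \<subseteq> {..<K}" for z and K :: nat
    proof -
      have "rate z = process_entropy b M T K (level_sets M K z)"
        using process_entropy_eq_rate[OF level_sets_partition[OF z]]
          rate_cong[of "label K (level_sets M K z)" z] label_level_sets[OF z] by simp
      \<comment> \<open>A simple function into the first K numbers is a labelled partition, so its
        rate is one of the values in the supremum defining the system entropy.\<close>
      also have "ereal \<dots> \<le> ereal h"
        unfolding SUP[symmetric] using level_sets_partition[OF z]
        by (intro SUP_upper2[of "(K, level_sets M K z)"]) auto
      finally show ?thesis by simp
    qed
    show "\<exists>z K. simple_function M z \<and> z ` space M \<subseteq> {..<K::nat} \<and> h - \<delta> < rate z" if "0 < \<delta>" for \<delta>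
    proof -
      have "ereal (h - \<delta>) < ereal h" using that by simp
      then obtain k P where P: "P \<in> labelled_partitions M k" "h - \<delta> < process_entropy b M T k P"
        unfolding SUP[symmetric] less_SUP_iff by auto
      then show ?thesis
        using simple_label[OF P(1)] label_image[OF P(1)] process_entropy_eq_rate[OF P(1)] by auto
    qed
  qed
  show ?thesis by (rule generic_generator[OF assms(1,8) U dense])
qed

end
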